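(* Let $n\geq2$, $m\geq1$ be integers, $\alpha,\beta\in\mathbb{C}$, $T=J_n(\alpha)\oplus\beta I_m\in M_{n+m}(\mathbb{C})$, $k\in\{1,\ldots,n+m\}$, and let $\psi\in\mathbb{R}$ satisfy $\beta-\alpha=|\beta-\alpha|e^{i\psi}$. Then: (1) if $1\leq k\leq n/2$ and $|\beta-\alpha|\leq\cos\phi_k$: $\Lambda_k(T)=B_{\cos\phi_k}(\alpha)$; (2) if $1\leq k\leq n/2$, $k\leq m$, $|\beta-\alpha|>\cos\phi_k$: $\Lambda_k(T)=B_{\cos\phi_k}(\alpha)\cup(\widetilde E^{\psi}_k\cap R^{\psi}_{|\beta-\alpha|,k})$; (3) if $1\leq k\leq n/2$, $k>m$, $|\beta-\alpha|>\cos\phi_k$: $\Lambda_k(T)=B_{\cos\phi_k}(\alpha)\cup(\widetilde E^{\psi}_k\cap R^{\psi}_{|\beta-\alpha|,k}\cap B_{\cos\psi_{k,m}}(\alpha))$; (4) if $k=\frac{n+1}{2}\leq m$, or $k=\frac{n+1}{2}>m$ and $|\beta-\alpha|\leq\cos\psi_{k,m}$: $\Lambda_k(T)=[\alpha,\beta]$; (5) if $k=\frac{n+1}{2}>m$ and $|\beta-\alpha|>\cos\psi_{k,m}$: $\Lambda_k(T)=\{\alpha+t(\beta-\alpha)\cos\eta_{k,m}:\ t\in[0,1]\}$; (6) if $\frac{n+1}{2}<k\leq m$, or $\frac{n+1}{2}<k$, $m<k$ and $|\beta-\alpha|\leq\cos\psi_{k,m}$: $\Lambda_k(T)=\{\beta\}$;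 (7) if $\frac{n+1}{2}<k$, $m<k$ and $|\beta-\alpha|>\cos\psi_{k,m}$: $\Lambda_k(T)=\emptyset$.
   Context: $J_n(\alpha)$ is the $n\times n$ Jordan block with eigenvalue $\alpha$. For $T\in M_N(\mathbb{C})$, $\Lambda_k(T)=\{\lambda\in\mathbb{C}:\ \text{there is a rank-}k\text{ orthogonal projection }P\text{ with }PTP=\lambda P\}$. $\phi_k=\frac{k\pi}{n+1}$, $\psi_{k,m}=\frac{(k-m)\pi}{n+1}$. $D_k=\{\theta\in\mathbb{R}:\ |\beta-\alpha|\cos\theta\leq\cos\phi_k\}$; $\delta_k=\arccos(\cos\phi_k/|\beta-\alpha|)\in[0,\pi]$ if $\beta\neq\alpha$ and $|\beta-\alpha|\geq|\cos\phi_k|$, and $\delta_k=0$ otherwise; $\eta_{k,m}=\arccos(\cos\psi_{k,m}/|\beta-\alpha|)\in[0,\pi]$ if $k>m$, $\beta\neq\alpha$ and $|\beta-\alpha|\geq|\cos\psi_{k,m}|$, and $\eta_{k,m}=0$ otherwise. $\widetilde E_k=\{\mu\in\mathbb{C}:\ \arg\mu\notin D_k\}$. $B_r(\lambda)$ is the closed disk of radius $r$ centered at $\lambda$ (empty if $r<0$). For $r\geq0$, $R_{r,k}=\{x+iy:\ x\leq r,\ (x-r)\cot\delta_k\leq y\leq(r-x)\cot\delta_k\}$. $\widetilde E^{\psi}_k=\alpha+e^{i\psi}\widetilde E_k$ and $R^{\psi}_{r,k}=\alpha+e^{i\psi}R_{r,k}$. $[\alpha,\beta]=\{(1-t)\alpha+t\beta:\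 t\in[0,1]\}$. *)

theory Defs
  imports "HOL-Analysis.Complex_Transcendental"
    "Jordan_Normal_Form.Jordan_Normal_Form_Existence"
    "Jordan_Normal_Form.DL_Rank"
begin

definition higher_rank_nr :: "nat \<Rightarrow> complex mat \<Rightarrow> complex set" where
  "higher_rank_nr k T = {l. \<exists>P. P \<in> carrier_mat (dim_row T) (dim_row T) \<and>
      mat_adjoint P = P \<and> P * P = P \<and> vec_space.rank (dim_row T) P = k \<and>
      P * T * P = l \<cdot>\<^sub>m P}"

definition Tmat :: "nat \<Rightarrow> nat \<Rightarrow> complex \<Rightarrow> complex \<Rightarrow> complex mat" where
  "Tmat n m \<alpha> \<beta> = four_block_mat (jordan_block n \<alpha>) (0\<^sub>m n m) (0\<^sub>m m n) (\<beta> \<cdot>\<^sub>m 1\<^sub>m m)"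

definition phi :: "nat \<Rightarrow> nat \<Rightarrow> real" where
  "phi n k = real k * pi / (real n + 1)"

definition psi_km :: "nat \<Rightarrow> nat \<Rightarrow> nat \<Rightarrow> real" where
  "psi_km n k m = (real k - real m) * pi / (real n + 1)"

definition Dset :: "nat \<Rightarrow> nat \<Rightarrow> complex \<Rightarrow> complex \<Rightarrow> real set" where
  "Dset n k \<alpha> \<beta> = {\<theta>. cmod (\<beta> - \<alpha>) * cos \<theta> \<le> cos (phi n k)}"

definition delta :: "nat \<Rightarrow> nat \<Rightarrow> complex \<Rightarrow> complex \<Rightarrow> real" where
  "delta n k \<alpha> \<beta> = (if \<beta> \<noteq> \<alpha> \<and> cmod (\<beta> - \<alpha>) \<ge> \<bar>cos (phi n k)\<bar>
      then arccos (cos (phi n k) / cmod (\<beta> - \<alpha>)) else 0)"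

definition eta :: "nat \<Rightarrow> nat \<Rightarrow> nat \<Rightarrow> complex \<Rightarrow> complex \<Rightarrow> real" where
  "eta n k m \<alpha> \<beta> = (if k > m \<and> \<beta> \<noteq> \<alpha> \<and> cmod (\<beta> - \<alpha>) \<ge> \<bar>cos (psi_km n k m)\<bar>
      then arccos (cos (psi_km n k m) / cmod (\<beta> - \<alpha>)) else 0)"

text \<open>widetilde E_k = {mu. arg mu not in D_k} (arg taken as the principal argument Arg;
  D_k is 2pi-periodic, so the choice of branch is irrelevant)\<close>
definition Etilde :: "nat \<Rightarrow> nat \<Rightarrow> complex \<Rightarrow> complex \<Rightarrow> complex set" where
  "Etilde n k \<alpha> \<beta> = {\<mu>. Arg \<mu> \<notin> Dset n k \<alpha> \<beta>}"

definition Rset :: "nat \<Rightarrow> real \<Rightarrow> nat \<Rightarrow> complex \<Rightarrow> complex \<Rightarrow> complex set" where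
  "Rset n r k \<alpha> \<beta> = {z. Re z \<le> r \<and>
      (Re z - r) * cot (delta n k \<alpha> \<beta>) \<le> Im z \<and> Im z \<le> (r - Re z) * cot (delta n k \<alpha> \<beta>)}"

definition Etilde_rot :: "real \<Rightarrow> nat \<Rightarrow> nat \<Rightarrow> complex \<Rightarrow> complex \<Rightarrow> complex set" where
  "Etilde_rot \<psi> n k \<alpha> \<beta> = (\<lambda>\<mu>. \<alpha> + cis \<psi> * \<mu>) ` Etilde n k \<alpha> \<beta>"

definition Rset_rot :: "real \<Rightarrow> nat \<Rightarrow> real \<Rightarrow> nat \<Rightarrow> complex \<Rightarrow> complex \<Rightarrow> complex set" where
  "Rset_rot \<psi> n r k \<alpha> \<beta> = (\<lambda>\<mu>. \<alpha> + cis \<psi> * \<mu>) ` Rset n r k \<alpha> \<beta>"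

end

theory Submission
  imports Defs
begin

text \<open>Write \<open>z = \<lambda> - \<alpha>\<close>, \<open>\<rho> = \<bar>z\<bar>\<close>, \<open>d = \<bar>\<beta> - \<alpha>\<bar>\<close>, \<open>h = \<pi>/(n+1)\<close> and \<open>a\<^sub>j = cos (j h)\<close>. A number \<open>\<lambda>\<close> lies in \<open>\<Lambda>\<^sub>k(T)\<close>
  iff some k-dimensional subspace is isotropic for the form \<open>y\<^sup>* (T - \<lambda>) x\<close>.

  Necessity: a k-dimensional subspace meets the orthogonal complement of any \<open>k - 1\<close> vectors. Taking
  top eigenvectors \<open>(sin (i j h))\<^sub>i\<close> of the rotated real part of \<open>J\<^sub>n\<close>, and possibly the coordinate vectors of the
  \<open>\<beta>\<close>-block, gives the supporting half planes of \<open>\<Lambda>\<^sub>k(T)\<close>.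

  Sufficiency avoids the Li--Sze theorem by explicit subspaces. The pencil \<open>J\<^sub>n(0) - z = \<mu> (J\<^sub>n(0) - z)\<^sup>*\<close> has the
  eigenvectors \<open>(u\<^sup>i sin (i j h))\<^sub>i\<close> where \<open>2 u a\<^sub>j = z + u\<^sup>2 cnj z\<close> and \<open>\<mu> = -u\<^sup>2\<close>, and two of them are orthogonal for the form unless
  \<open>\<mu> cnj \<nu> = 1\<close>. If \<open>a\<^sub>j \<ge> \<rho>\<close>, one may take \<open>\<bar>u\<bar> \<ge> 1\<close>, and these vectors span an isotropic subspace.
  If \<open>\<bar>a\<^sub>j\<bar> < \<rho>\<close>, then \<open>\<bar>u\<bar> = 1\<close> and the eigenvectors with indices \<open>j\<close> and \<open>n + 1 - j\<close> combine with one coordinate vector of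
  the \<open>\<beta>\<close>-block to an isotropic vector exactly if \<open>\<lambda>\<close> lies in the kite spanned by \<open>\<beta>\<close> and its tangents
  to the disk of radius \<open>a\<^sub>j\<close>.\<close>

section \<open>Isotropic subspaces and higher rank numerical ranges\<close>

text \<open>Zero rows pad \<open>B\<close> to a square matrix \<open>M\<close>. As
  \<open>p < q\<close>, row \<open>p\<close> of \<open>M\<close> vanishes, so the transpose of
  \<open>M\<close> kills a unit vector and \<open>M\<close> is singular; its kernel is that of
  \<open>B\<close>.\<close>

lemma wide_mat_kernel:
  fixes B :: "'a::field mat"
  assumes B: "B \<in> carrier_mat p q" and pq: "p < q"
  obtains y where "y \<in> carrier_vec q" "y \<noteq> 0\<^sub>v q" "B *\<^sub>v y = 0\<^sub>v p"
proof -
  define M where "M = mat q q (\<lambda>(i,j). if i < p then B $$ (i,j) else 0)"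
  have M: "M \<in> carrier_mat q q" by (simp add: M_def)
  have "transpose_mat M *\<^sub>v unit_vec q p = 0\<^sub>v q"
    using pq by (intro eq_vecI) (auto simp: M_def)
  moreover have "unit_vec q p \<noteq> (0\<^sub>v q :: 'a vec)" using pq by simp
  ultimately have "det (transpose_mat M) = 0"
    using det_0_iff_vec_prod_zero_field[of "transpose_mat M" q] M by (meson transpose_carrier_mat unit_vec_carrier)
  then have "det M = 0" using det_transpose[OF M] by simp
  then obtain y where y: "y \<in> carrier_vec q" "y \<noteq> 0\<^sub>v q" "M *\<^sub>v y = 0\<^sub>v q"
    using det_0_iff_vec_prod_zero_field[OF M] by blast
  have "B *\<^sub>v y = 0\<^sub>v p"
  proof (intro eq_vecI)
    fix i assume "i < dim_vec (0\<^sub>v p :: 'a vec)"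
    then have i: "i < p" by simp
    have "(M *\<^sub>v y) $ i = 0" using y(3) i pq by simp
    moreover have "row M i = row B i" using i pq B by (intro eq_vecI) (auto simp: M_def)
    ultimately show "(B *\<^sub>v y) $ i = 0\<^sub>v p $ i" using i pq B M by simp
  qed (use B in simp)
  with y show thesis using that by blast
qed

lemma injective_mat_dim_le:
  fixes B :: "'a::field mat"
  assumes "B \<in> carrier_mat p q"
    and "\<And>y. y \<in> carrier_vec q \<Longrightarrow> B *\<^sub>v y = 0\<^sub>v p \<Longrightarrow> y = 0\<^sub>v q"
  shows "q \<le> p"
  using wide_mat_kernel[OF assms(1)] assms(2) by (metis not_le_imp_less)

text \<open>\<open>V\<close> collects a maximal independent set of columns of \<open>P\<close>, and
  \<open>E\<close> selects these columns. So \<open>V\<close> is injective with the same range as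
  \<open>P\<close>, and the rank turns into a number of columns.\<close>

lemma rank_factorization:
  fixes P :: "'a::field mat"
  assumes P: "P \<in> carrier_mat N c" and r: "vec_space.rank N P = r"
  obtains V C E where "V \<in> carrier_mat N r" "C \<in> carrier_mat r c" "E \<in> carrier_mat c r"
    "P = V * C" "V = P * E"
    "\<forall>y\<in>carrier_vec r. V *\<^sub>v y = 0\<^sub>v N \<longrightarrow> y = 0\<^sub>v r"
proof -
  interpret vec_space "TYPE('a)" N .
  have cP: "set (cols P) \<subseteq> carrier_vec N" using P cols_dim by blast
  have "lin_indpt {}" by (simp add: lin_dep_def)
  have "\<exists>S. finite S \<and> maximal S (\<lambda>T. T \<subseteq> set (cols P) \<and> lin_indpt T) \<and> {} \<subseteq> S"
    by (rule maximal_exists_superset[of "set (cols P)"]) (simp_all add: \<open>lin_indpt {}\<close>)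
  then obtain S where S: "maximal S (\<lambda>T. T \<subseteq> set (cols P) \<and> lin_indpt T)" by blast
  have Sc: "S \<subseteq> set (cols P)" and Si: "lin_indpt S" using S unfolding maximal_def by auto
  have finS: "finite S" using Sc finite_subset by blast
  have cS: "S \<subseteq> carrier_vec N" using Sc cP by blast
  have cardS: "card S = r" using rank_card_indpt[OF P S] r by simp
  obtain vs where vs: "set vs = S" "distinct vs" using finite_distinct_list[OF finS] by blast
  have len: "length vs = r" using vs cardS distinct_card by fastforce
  define V where "V = mat_of_cols N vs"
  have V: "V \<in> carrier_mat N r" unfolding V_def using len by auto
  have colsV: "cols V = vs" unfolding V_def using vs cS by (intro cols_mat_of_cols) auto
  have inj: "y = 0\<^sub>v r" if "y \<in> carrier_vec r" "V *\<^sub>v y = 0\<^sub>v N" for y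
    using lin_depI[OF V that(1) _ that(2)] colsV vs Si by auto
  have spn: "\<exists>e. e \<in> carrier_vec r \<and> x = V *\<^sub>v e" if x: "x \<in> set (cols P)" for x
  proof -
    have "x \<in> span S"
    proof (cases "x \<in> S")
      case True then show ?thesis using cS by (simp add: span_mem)
    next
      case False
      have "\<not> lin_indpt (insert x S)"
      proof
        assume "lin_indpt (insert x S)"
        moreover have "insert x S \<subseteq> set (cols P)" using Sc x by auto
        ultimately have "S = insert x S" using S unfolding maximal_def by blast
        then show False using False by auto
      qed
      then show ?thesis using lin_dep_iff_in_span[OF cS Si _ False] x cP by auto
    qed
    then obtain a where "x = lincomb a S" using finite_in_span[OF finS cS] by blast
    then have "x = V *\<^sub>v vec r (\<lambda>i. a (col V i))"
      using mat_mult_eq_lincomb[OF V, of a] colsV vs by simp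
    then show ?thesis by (metis vec_carrier)
  qed
  then obtain g where g: "\<And>x. x \<in> set (cols P) \<Longrightarrow> g x \<in> carrier_vec r \<and> x = V *\<^sub>v g x" by metis
  define C where "C = mat r c (\<lambda>(i,j). g (col P j) $ i)"
  have C: "C \<in> carrier_mat r c" by (simp add: C_def)
  have inP: "col P j \<in> set (cols P)" if "j < c" for j
    using that P by (metis carrier_matD(2) cols_length cols_nth nth_mem)
  have PC: "P = V * C"
  proof (rule eq_matI)
    fix i j assume "i < dim_row (V * C)" "j < dim_col (V * C)"
    then have i: "i < N" and j: "j < c" using V C by auto
    have gc: "g (col P j) \<in> carrier_vec r" "col P j = V *\<^sub>v g (col P j)" using g[OF inP[OF j]] by auto
    have cC: "col C j = g (col P j)" using gc(1) j by (intro eq_vecI) (auto simp: C_def)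
    have "P $$ (i,j) = col P j $ i" using i j P by simp
    also have "\<dots> = (V *\<^sub>v col C j) $ i" using gc(2) cC by simp
    also have "\<dots> = (V * C) $$ (i,j)" using i j V C by simp
    finally show "P $$ (i,j) = (V * C) $$ (i,j)" .
  qed (use P V C in auto)
  have "\<exists>j<c. vs ! l = col P j" if "l < r" for l
  proof -
    have "vs ! l \<in> set (cols P)" using that len vs Sc nth_mem by blast
    then show ?thesis using P by (metis carrier_matD(2) cols_length cols_nth in_set_conv_nth)
  qed
  then obtain f where f: "\<And>l. l < r \<Longrightarrow> f l < c \<and> vs ! l = col P (f l)" by metis
  define E where "E = mat c r (\<lambda>(j,l). if j = f l then 1 else (0::'a))"
  have E: "E \<in> carrier_mat c r" by (simp add: E_def)
  have VE: "V = P * E"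
  proof (rule eq_matI)
    fix i l assume "i < dim_row (P * E)" "l < dim_col (P * E)"
    then have i: "i < N" and l: "l < r" using P E by auto
    have "(P * E) $$ (i,l) = (\<Sum>j<c. P $$ (i,j) * (if j = f l then 1 else 0))"
      using i l P E by (auto simp: scalar_prod_def E_def atLeast0LessThan intro!: sum.cong)
    also have "\<dots> = P $$ (i, f l)" using f[OF l] by (simp add: if_distrib[of "(*) _"] cong: if_cong)
    also have "\<dots> = V $$ (i,l)" using f[OF l] i l P V len by (simp add: V_def mat_of_cols_index)
    finally show "V $$ (i,l) = (P * E) $$ (i,l)" by simp
  qed (use P V E in auto)
  show thesis using that[OF V C E PC VE] inj by blast
qed

section \<open>Adjoint matrices\<close>

lemma mat_adjoint_index:
  fixes A :: "complex mat"
  assumes "A \<in> carrier_mat p q" "i < q" "j < p"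
  shows "mat_adjoint A $$ (i,j) = cnj (A $$ (j,i))"
  using assms by (auto simp: mat_adjoint_def mat_of_rows_index)

lemma mat_adjoint_carrier:
  fixes A :: "complex mat"
  assumes "A \<in> carrier_mat p q" 
  shows "mat_adjoint A \<in> carrier_mat q p"
  using assms by (auto simp: mat_adjoint_def)

lemma mat_adjoint_adjoint:
  fixes A :: "complex mat"
  assumes "A \<in> carrier_mat p q" 
  shows "mat_adjoint (mat_adjoint A) = A"
  using assms mat_adjoint_carrier[OF mat_adjoint_carrier[OF assms]] mat_adjoint_carrier[OF assms]
  by (intro eq_matI) (auto simp: mat_adjoint_index[of _ p q] mat_adjoint_index[of _ q p])

lemma mat_adjoint_mult:
  fixes A :: "complex mat"
  assumes "A \<in> carrier_mat p q" "B \<in> carrier_mat q r"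
  shows "mat_adjoint (A * B) = mat_adjoint B * mat_adjoint A"
proof (rule eq_matI)
  have AB: "A * B \<in> carrier_mat p r" using assms by simp
  note c = mat_adjoint_carrier[OF assms(1)] mat_adjoint_carrier[OF assms(2)] mat_adjoint_carrier[OF AB]
  fix i j assume "i < dim_row (mat_adjoint B * mat_adjoint A)" "j < dim_col (mat_adjoint B * mat_adjoint A)"
  then have ij: "i < r" "j < p" using c by auto
  show "mat_adjoint (A * B) $$ (i, j) = (mat_adjoint B * mat_adjoint A) $$ (i, j)"
    using ij c assms AB mat_adjoint_index[OF AB] mat_adjoint_index[OF assms(1)] mat_adjoint_index[OF assms(2)]
    by (auto simp: scalar_prod_def intro!: sum.cong)
qed (use assms mat_adjoint_carrier[of A p q] mat_adjoint_carrier[of B q r]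
     mat_adjoint_carrier[of "A*B" p r] in auto)

text \<open>The squared norm of \<open>V *\<^sub>v y\<close> is the pairing of \<open>y\<close> with
  the Gram matrix applied to \<open>y\<close>.\<close>

lemma mat_adjoint_gram_kernel:
  fixes V :: "complex mat"
  assumes V: "V \<in> carrier_mat N k" and y: "y \<in> carrier_vec k"
    and 0: "(mat_adjoint V * V) *\<^sub>v y = 0\<^sub>v k"
  shows "V *\<^sub>v y = 0\<^sub>v N"
proof -
  note aV = mat_adjoint_carrier[OF V]
  define x where "x = V *\<^sub>v y"
  have x: "x \<in> carrier_vec N" using V y by (simp add: x_def)
  have 1: "mat_adjoint V *\<^sub>v x = 0\<^sub>v k" using 0 aV V y by (simp add: x_def)
  have "(\<Sum>l<k. cnj (y $ l) * (\<Sum>i<N. cnj (V $$ (i,l)) * x $ i)) = 0"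
  proof (rule sum.neutral, safe)
    fix l assume "l < k"
    then have "(mat_adjoint V *\<^sub>v x) $ l = 0" using 1 by simp
    moreover have "(mat_adjoint V *\<^sub>v x) $ l = (\<Sum>i<N. cnj (V $$ (i,l)) * x $ i)"
      using \<open>l < k\<close> aV x V by (auto simp: scalar_prod_def mat_adjoint_index[OF V] atLeast0LessThan intro!: sum.cong)
    ultimately show "cnj (y $ l) * (\<Sum>i<N. cnj (V $$ (i,l)) * x $ i) = 0" by simp
  qed
  moreover have "(\<Sum>l<k. cnj (y $ l) * (\<Sum>i<N. cnj (V $$ (i,l)) * x $ i))
      = (\<Sum>i<N. (\<Sum>l<k. cnj (V $$ (i,l) * y $ l)) * x $ i)"
    by (simp add: sum_distrib_left sum_distrib_right mult_ac) (rule sum.swap)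
  moreover have "(\<Sum>l<k. cnj (V $$ (i,l) * y $ l)) = cnj (x $ i)" if "i < N" for i
    using that V y by (simp add: x_def scalar_prod_def atLeast0LessThan)
  ultimately have "(\<Sum>i<N. cnj (x $ i) * x $ i) = 0" by simp
  then have "of_real (\<Sum>i<N. (cmod (x $ i))\<^sup>2) = (0::complex)"
    by (simp only: of_real_sum complex_norm_square) (simp add: mult.commute)
  then have "(\<Sum>i<N. (cmod (x $ i))\<^sup>2) = 0" by (simp only: of_real_eq_0_iff)
  then have "\<forall>i<N. x $ i = 0" by (simp add: sum_nonneg_eq_0_iff)
  then show ?thesis using x unfolding x_def[symmetric] by (intro eq_vecI) auto
qed

section \<open>From projections to isotropic subspaces and back\<close>

text \<open>The range of \<open>P\<close> has dimension \<open>k\<close>, so \<open>p < k\<close>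
  linear conditions leave a nonzero \<open>x\<close> in it. As \<open>P\<close> is self-adjoint and
  fixes \<open>x\<close>, the form of \<open>T\<close> at \<open>x\<close> equals that of
  \<open>P * T * P\<close>.\<close>

lemma higher_rank_nr_range_vector:
  assumes T: "T \<in> carrier_mat N N" and lam: "lam \<in> higher_rank_nr k T" and pk: "p < k"
  obtains x where "\<exists>i<N. x i \<noteq> 0" "\<And>q. q < p \<Longrightarrow> (\<Sum>i<N. f q i * x i) = 0"
    "(\<Sum>i<N. cnj (x i) * (\<Sum>j<N. T $$ (i,j) * x j)) = lam * (\<Sum>i<N. cnj (x i) * x i)"
proof -
  obtain P where P: "P \<in> carrier_mat N N" "mat_adjoint P = P" "P * P = P"
      "vec_space.rank N P = k" "P * T * P = lam \<cdot>\<^sub>m P"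
    using lam T unfolding higher_rank_nr_def by auto
  obtain V C E where V: "V \<in> carrier_mat N k" "C \<in> carrier_mat k N" "E \<in> carrier_mat N k"
    "P = V * C" "V = P * E" "\<forall>y\<in>carrier_vec k. V *\<^sub>v y = 0\<^sub>v N \<longrightarrow> y = 0\<^sub>v k"
    by (rule rank_factorization[OF P(1,4)])
  define F where "F = mat p N (\<lambda>(q,i). f q i)"
  have F: "F \<in> carrier_mat p N" by (simp add: F_def)
  have "F * V \<in> carrier_mat p k" using F V(1) by simp
  from wide_mat_kernel[OF this pk] obtain y
    where y: "y \<in> carrier_vec k" "y \<noteq> 0\<^sub>v k" "F * V *\<^sub>v y = 0\<^sub>v p" .
  define x where "x = V *\<^sub>v y"
  have x: "x \<in> carrier_vec N" using V(1) y(1) by (simp add: x_def)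
  have xn: "x \<noteq> 0\<^sub>v N" using V(6) y unfolding x_def by blast
  have Fx: "F *\<^sub>v x = 0\<^sub>v p" using y F V(1) by (simp add: x_def)
  have "P * V = V" using assoc_mult_mat[OF P(1) P(1) V(3)] unfolding P(3) V(5)[symmetric] by simp
  then have Px: "P *\<^sub>v x = x" unfolding x_def using assoc_mult_mat_vec[OF P(1) V(1) y(1)] by simp
  have aux: "(P * T * P) *\<^sub>v x = P *\<^sub>v (T *\<^sub>v x)"
  proof -
    have "(P * T * P) *\<^sub>v x = P * T *\<^sub>v (P *\<^sub>v x)" using P(1) T x by (intro assoc_mult_mat_vec) auto
    also have "\<dots> = P *\<^sub>v (T *\<^sub>v x)" unfolding Px using P(1) T x by (intro assoc_mult_mat_vec) auto
    finally show ?thesis .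
  qed
  have PTx: "P *\<^sub>v (T *\<^sub>v x) = lam \<cdot>\<^sub>v x"
  proof -
    have "(lam \<cdot>\<^sub>m P) *\<^sub>v x = lam \<cdot>\<^sub>v (P *\<^sub>v x)" using P(1) x by (intro eq_vecI) auto
    then show ?thesis using aux unfolding P(5) Px by simp
  qed
  have Tx: "T *\<^sub>v x \<in> carrier_vec N" using T x by simp
  have Pij: "P $$ (j,i) = cnj (P $$ (i,j))" if "i < N" "j < N" for i j
    using mat_adjoint_index[OF P(1), of j i] that P(2) by simp
  have self: "cnj (x $ i) = (\<Sum>j<N. P $$ (j,i) * cnj (x $ j))" if "i < N" for i
  proof -
    have "x $ i = (P *\<^sub>v x) $ i" using Px by simp
    also have "\<dots> = (\<Sum>j<N. P $$ (i,j) * x $ j)"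
      using that P(1) x by (auto simp: scalar_prod_def atLeast0LessThan)
    finally have "cnj (x $ i) = (\<Sum>j<N. cnj (P $$ (i,j)) * cnj (x $ j))" by simp
    also have "\<dots> = (\<Sum>j<N. P $$ (j,i) * cnj (x $ j))"
      using that by (intro sum.cong refl) (simp add: Pij[of i])
    finally show ?thesis .
  qed
  have "(\<Sum>i<N. cnj (x $ i) * (T *\<^sub>v x) $ i) = (\<Sum>i<N. (\<Sum>j<N. P $$ (j,i) * cnj (x $ j)) * (T *\<^sub>v x) $ i)"
    by (intro sum.cong refl arg_cong2[where f = "(*)"] self) simp
  also have "\<dots> = (\<Sum>j<N. cnj (x $ j) * (\<Sum>i<N. P $$ (j,i) * (T *\<^sub>v x) $ i))"
    unfolding sum_distrib_left sum_distrib_right by (subst sum.swap) (simp add: mult_ac)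
  also have "\<dots> = (\<Sum>j<N. cnj (x $ j) * (lam * x $ j))"
  proof (rule sum.cong)
    fix j assume "j \<in> {..<N}"
    then have j: "j < N" by simp
    have "(\<Sum>i<N. P $$ (j,i) * (T *\<^sub>v x) $ i) = (P *\<^sub>v (T *\<^sub>v x)) $ j"
      using j P(1) Tx T by (auto simp: scalar_prod_def atLeast0LessThan intro!: sum.cong)
    also have "\<dots> = lam * x $ j" unfolding PTx using j x by simp
    finally show "cnj (x $ j) * (\<Sum>i<N. P $$ (j,i) * (T *\<^sub>v x) $ i) = cnj (x $ j) * (lam * x $ j)" by simp
  qed simp
  finally have main: "(\<Sum>i<N. cnj (x $ i) * (T *\<^sub>v x) $ i) = lam * (\<Sum>i<N. cnj (x $ i) * x $ i)"
    by (simp add: sum_distrib_left mult_ac)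
  show thesis
  proof (rule that[of "\<lambda>i. x $ i"])
    show "\<exists>i<N. x $ i \<noteq> 0" 
    proof (rule ccontr)
      assume "\<not> ?thesis"
      then have "x = 0\<^sub>v N" using x by (intro eq_vecI) auto
      then show False using xn by simp
    qed
    show "(\<Sum>i<N. f q i * x $ i) = 0" if "q < p" for q
    proof -
      have "(F *\<^sub>v x) $ q = 0" using Fx that by simp
      then show ?thesis using that F x by (simp add: scalar_prod_def F_def atLeast0LessThan)
    qed
    have "(T *\<^sub>v x) $ i = (\<Sum>j<N. T $$ (i,j) * x $ j)" if "i < N" for i
      using that T x by (auto simp: scalar_prod_def atLeast0LessThan)
    then show "(\<Sum>i<N. cnj (x $ i) * (\<Sum>j<N. T $$ (i,j) * x $ j)) = lam * (\<Sum>i<N. cnj (x $ i) * x $ i)"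
      using main by simp
  qed
qed

text \<open>The vectors \<open>w l\<close> span the range of \<open>P = V * (H * U)\<close>, where
  \<open>U\<close> is the adjoint of \<open>V\<close> and \<open>H\<close> the inverse of the Gram
  matrix \<open>G\<close>. The hypothesis on the form says
  \<open>U * T * V = lam \<cdot>\<^sub>m G\<close>; multiplying by \<open>V * H\<close> on the left
  and \<open>H * U\<close> on the right gives \<open>P * T * P\<close>.\<close>

lemma higher_rank_nrI:
  assumes T: "T \<in> carrier_mat N N"
    and indep: "\<And>y. (\<And>i. i < N \<Longrightarrow> (\<Sum>l<k. y l * w l i) = 0) \<Longrightarrow> (\<forall>l<k. y l = 0)"
    and form: "\<And>a b. a < k \<Longrightarrow> b < k \<Longrightarrow>
      (\<Sum>i<N. cnj (w a i) * (\<Sum>j<N. T $$ (i,j) * w b j)) = lam * (\<Sum>i<N. cnj (w a i) * w b i)"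
  shows "lam \<in> higher_rank_nr k T"
proof -
  define V where "V = mat N k (\<lambda>(i,l). w l i)"
  have V: "V \<in> carrier_mat N k" by (simp add: V_def)
  define U where "U = mat_adjoint V"
  have U: "U \<in> carrier_mat k N" unfolding U_def using mat_adjoint_carrier[OF V] .
  have Uij: "U $$ (a,i) = cnj (w a i)" if "a < k" "i < N" for a i
    unfolding U_def using mat_adjoint_index[OF V that] that by (simp add: V_def)
  have inj: "y = 0\<^sub>v k" if y: "y \<in> carrier_vec k" "V *\<^sub>v y = 0\<^sub>v N" for y
  proof -
    have "(\<Sum>l<k. y $ l * w l i) = 0" if "i < N" for i
    proof -
      have "(V *\<^sub>v y) $ i = 0" using y that by simp
      then show ?thesis using that y V by (simp add: V_def scalar_prod_def atLeast0LessThan mult.commute)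
    qed
    then have "\<forall>l<k. y $ l = 0" by (rule indep)
    then show ?thesis using y by (intro eq_vecI) auto
  qed
  define G where "G = U * V"
  have G: "G \<in> carrier_mat k k" using U V by (simp add: G_def)
  have "det G \<noteq> 0"
    using det_0_iff_vec_prod_zero_field[OF G] mat_adjoint_gram_kernel[OF V] inj
    unfolding G_def U_def by blast
  then obtain H where H: "H \<in> carrier_mat k k" "H * G = 1\<^sub>m k" "G * H = 1\<^sub>m k"
    using det_non_zero_imp_unit[OF G] unfolding Units_def ring_mat_def by auto
  have UTV: "U * T * V = lam \<cdot>\<^sub>m G"
  proof (rule eq_matI)
    fix a b assume "a < dim_row (lam \<cdot>\<^sub>m G)" "b < dim_col (lam \<cdot>\<^sub>m G)"
    then have ab: "a < k" "b < k" using G by auto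
    have "(U * T * V) $$ (a,b) = (U * (T * V)) $$ (a,b)" using U T V by simp
    also have "\<dots> = (\<Sum>i<N. cnj (w a i) * (\<Sum>j<N. T $$ (i,j) * w b j))"
      using ab U T V Uij by (auto simp: scalar_prod_def V_def atLeast0LessThan intro!: sum.cong)
    also have "\<dots> = lam * (\<Sum>i<N. cnj (w a i) * w b i)" using form[OF ab] .
    also have "\<dots> = (lam \<cdot>\<^sub>m G) $$ (a,b)"
      using ab U T V Uij G by (auto simp: G_def scalar_prod_def V_def atLeast0LessThan intro!: sum.cong)
    finally show "(U * T * V) $$ (a,b) = (lam \<cdot>\<^sub>m G) $$ (a,b)" .
  qed (use U V T G in auto)
  have GU: "mat_adjoint G = G" unfolding G_def U_def
    using mat_adjoint_mult[OF mat_adjoint_carrier[OF V] V] mat_adjoint_adjoint[OF V] by simp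
  have HU: "mat_adjoint H = H"
  proof -
    have aH: "mat_adjoint H \<in> carrier_mat k k" using mat_adjoint_carrier[OF H(1)] .
    have one: "mat_adjoint (1\<^sub>m k) = (1\<^sub>m k :: complex mat)"
      using mat_adjoint_carrier[of "1\<^sub>m k" k k]
      by (intro eq_matI) (auto simp: mat_adjoint_index[of "1\<^sub>m k" k k])
    have "mat_adjoint H * G = 1\<^sub>m k" using mat_adjoint_mult[OF G H(1)] GU H(3) one by simp
    then have "mat_adjoint H * (G * H) = H" using assoc_mult_mat[OF aH G H(1)] H(1) by simp
    then show ?thesis using H(3) aH by simp
  qed
  define P where "P = V * (H * U)"
  have HUc: "H * U \<in> carrier_mat k N" using H U by simp
  have P: "P \<in> carrier_mat N N" using V HUc by (simp add: P_def)
  have HUV: "H * U * V = 1\<^sub>m k" using assoc_mult_mat[OF H(1) U V] H(2) by (simp add: G_def)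
  have PV: "P * V = V" unfolding P_def using assoc_mult_mat[OF V HUc V] HUV V by simp
  have Padj: "mat_adjoint P = P"
  proof -
    have "mat_adjoint P = (mat_adjoint U * mat_adjoint H) * mat_adjoint V"
      unfolding P_def using mat_adjoint_mult[OF V HUc] mat_adjoint_mult[OF H(1) U] by simp
    also have "\<dots> = V * H * U" using HU mat_adjoint_adjoint[OF V] by (simp add: U_def)
    also have "\<dots> = P" unfolding P_def using assoc_mult_mat[OF V H(1) U] .
    finally show ?thesis .
  qed
  have PP: "P * P = P"
  proof -
    have "P * P = (P * V) * (H * U)" using assoc_mult_mat[OF P V HUc] by (simp add: P_def)
    then show ?thesis using PV by (simp add: P_def)
  qed
  have PTP: "P * T * P = lam \<cdot>\<^sub>m P"
  proof -
    have VH: "V * H \<in> carrier_mat N k" using V H by simp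
    have P2: "P = (V * H) * U" unfolding P_def using assoc_mult_mat[OF V H(1) U] by simp
    have TV: "T * V \<in> carrier_mat N k" using T V by simp
    have UT: "U * T \<in> carrier_mat k N" using U T by simp
    have "P * T * P = ((V * H) * (U * T)) * (V * (H * U))"
      using assoc_mult_mat[OF VH U T] by (simp add: P2[symmetric]) (simp add: P_def)
    also have "\<dots> = (V * H) * ((U * T) * (V * (H * U)))"
      using assoc_mult_mat[OF VH UT] V HUc by (meson mult_carrier_mat)
    also have "(U * T) * (V * (H * U)) = (lam \<cdot>\<^sub>m G) * (H * U)"
      using assoc_mult_mat[OF UT V HUc] UTV by simp
    also have "\<dots> = lam \<cdot>\<^sub>m (G * (H * U))" using mult_smult_assoc_mat[OF G HUc] .
    also have "G * (H * U) = U" using assoc_mult_mat[OF G H(1) U] H(3) U by simp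
    also have "(V * H) * (lam \<cdot>\<^sub>m U) = lam \<cdot>\<^sub>m P" using mult_smult_distrib[OF VH U] P2 by simp
    finally show ?thesis .
  qed
  \<comment> \<open>\<open>P\<close> factors through dimension \<open>k\<close> by \<open>V\<close>
    and through its own rank \<open>r\<close> by \<open>W\<close>. Injectivity of \<open>W\<close>
    gives \<open>r \<le> k\<close>, that of \<open>V\<close> gives \<open>k \<le> r\<close>.\<close>
  have rk: "vec_space.rank N P = k"
  proof -
    define r where "r = vec_space.rank N P"
    obtain W C E where W: "W \<in> carrier_mat N r" "C \<in> carrier_mat r N" "E \<in> carrier_mat N r"
      "P = W * C" "W = P * E" "\<forall>y\<in>carrier_vec r. W *\<^sub>v y = 0\<^sub>v N \<longrightarrow> y = 0\<^sub>v r"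
      by (rule rank_factorization[OF P r_def[symmetric]])
    have "r \<le> k"
    proof (rule injective_mat_dim_le[of "(H * U) * E"])
      show "H * U * E \<in> carrier_mat k r" using HUc W(3) by simp
      fix y assume y: "y \<in> carrier_vec r" "H * U * E *\<^sub>v y = 0\<^sub>v k"
      have "W *\<^sub>v y = (V * ((H * U) * E)) *\<^sub>v y"
        using W(5) assoc_mult_mat[OF V HUc W(3)] by (simp add: P_def)
      also have "\<dots> = V *\<^sub>v ((H * U) * E *\<^sub>v y)" using V HUc W(3) y by (intro assoc_mult_mat_vec) auto
      also have "\<dots> = 0\<^sub>v N" unfolding y(2) using V by (intro eq_vecI) auto
      finally show "y = 0\<^sub>v r" using W(6) y by blast
    qed
    moreover have "k \<le> r"
    proof (rule injective_mat_dim_le[of "C * V"])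
      show "C * V \<in> carrier_mat r k" using V W(2) by simp
      fix y assume y: "y \<in> carrier_vec k" "C * V *\<^sub>v y = 0\<^sub>v r"
      have "V *\<^sub>v y = (W * (C * V)) *\<^sub>v y"
        using PV W(4) assoc_mult_mat[OF W(1,2) V] by simp
      also have "\<dots> = W *\<^sub>v (C * V *\<^sub>v y)" using V W(1,2) y(1) by (intro assoc_mult_mat_vec) auto
      also have "\<dots> = 0\<^sub>v N" unfolding y(2) using W(1) by (intro eq_vecI) auto
      finally show "y = 0\<^sub>v k" using inj y by blast
    qed
    ultimately show ?thesis by (simp add: r_def)
  qed
  show ?thesis unfolding higher_rank_nr_def using P Padj PP rk PTP T by auto
qed

section \<open>Sine vectors and the shift form\<close>

text \<open>Eigenvectors of the real part of the nilpotent Jordan block, with eigenvalue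
  \<open>cos (phi n j)\<close>. Coordinates are numbered from 1; the zeros at \<open>0\<close> and
  \<open>Suc n\<close> act as boundary conditions.\<close>

definition sine_vec :: "nat \<Rightarrow> nat \<Rightarrow> nat \<Rightarrow> real" where
  "sine_vec n j p = sin (real p * phi n j)"

lemma sine_vec_0 [simp]: "sine_vec n j 0 = 0"
  by (simp add: sine_vec_def)

lemma sine_vec_Suc_n [simp]: "sine_vec n j (Suc n) = 0"
proof -
  have "real (Suc n) * phi n j = real j * pi" by (simp add: phi_def field_simps)
  then show ?thesis by (simp add: sine_vec_def)
qed

lemma sine_vec_commute: "sine_vec n j p = sine_vec n p j"
  by (simp add: sine_vec_def phi_def mult_ac)

lemma sine_vec_rec: "sine_vec n j (Suc (Suc p)) + sine_vec n j p = 2 * cos (phi n j) * sine_vec n j (Suc p)"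
proof -
  let ?x = "phi n j"
  have "real (Suc (Suc p)) * ?x = real (Suc p) * ?x + ?x" "real p * ?x = real (Suc p) * ?x - ?x"
    by (simp_all add: algebra_simps)
  then show ?thesis unfolding sine_vec_def by (simp add: sin_add sin_diff)
qed

lemma phi_bounds: "1 \<le> j \<Longrightarrow> j \<le> n \<Longrightarrow> 0 < phi n j \<and> phi n j < pi"
  using mult_strict_right_mono[of "real j" "real n + 1" pi] by (auto simp: phi_def divide_less_eq mult.commute)

lemma sin_phi_pos: "1 \<le> j \<Longrightarrow> j \<le> n \<Longrightarrow> 0 < sin (phi n j)"
  using phi_bounds sin_gt_zero by blast

lemma phi_reflect: "j \<le> Suc n \<Longrightarrow> phi n (Suc n - j) = pi - phi n j"
  by (simp add: phi_def of_nat_diff field_simps)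

lemma cos_phi_less: "1 \<le> j \<Longrightarrow> j < l \<Longrightarrow> l \<le> n \<Longrightarrow> cos (phi n l) < cos (phi n j)"
  by (rule cos_monotone_0_pi) (auto simp: phi_def divide_simps)

lemma cos_phi_le: "1 \<le> j \<Longrightarrow> j \<le> l \<Longrightarrow> l \<le> n \<Longrightarrow> cos (phi n l) \<le> cos (phi n j)"
  using cos_phi_less[of j l n] by (cases "j = l") auto

lemma cos_phi_inj: "1 \<le> j \<Longrightarrow> j \<le> n \<Longrightarrow> 1 \<le> l \<Longrightarrow> l \<le> n \<Longrightarrow> cos (phi n j) = cos (phi n l) \<Longrightarrow> j = l"
  using cos_phi_less[of j l n] cos_phi_less[of l j n] by (cases j l rule: linorder_cases) auto

lemma cos_phi_nonneg:
  assumes "2 * k \<le> n + 1"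
  shows "0 \<le> cos (phi n k)"
proof (rule cos_ge_zero)
  have "real k * 2 \<le> real n + 1" using assms by linarith
  then have "(real k * 2) * pi \<le> (real n + 1) * pi" by (intro mult_right_mono) auto
  then show "phi n k \<le> pi / 2" by (simp add: phi_def field_simps)
  show "- (pi / 2) \<le> phi n k" by (rule order_trans[of _ 0]) (auto simp: phi_def)
qed

lemma cos_phi_pos:
  assumes "2 * k \<le> n"
  shows "0 < cos (phi n k)"
proof (rule cos_gt_zero_pi)
  have "real k * 2 < real n + 1" using assms by linarith
  then have "(real k * 2) * pi < (real n + 1) * pi" by (intro mult_strict_right_mono) auto
  then show "phi n k < pi / 2" by (simp add: phi_def field_simps)
  show "- (pi / 2) < phi n k" by (rule less_le_trans[of _ 0]) (auto simp: phi_def)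
qed

lemma cos_phi_neg:
  assumes "n + 1 < 2 * k" "k \<le> n"
  shows "cos (phi n k) < 0"
proof -
  have "(real n + 1) < real k * 2" using assms by linarith
  then have "(real n + 1) * pi < (real k * 2) * pi" by (intro mult_strict_right_mono) auto
  then have "pi / 2 < phi n k" by (simp add: phi_def field_simps)
  moreover have "phi n k \<le> pi" using phi_bounds[of k n] assms by simp
  ultimately have "cos (phi n k) < cos (pi / 2)" by (intro cos_monotone_0_pi) auto
  then show ?thesis by simp
qed

section \<open>Orthogonality of the sine vectors\<close>

text \<open>Dirichlet kernel: the factor \<open>2 * sin (x/2)\<close> makes the sum
  telescope.\<close>

lemma cos_sum_telescope:
  "2 * sin (x/2) * (\<Sum>i\<le>n. cos (real i * x)) = sin ((real n + 1/2) * x) + sin (x/2)"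
proof (induction n)
  case (Suc n)
  have "2 * sin (x/2) * cos (real (Suc n) * x) = sin ((real (Suc n) + 1/2) * x) - sin ((real n + 1/2) * x)"
  proof -
    have "(real (Suc n) + 1/2) * x = real (Suc n) * x + x/2" "(real n + 1/2) * x = real (Suc n) * x - x/2"
      by (simp_all add: algebra_simps)
    then show ?thesis by (simp add: sin_add sin_diff)
  qed
  then show ?case using Suc by (simp add: distrib_left)
qed simp

text \<open>On the grid, \<open>(real n + 1/2) * phi n q\<close> is \<open>real q * pi\<close> minus
  \<open>phi n q / 2\<close>, so only the parity of \<open>q\<close> survives.\<close>

lemma cos_sum_grid:
  assumes "0 < q" "q < 2 * (n + 1)"
  shows "(\<Sum>i\<le>n. cos (real i * phi n q)) = (if even q then 0 else 1)"
proof -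
  have "0 < phi n q / 2" "phi n q / 2 < pi"
    using assms mult_strict_right_mono[of "real q" "2 * (real n + 1)" pi]
    by (auto simp: phi_def divide_less_eq mult_ac)
  then have s: "sin (phi n q / 2) > 0" by (rule sin_gt_zero)
  have "(real n + 1/2) * phi n q = real q * pi - phi n q / 2"
    by (simp add: phi_def field_simps)
  then have "sin ((real n + 1/2) * phi n q) = - ((-1) ^ q) * sin (phi n q / 2)"
    by (simp add: sin_diff)
  then have "2 * sin (phi n q / 2) * (\<Sum>i\<le>n. cos (real i * phi n q)) = (1 - (-1)^q) * sin (phi n q / 2)"
    using cos_sum_telescope[of "phi n q" n] by (simp add: algebra_simps)
  then show ?thesis using s by (auto split: if_splits)
qed

text \<open>Product-to-sum gives two grid sums with indices \<open>j - l\<close> and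
  \<open>j + l\<close>. These have equal parity, so the sums cancel unless \<open>j = l\<close>,
  when every cosine in the first one is 1 and the second sum is 0.\<close>

lemma sine_vec_orthogonal:
  assumes "1 \<le> j" "j \<le> n" "1 \<le> l" "l \<le> n"
  shows "(\<Sum>p=1..n. sine_vec n j p * sine_vec n l p) = (if j = l then (real n + 1) / 2 else 0)"
proof -
  \<comment> \<open>The assumption \<open>l \<le> j\<close> keeps the natural number subtraction
    \<open>j - l\<close> exact; the other order follows by symmetry.\<close>
  have main: "(\<Sum>p=1..n. sine_vec n j p * sine_vec n l p) = (if j = l then (real n + 1) / 2 else 0)"
    if "1 \<le> j" "j \<le> n" "1 \<le> l" "l \<le> n" "l \<le> j" for j l
  proof -
    have "(\<Sum>p=1..n. sine_vec n j p * sine_vec n l p) = (\<Sum>p\<le>n. sine_vec n j p * sine_vec n l p)"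
      by (intro sum.mono_neutral_left) (auto simp: not_le)
    also have "\<dots> = (\<Sum>p\<le>n. (cos (real p * phi n (j - l)) - cos (real p * phi n (j + l))) / 2)"
    proof (rule sum.cong)
      fix p
      have "real p * phi n (j - l) = real p * phi n j - real p * phi n l"
        "real p * phi n (j + l) = real p * phi n j + real p * phi n l"
        using that by (simp_all add: phi_def of_nat_diff diff_divide_distrib add_divide_distrib algebra_simps)
      then show "sine_vec n j p * sine_vec n l p = (cos (real p * phi n (j - l)) - cos (real p * phi n (j + l))) / 2"
        by (simp add: sine_vec_def cos_add cos_diff)
    qed simp
    also have "\<dots> = ((\<Sum>p\<le>n. cos (real p * phi n (j - l))) - (\<Sum>p\<le>n. cos (real p * phi n (j + l)))) / 2"
      by (simp add: sum_subtractf sum_divide_distrib[symmetric])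
    also have "\<dots> = (if j = l then (real n + 1) / 2 else 0)"
    proof (cases "j = l")
      case True
      then show ?thesis using that cos_sum_grid[of "j + l" n] by (auto simp: phi_def)
    next
      case False
      then show ?thesis using that cos_sum_grid[of "j + l" n] cos_sum_grid[of "j - l" n] by auto
    qed
    finally show ?thesis .
  qed
  show ?thesis
  proof (cases "l \<le> j")
    case True then show ?thesis using main assms by blast
  next
    case False
    then have "(\<Sum>p=1..n. sine_vec n l p * sine_vec n j p) = (if l = j then (real n + 1) / 2 else 0)"
      using main[of l j] assms by linarith
    then show ?thesis using False by (simp add: mult.commute)
  qed
qed

lemma sum_shift_boundary:
  fixes f :: "nat \<Rightarrow> 'a::comm_monoid_add"
  assumes "f 0 = 0" "f n = 0"
  shows "(\<Sum>p=1..n. f (p - 1)) = (\<Sum>p=1..n. f p)"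
proof -
  have "(\<Sum>p=1..n. f (p - 1)) = (\<Sum>p<n. f p)"
    by (rule sum.reindex_bij_witness[of _ Suc "\<lambda>p. p - 1"]) auto
  also have "\<dots> = (\<Sum>p=1..n. f p)"
  proof (cases n)
    case (Suc n')
    have "{..<n} = insert 0 {1..n'}" "{1..n} = insert n {1..n'}" using Suc by auto
    then show ?thesis using assms Suc by simp
  qed simp
  finally show ?thesis .
qed

text \<open>By the boundary zeros the forward and backward shift sums agree, and by the recurrence
  they add up to \<open>2 * cos (phi n j)\<close> times the squared norm.\<close>

lemma sine_vec_self_shift:
  assumes "1 \<le> j" "j \<le> n"
  shows "(\<Sum>p=1..n. sine_vec n j p * sine_vec n j (Suc p)) = cos (phi n j) * ((real n + 1) / 2)"
proof -
  have "(\<Sum>p=1..n. sine_vec n j p * sine_vec n j (p - 1)) = (\<Sum>p=1..n. sine_vec n j p * sine_vec n j (Suc p))"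
  proof -
    have "(\<Sum>p=1..n. sine_vec n j p * sine_vec n j (p - 1)) = (\<Sum>p=1..n. sine_vec n j (Suc (p - 1)) * sine_vec n j (p - 1))"
      by (intro sum.cong) auto
    also have "\<dots> = (\<Sum>p=1..n. sine_vec n j (Suc p) * sine_vec n j p)"
      by (rule sum_shift_boundary) auto
    finally show ?thesis by (simp add: mult.commute)
  qed
  moreover have "(\<Sum>p=1..n. sine_vec n j p * sine_vec n j (Suc p)) + (\<Sum>p=1..n. sine_vec n j p * sine_vec n j (p - 1))
    = (\<Sum>p=1..n. 2 * cos (phi n j) * (sine_vec n j p * sine_vec n j p))"
    unfolding sum.distrib[symmetric]
  proof (rule sum.cong)
    fix p assume "p \<in> {1..n}"
    then obtain p' where "p = Suc p'" by (cases p) auto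
    then show "sine_vec n j p * sine_vec n j (Suc p) + sine_vec n j p * sine_vec n j (p - 1) = 2 * cos (phi n j) * (sine_vec n j p * sine_vec n j p)"
      using sine_vec_rec[of n j p'] by (simp add: distrib_left[symmetric] del: distrib_left_numeral)
  qed simp
  moreover have "(\<Sum>p=1..n. 2 * cos (phi n j) * (sine_vec n j p * sine_vec n j p)) = 2 * cos (phi n j) * ((real n + 1) / 2)"
    unfolding sum_distrib_left[symmetric] using sine_vec_orthogonal[OF assms assms] by simp
  ultimately show ?thesis by simp
qed

section \<open>The form of the shifted Jordan block and the eigenvectors of its pencil\<close>

text \<open>The sesquilinear form of \<open>J - z\<close> for the nilpotent Jordan block
  \<open>J\<close>, conjugate linear in \<open>Y\<close>. The entry \<open>X (Suc p)\<close> is the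
  action of \<open>J\<close> once \<open>X (Suc n) = 0\<close>.\<close>

definition jform :: "nat \<Rightarrow> complex \<Rightarrow> (nat \<Rightarrow> complex) \<Rightarrow> (nat \<Rightarrow> complex) \<Rightarrow> complex" where
  "jform n z Y X = (\<Sum>p=1..n. cnj (Y p) * (X (Suc p) - z * X p))"

text \<open>The backward shift is the adjoint of the forward shift: shift the summation index and
  drop the vanishing boundary terms.\<close>

lemma jform_adjoint:
  assumes "X 0 = 0" "X (Suc n) = 0" "Y 0 = 0" "Y (Suc n) = 0"
  shows "(\<Sum>p=1..n. cnj (Y p) * (X (p - 1) - cnj z * X p)) = cnj (jform n z X Y)"
proof -
  have "(\<Sum>p=1..n. cnj (Y p) * X (p - 1)) = (\<Sum>p=1..n. cnj (Y (Suc (p - 1))) * X (p - 1))"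
    by (intro sum.cong) auto
  also have "\<dots> = (\<Sum>p=1..n. cnj (Y (Suc p)) * X p)"
    by (rule sum_shift_boundary[where f = "\<lambda>p. cnj (Y (Suc p)) * X p"]) (use assms in auto)
  finally show ?thesis
    by (simp add: jform_def right_diff_distrib sum_subtractf mult_ac)
qed

lemma jform_add_right: "jform n z Y (\<lambda>p. a * X p + b * W p) = a * jform n z Y X + b * jform n z Y W"
  unfolding jform_def sum_distrib_left sum.distrib[symmetric]
  by (intro sum.cong) (auto simp: algebra_simps)

lemma jform_add_left: "jform n z (\<lambda>p. a * X p + b * W p) Y = cnj a * jform n z X Y + cnj b * jform n z W Y"
  unfolding jform_def sum_distrib_left sum.distrib[symmetric]
  by (intro sum.cong) (auto simp: algebra_simps)

lemma jform_sum_right: "jform n z Y (\<lambda>p. \<Sum>l\<in>L. c l * X l p) = (\<Sum>l\<in>L. c l * jform n z Y (X l))"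
proof -
  have "jform n z Y (\<lambda>p. \<Sum>l\<in>L. c l * X l p)
      = (\<Sum>p=1..n. \<Sum>l\<in>L. c l * (cnj (Y p) * (X l (Suc p) - z * X l p)))"
    unfolding jform_def
    by (intro sum.cong) (simp_all add: sum_distrib_left sum_subtractf right_diff_distrib mult_ac)
  then show ?thesis unfolding jform_def by (subst (asm) sum.swap) (simp add: sum_distrib_left)
qed

definition pencil_vec :: "nat \<Rightarrow> nat \<Rightarrow> complex \<Rightarrow> nat \<Rightarrow> complex" where
  "pencil_vec n j u p = u ^ p * of_real (sine_vec n j p)"

lemma pencil_vec_boundary [simp]: "pencil_vec n j u 0 = 0" "pencil_vec n j u (Suc n) = 0"
  by (simp_all add: pencil_vec_def)

text \<open>The weights \<open>u ^ p\<close> twist the sine recurrence so that the forward shift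
  plus \<open>u\<^sup>2\<close> times the backward shift multiplies the vector by
  \<open>2 * u * cos (phi n j)\<close>. The equation for \<open>u\<close> splits this factor into
  the two multiples of \<open>z\<close> and \<open>cnj z\<close>.\<close>

lemma pencil_vec_eigen:
  assumes u: "2 * u * of_real (cos (phi n j)) = z + u\<^sup>2 * cnj z" and "1 \<le> p"
  shows "pencil_vec n j u (Suc p) - z * pencil_vec n j u p
    = - u\<^sup>2 * (pencil_vec n j u (p - 1) - cnj z * pencil_vec n j u p)"
proof -
  obtain q where p: "p = Suc q" using \<open>1 \<le> p\<close> by (cases p) auto
  have "complex_of_real (sine_vec n j (Suc (Suc q)) + sine_vec n j q) = of_real (2 * cos (phi n j) * sine_vec n j (Suc q))"
    unfolding sine_vec_rec ..
  then have r: "of_real (sine_vec n j (Suc (Suc q))) = 2 * of_real (cos (phi n j)) * of_real (sine_vec n j (Suc q)) - complex_of_real (sine_vec n j q)"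
    by (simp add: algebra_simps)
  have "pencil_vec n j u (Suc p) + u\<^sup>2 * pencil_vec n j u (p - 1)
    = u ^ p * of_real (sine_vec n j p) * (2 * u * of_real (cos (phi n j)))"
    unfolding pencil_vec_def p r by (simp add: power2_eq_square algebra_simps)
  also have "\<dots> = pencil_vec n j u p * (z + u\<^sup>2 * cnj z)"
    unfolding u pencil_vec_def ..
  finally show ?thesis by (simp add: algebra_simps)
qed

text \<open>Both vectors are eigenvectors of the pencil \<open>J - z = \<mu> (J - z)\<^sup>*\<close>, with \<open>\<mu> = -u\<^sup>2\<close> and
  \<open>\<nu> = -v\<^sup>2\<close>; the value of the form is therefore fixed by the factor \<open>\<mu> * cnj \<nu>\<close>.\<close>
lemma jform_pencil_vec_orthogonal:
  assumes u: "2 * u * of_real (cos (phi n j)) = z + u\<^sup>2 * cnj z"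
    and v: "2 * v * of_real (cos (phi n l)) = z + v\<^sup>2 * cnj z"
    and uv: "u\<^sup>2 * (cnj v)\<^sup>2 \<noteq> 1"
  shows "jform n z (pencil_vec n l v) (pencil_vec n j u) = 0"
proof -
  have step: "jform n z (pencil_vec n l v) (pencil_vec n j u)
      = - u\<^sup>2 * cnj (jform n z (pencil_vec n j u) (pencil_vec n l v))"
    if u: "2 * u * of_real (cos (phi n j)) = z + u\<^sup>2 * cnj z" for u v j l
  proof -
    have "jform n z (pencil_vec n l v) (pencil_vec n j u)
      = (\<Sum>p=1..n. - u\<^sup>2 * (cnj (pencil_vec n l v p) * (pencil_vec n j u (p - 1) - cnj z * pencil_vec n j u p)))"
      unfolding jform_def
    proof (rule sum.cong)
      fix p assume "p \<in> {1..n}"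
      then have "1 \<le> p" by simp
      from pencil_vec_eigen[OF u this]
      show "cnj (pencil_vec n l v p) * (pencil_vec n j u (Suc p) - z * pencil_vec n j u p)
        = - u\<^sup>2 * (cnj (pencil_vec n l v p) * (pencil_vec n j u (p - 1) - cnj z * pencil_vec n j u p))"
        by (simp only: mult_ac)
    qed simp
    also have "\<dots> = - u\<^sup>2 * cnj (jform n z (pencil_vec n j u) (pencil_vec n l v))"
      unfolding sum_distrib_left[symmetric] by (subst jform_adjoint) auto
    finally show ?thesis .
  qed
  have "jform n z (pencil_vec n l v) (pencil_vec n j u)
      = u\<^sup>2 * (cnj v)\<^sup>2 * jform n z (pencil_vec n l v) (pencil_vec n j u)"
    using step[OF u, of l v] step[OF v, of j u] by (metis complex_cnj_cnj complex_cnj_minus complex_cnj_mult complex_cnj_power minus_mult_minus mult.assoc)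
  then show ?thesis using uv by (metis mult_cancel_right2)
qed

text \<open>The exceptional case of the orthogonality criterion: the weights of the two vectors
  cancel, and only the norm and the self-shift of one sine vector remain.\<close>

lemma jform_pencil_vec_dual:
  assumes "1 \<le> j" "j \<le> n" and uv: "cnj v * u = 1"
  shows "jform n z (pencil_vec n j v) (pencil_vec n j u)
    = (u * of_real (cos (phi n j)) - z) * of_real ((real n + 1) / 2)"
proof -
  have uvp: "cnj v ^ p * u ^ p = 1" for p
    using uv by (metis power_mult_distrib power_one)
  have "jform n z (pencil_vec n j v) (pencil_vec n j u)
    = (\<Sum>p=1..n. (cnj v ^ p * u ^ p) * (u * of_real (sine_vec n j p * sine_vec n j (Suc p)) - z * of_real (sine_vec n j p * sine_vec n j p)))"
    unfolding jform_def
    by (intro sum.cong refl) (simp only: pencil_vec_def complex_cnj_mult complex_cnj_power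
      complex_cnj_complex_of_real power_Suc of_real_mult right_diff_distrib mult_ac)
  also have "\<dots> = u * of_real (\<Sum>p=1..n. sine_vec n j p * sine_vec n j (Suc p)) - z * of_real (\<Sum>p=1..n. sine_vec n j p * sine_vec n j p)"
    unfolding uvp mult_1_left sum_subtractf of_real_sum sum_distrib_left ..
  finally show ?thesis
    unfolding sine_vec_self_shift[OF assms(1,2)] sine_vec_orthogonal[OF assms(1,2) assms(1,2)]
    by (simp only: of_real_mult left_diff_distrib mult.assoc if_True refl)
qed

section \<open>Spectral decomposition of the real part of the shift\<close>

text \<open>The matrix with entries \<open>sine_vec n j p\<close> is symmetric in \<open>j\<close>
  and \<open>p\<close>, so the orthogonality of its rows also yields completeness.\<close>

lemma sine_expansion:
  assumes "1 \<le> p" "p \<le> n"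
  shows "X p = of_real (2 / (real n + 1)) * (\<Sum>j=1..n. (\<Sum>q=1..n. of_real (sine_vec n j q) * X q) * of_real (sine_vec n j p) :: complex)"
proof -
  have "(\<Sum>j=1..n. (\<Sum>q=1..n. of_real (sine_vec n j q) * X q) * of_real (sine_vec n j p))
      = (\<Sum>q=1..n. of_real (\<Sum>j=1..n. sine_vec n j q * sine_vec n j p) * X q)"
    unfolding of_real_sum sum_distrib_right
    by (subst sum.swap) (simp add: mult_ac)
  also have "\<dots> = (\<Sum>q=1..n. if q = p then of_real ((real n + 1) / 2) * X q else 0)"
  proof (rule sum.cong)
    fix q assume "q \<in> {1..n}"
    then have "(\<Sum>j=1..n. sine_vec n j q * sine_vec n j p) = (if q = p then (real n + 1) / 2 else 0)"
      using sine_vec_orthogonal[of q n p] assms by (simp only: sine_vec_commute[of n q] sine_vec_commute[of n p]) simp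
    then show "of_real (\<Sum>j=1..n. sine_vec n j q * sine_vec n j p) * X q = (if q = p then of_real ((real n + 1) / 2) * X q else 0)"
      by simp
  qed simp
  also have "\<dots> = of_real ((real n + 1) / 2) * X p" using assms by simp
  finally have "of_real (2 / (real n + 1)) * (\<Sum>j=1..n. (\<Sum>q=1..n. of_real (sine_vec n j q) * X q) * of_real (sine_vec n j p))
    = of_real (2 / (real n + 1) * ((real n + 1) / 2)) * X p" by (simp only: of_real_mult mult.assoc)
  moreover have "2 / (real n + 1) * ((real n + 1) / 2) = 1" by simp
  ultimately show ?thesis by (simp only: of_real_1 mult_1_left)
qed

text \<open>The sine coefficients \<open>y j\<close> diagonalize the norm and the real part of the
  shift form at the same time.\<close>

lemma sine_parseval:
  fixes X :: "nat \<Rightarrow> complex" and n :: nat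
  defines "y \<equiv> \<lambda>j. \<Sum>q=1..n. of_real (sine_vec n j q) * X q"
  shows "(\<Sum>p=1..n. (cmod (X p))\<^sup>2) = 2 / (real n + 1) * (\<Sum>j=1..n. (cmod (y j))\<^sup>2)" (is ?A)
    and "X 0 = 0 \<Longrightarrow> X (Suc n) = 0 \<Longrightarrow> Re (\<Sum>p=1..n. cnj (X p) * X (Suc p))
      = 2 / (real n + 1) * (\<Sum>j=1..n. cos (phi n j) * (cmod (y j))\<^sup>2)" (is "_ \<Longrightarrow> _ \<Longrightarrow> ?B")
proof -
  define c where "c = complex_of_real (2 / (real n + 1))"
  have exp: "X p = c * (\<Sum>j=1..n. y j * of_real (sine_vec n j p))" if "p \<in> {1..n}" for p
    using sine_expansion[of p n X] that by (simp only: c_def y_def atLeastAtMost_iff)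
  have cy: "cnj (y j) = (\<Sum>p=1..n. cnj (X p) * of_real (sine_vec n j p))" for j
    by (simp add: y_def mult.commute)
  have swap: "(\<Sum>p=1..n. cnj (X p) * (c * (\<Sum>j=1..n. g j * (y j * of_real (sine_vec n j p)))))
      = c * (\<Sum>j=1..n. g j * (y j * cnj (y j)))" for g
    unfolding cy sum_distrib_left by (subst sum.swap) (simp add: mult_ac)
  have "complex_of_real (\<Sum>p=1..n. (cmod (X p))\<^sup>2) = (\<Sum>p=1..n. cnj (X p) * X p)"
    unfolding of_real_sum by (intro sum.cong refl) (simp only: complex_norm_square mult.commute)
  also have "\<dots> = (\<Sum>p=1..n. cnj (X p) * (c * (\<Sum>j=1..n. 1 * (y j * of_real (sine_vec n j p)))))"
    by (intro sum.cong refl arg_cong2[where f = "(*)"]) (simp only: exp mult_1_left)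
  also have "\<dots> = c * (\<Sum>j=1..n. y j * cnj (y j))" unfolding swap by simp
  also have "\<dots> = of_real (2 / (real n + 1) * (\<Sum>j=1..n. (cmod (y j))\<^sup>2))"
    unfolding of_real_mult of_real_sum complex_norm_square c_def ..
  finally show ?A using of_real_eq_iff by blast
  show ?B if X0: "X 0 = 0" and Xn: "X (Suc n) = 0"
  proof -
    \<comment> \<open>\<open>X'\<close> is the sine expansion read at all indices. It agrees with
      \<open>X\<close> also at \<open>0\<close> and \<open>Suc n\<close>, where both vanish, so the
      recurrence can be used at \<open>p = 1\<close> and \<open>p = n\<close> too.\<close>
    define X' where "X' p = c * (\<Sum>j=1..n. y j * of_real (sine_vec n j p))" for p
    have XX': "X p = X' p" if "p \<le> Suc n" for p
    proof (cases "p \<in> {1..n}")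
      case True then show ?thesis using exp by (simp add: X'_def)
    next
      case False
      then have "p = 0 \<or> p = Suc n" using that by auto
      then show ?thesis using X0 Xn by (auto simp: X'_def)
    qed
    have rec: "X (Suc p) + X (p - 1) = c * (\<Sum>j=1..n. of_real (2 * cos (phi n j)) * (y j * of_real (sine_vec n j p)))"
      if pn: "p \<in> {1..n}" for p
    proof -
      obtain q where q: "p = Suc q" using pn by (cases p) auto
      have "X (Suc p) + X (p - 1) = X' (Suc p) + X' (p - 1)" using XX' pn by auto
      also have "\<dots> = c * (\<Sum>j=1..n. y j * of_real (sine_vec n j (Suc (Suc q)) + sine_vec n j q))"
        by (simp add: X'_def q sum.distrib distrib_left)
      finally show ?thesis unfolding sine_vec_rec q by (simp add: mult_ac)
    qed
    let ?B = "\<Sum>p=1..n. cnj (X p) * X (Suc p)"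
    have "(\<Sum>p=1..n. cnj (X p) * (X (p - 1) - cnj 0 * X p)) = cnj (jform n 0 X X)"
      by (rule jform_adjoint) (use X0 Xn in auto)
    then have "(\<Sum>p=1..n. cnj (X p) * X (p - 1)) = cnj ?B"
      by (simp add: jform_def)
    then have "?B + cnj ?B = (\<Sum>p=1..n. cnj (X p) * (X (Suc p) + X (p - 1)))"
      by (simp add: distrib_left sum.distrib)
    also have "\<dots> = (\<Sum>p=1..n. cnj (X p) * (c * (\<Sum>j=1..n. of_real (2 * cos (phi n j)) * (y j * of_real (sine_vec n j p)))))"
      by (intro sum.cong refl arg_cong2[where f = "(*)"] rec)
    also have "\<dots> = c * (\<Sum>j=1..n. of_real (2 * cos (phi n j)) * (y j * cnj (y j)))" by (rule swap)
    also have "\<dots> = of_real (2 / (real n + 1) * (\<Sum>j=1..n. 2 * cos (phi n j) * (cmod (y j))\<^sup>2))"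
      unfolding of_real_mult of_real_sum complex_norm_square c_def ..
    finally have "2 * Re ?B = 2 / (real n + 1) * (\<Sum>j=1..n. 2 * cos (phi n j) * (cmod (y j))\<^sup>2)"
      unfolding complex_add_cnj by (simp only: of_real_eq_iff)
    then show ?thesis by (simp add: sum_distrib_left[symmetric] mult.assoc)
  qed
qed

text \<open>Courant-Fischer: without the first \<open>k - 1\<close> coefficients only eigenvalues up
  to \<open>cos (phi n k)\<close> contribute. If \<open>n < k\<close>, no coefficient is left, hence
  the guarded assumption on \<open>c\<close>.\<close>

lemma shift_form_upper_bound:
  fixes X :: "nat \<Rightarrow> complex"
  assumes X: "X 0 = 0" "X (Suc n) = 0" and k: "1 \<le> k"
    and y: "\<And>j. 1 \<le> j \<Longrightarrow> j < k \<Longrightarrow> (\<Sum>q=1..n. of_real (sine_vec n j q) * X q) = 0"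
    and c: "k \<le> n \<Longrightarrow> cos (phi n k) \<le> c"
  shows "Re (\<Sum>p=1..n. cnj (X p) * X (Suc p)) \<le> c * (\<Sum>p=1..n. (cmod (X p))\<^sup>2)"
proof -
  define y where "y j = (\<Sum>q=1..n. of_real (sine_vec n j q) * X q)" for j
  have "(\<Sum>j=1..n. cos (phi n j) * (cmod (y j))\<^sup>2) \<le> (\<Sum>j=1..n. c * (cmod (y j))\<^sup>2)"
  proof (rule sum_mono)
    fix j assume j: "j \<in> {1..n}"
    show "cos (phi n j) * (cmod (y j))\<^sup>2 \<le> c * (cmod (y j))\<^sup>2"
    proof (cases "j < k")
      case True then show ?thesis using j assms(4)[of j] by (simp add: y_def)
    next
      case False
      then have "cos (phi n j) \<le> c" using cos_phi_le[of k j n] c j k by auto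
      then show ?thesis by (simp add: mult_right_mono)
    qed
  qed
  then have "2 / (real n + 1) * (\<Sum>j=1..n. cos (phi n j) * (cmod (y j))\<^sup>2)
      \<le> 2 / (real n + 1) * (c * (\<Sum>j=1..n. (cmod (y j))\<^sup>2))"
    unfolding sum_distrib_left[symmetric] by (intro mult_left_mono) auto
  also have "\<dots> = c * (\<Sum>p=1..n. (cmod (X p))\<^sup>2)"
    unfolding sine_parseval(1)[of X n] y_def by simp
  finally show ?thesis
    using sine_parseval(2)[of X n] X unfolding y_def by simp
qed

section \<open>The direct sum of a Jordan block and a scalar block\<close>

lemma sum_lessThan_add:
  fixes f :: "nat \<Rightarrow> 'a::comm_monoid_add"
  shows "(\<Sum>i<n + m. f i) = (\<Sum>i<n. f i) + (\<Sum>q<m. f (n + q))"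
  by (induction m) (simp_all add: add.assoc)

lemma sum_lessThan_Suc_shift: "(\<Sum>i<n. f (Suc i)) = (\<Sum>p=1..n. f p)"
  by (rule sum.reindex_bij_witness[of _ "\<lambda>p. p - 1" Suc]) auto

text \<open>Vectors of the Jordan block are functions \<open>X\<close> on \<open>{1..n}\<close> padded by \<open>X 0 = X (n + 1) = 0\<close>, so that
  the shift needs no case distinction; matrix indices start at 0.\<close>
definition direct_sum_vec :: "nat \<Rightarrow> (nat \<Rightarrow> complex) \<Rightarrow> (nat \<Rightarrow> complex) \<Rightarrow> nat \<Rightarrow> complex" where
  "direct_sum_vec n X W i = (if i < n then X (Suc i) else W (i - n))"

lemma Tmat_carrier: "Tmat n m \<alpha> \<beta> \<in> carrier_mat (n + m) (n + m)"
  unfolding Tmat_def by (intro four_block_carrier_mat) auto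

lemma Tmat_index:
  assumes "i < n + m" "j < n + m"
  shows "Tmat n m \<alpha> \<beta> $$ (i,j) = (if i = j then (if i < n then \<alpha> else \<beta>)
    else if Suc i = j \<and> j < n then 1 else 0)"
  using assms unfolding Tmat_def by (auto simp: jordan_block_def)

lemma Tmat_row:
  assumes "X (Suc n) = 0"
  shows "i < n \<Longrightarrow> (\<Sum>j<n + m. Tmat n m \<alpha> \<beta> $$ (i,j) * direct_sum_vec n X W j) = \<alpha> * X (Suc i) + X (Suc (Suc i))"
    and "q < m \<Longrightarrow> (\<Sum>j<n + m. Tmat n m \<alpha> \<beta> $$ (n + q,j) * direct_sum_vec n X W j) = \<beta> * W q"
proof -
  assume i: "i < n"
  have "(\<Sum>j<n + m. Tmat n m \<alpha> \<beta> $$ (i,j) * direct_sum_vec n X W j)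
    = (\<Sum>j<n + m. (if j = i then \<alpha> * X (Suc i) else 0) + (if j = Suc i then (if j < n then X (Suc j) else 0) else 0))"
    by (intro sum.cong refl) (use i in \<open>auto simp: Tmat_index direct_sum_vec_def\<close>)
  also have "\<dots> = \<alpha> * X (Suc i) + (if Suc i < n then X (Suc (Suc i)) else 0)"
    using i unfolding sum.distrib by (simp add: sum.delta)
  also have "\<dots> = \<alpha> * X (Suc i) + X (Suc (Suc i))"
    using i assms by (cases "Suc i = n") auto
  finally show "(\<Sum>j<n + m. Tmat n m \<alpha> \<beta> $$ (i,j) * direct_sum_vec n X W j) = \<alpha> * X (Suc i) + X (Suc (Suc i))" .
next
  assume q: "q < m"
  have "(\<Sum>j<n + m. Tmat n m \<alpha> \<beta> $$ (n + q,j) * direct_sum_vec n X W j)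
    = (\<Sum>j<n + m. if j = n + q then \<beta> * W q else 0)"
    by (intro sum.cong refl) (use q in \<open>auto simp: Tmat_index direct_sum_vec_def\<close>)
  also have "\<dots> = \<beta> * W q" using q by (simp add: sum.delta)
  finally show "(\<Sum>j<n + m. Tmat n m \<alpha> \<beta> $$ (n + q,j) * direct_sum_vec n X W j) = \<beta> * W q" .
qed

lemma Tmat_form:
  assumes "X (Suc n) = 0"
  shows "(\<Sum>i<n + m. cnj (direct_sum_vec n Y V i) * (\<Sum>j<n + m. Tmat n m \<alpha> \<beta> $$ (i,j) * direct_sum_vec n X W j))
      - lam * (\<Sum>i<n + m. cnj (direct_sum_vec n Y V i) * direct_sum_vec n X W i)
    = jform n (lam - \<alpha>) Y X + (\<beta> - lam) * (\<Sum>q<m. cnj (V q) * W q)"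
proof -
  have "(\<Sum>i<n + m. cnj (direct_sum_vec n Y V i) * (\<Sum>j<n + m. Tmat n m \<alpha> \<beta> $$ (i,j) * direct_sum_vec n X W j))
    = (\<Sum>i<n. cnj (Y (Suc i)) * (\<alpha> * X (Suc i) + X (Suc (Suc i)))) + (\<Sum>q<m. cnj (V q) * (\<beta> * W q))"
    (is "?L = _")
  proof -
    have "?L = (\<Sum>i<n. cnj (direct_sum_vec n Y V i) * (\<Sum>j<n + m. Tmat n m \<alpha> \<beta> $$ (i,j) * direct_sum_vec n X W j))
      + (\<Sum>q<m. cnj (direct_sum_vec n Y V (n + q)) * (\<Sum>j<n + m. Tmat n m \<alpha> \<beta> $$ (n + q,j) * direct_sum_vec n X W j))"
      by (rule sum_lessThan_add)
    also have "\<dots> = (\<Sum>i<n. cnj (Y (Suc i)) * (\<alpha> * X (Suc i) + X (Suc (Suc i)))) + (\<Sum>q<m. cnj (V q) * (\<beta> * W q))"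
    proof (intro arg_cong2[where f = "(+)"] sum.cong refl)
      fix i assume "i \<in> {..<n}"
      then have i: "i < n" by simp
      show "cnj (direct_sum_vec n Y V i) * (\<Sum>j<n + m. Tmat n m \<alpha> \<beta> $$ (i,j) * direct_sum_vec n X W j)
        = cnj (Y (Suc i)) * (\<alpha> * X (Suc i) + X (Suc (Suc i)))"
        unfolding Tmat_row(1)[where X = X and n = n, OF assms i] using i by (simp add: direct_sum_vec_def)
    next
      fix q assume "q \<in> {..<m}"
      then have q: "q < m" by simp
      show "cnj (direct_sum_vec n Y V (n + q)) * (\<Sum>j<n + m. Tmat n m \<alpha> \<beta> $$ (n + q,j) * direct_sum_vec n X W j)
        = cnj (V q) * (\<beta> * W q)"
        unfolding Tmat_row(2)[where X = X and n = n, OF assms q] by (simp add: direct_sum_vec_def)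
    qed
    finally show ?thesis .
  qed
  also have "(\<Sum>i<n. cnj (Y (Suc i)) * (\<alpha> * X (Suc i) + X (Suc (Suc i))))
      = (\<Sum>p=1..n. cnj (Y p) * (\<alpha> * X p + X (Suc p)))"
    by (rule sum_lessThan_Suc_shift)
  finally have 1: "(\<Sum>i<n + m. cnj (direct_sum_vec n Y V i) * (\<Sum>j<n + m. Tmat n m \<alpha> \<beta> $$ (i,j) * direct_sum_vec n X W j))
    = (\<Sum>p=1..n. cnj (Y p) * (\<alpha> * X p + X (Suc p))) + (\<Sum>q<m. cnj (V q) * (\<beta> * W q))" .
  have "(\<Sum>i<n + m. cnj (direct_sum_vec n Y V i) * direct_sum_vec n X W i)
    = (\<Sum>i<n. cnj (Y (Suc i)) * X (Suc i)) + (\<Sum>q<m. cnj (V q) * W q)"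
    unfolding sum_lessThan_add[of _ n m] by (simp add: direct_sum_vec_def)
  also have "(\<Sum>i<n. cnj (Y (Suc i)) * X (Suc i)) = (\<Sum>p=1..n. cnj (Y p) * X p)"
    by (rule sum_lessThan_Suc_shift)
  finally have 2: "(\<Sum>i<n + m. cnj (direct_sum_vec n Y V i) * direct_sum_vec n X W i)
    = (\<Sum>p=1..n. cnj (Y p) * X p) + (\<Sum>q<m. cnj (V q) * W q)" .
  have "(\<Sum>p=1..n. cnj (Y p) * (\<alpha> * X p + X (Suc p))) - lam * (\<Sum>p=1..n. cnj (Y p) * X p) = jform n (lam - \<alpha>) Y X"
    unfolding jform_def sum_distrib_left sum_subtractf[symmetric] by (intro sum.cong refl) (simp add: algebra_simps)
  moreover have "(\<Sum>q<m. cnj (V q) * (\<beta> * W q)) - lam * (\<Sum>q<m. cnj (V q) * W q) = (\<beta> - lam) * (\<Sum>q<m. cnj (V q) * W q)"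
    unfolding sum_distrib_left sum_subtractf[symmetric] by (intro sum.cong refl) (simp add: algebra_simps)
  ultimately show ?thesis unfolding 1 2 by (simp add: algebra_simps)
qed

lemma higher_rank_nr_TmatI:
  assumes bd: "\<And>l. l < k \<Longrightarrow> X l (Suc n) = 0"
    and form: "\<And>a b. a < k \<Longrightarrow> b < k \<Longrightarrow>
      jform n (lam - \<alpha>) (X a) (X b) + (\<beta> - lam) * (\<Sum>q<m. cnj (W a q) * W b q) = 0"
    and indep: "\<And>y. \<lbrakk>\<And>p. 1 \<le> p \<Longrightarrow> p \<le> n \<Longrightarrow> (\<Sum>l<k. y l * X l p) = 0;
      \<And>q. q < m \<Longrightarrow> (\<Sum>l<k. y l * W l q) = 0\<rbrakk> \<Longrightarrow> \<forall>l<k. y l = 0"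
  shows "lam \<in> higher_rank_nr k (Tmat n m \<alpha> \<beta>)"
proof (rule higher_rank_nrI[OF Tmat_carrier, where w = "\<lambda>l. direct_sum_vec n (X l) (W l)"])
  fix y assume y: "\<And>i. i < n + m \<Longrightarrow> (\<Sum>l<k. y l * direct_sum_vec n (X l) (W l) i) = 0"
  show "\<forall>l<k. y l = 0"
  proof (rule indep)
    fix p :: nat assume p: "1 \<le> p" "p \<le> n"
    then have "p - 1 < n + m" "p - 1 < n" "Suc (p - 1) = p" by auto
    then show "(\<Sum>l<k. y l * X l p) = 0" using y[of "p - 1"] by (simp only: direct_sum_vec_def if_True)
  next
    fix q assume "q < m"
    then show "(\<Sum>l<k. y l * W l q) = 0" using y[of "n + q"] by (simp add: direct_sum_vec_def)
  qed
next
  fix a b assume "a < k" "b < k"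
  then show "(\<Sum>i<n + m. cnj (direct_sum_vec n (X a) (W a) i) * (\<Sum>j<n + m. Tmat n m \<alpha> \<beta> $$ (i,j) * direct_sum_vec n (X b) (W b) j))
    = lam * (\<Sum>i<n + m. cnj (direct_sum_vec n (X a) (W a) i) * direct_sum_vec n (X b) (W b) i)"
    using Tmat_form[where X = "X b", OF bd, where Y = "X a" and V = "W a" and W = "W b" and \<alpha> = \<alpha> and \<beta> = \<beta> and lam = lam and m = m] form[of a b] by simp
qed

text \<open>The families \<open>f\<close> and \<open>g\<close> hold the coefficients of
  \<open>r\<close> freely chosen linear conditions on the two components of the vector; the
  necessary conditions on \<open>lam\<close> arise from suitable choices.\<close>

lemma higher_rank_nr_TmatE:
  assumes lam: "lam \<in> higher_rank_nr k (Tmat n m \<alpha> \<beta>)" and rk: "r < k"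
  obtains X W where "X 0 = 0" "X (Suc n) = 0"
    "(\<exists>p. 1 \<le> p \<and> p \<le> n \<and> X p \<noteq> 0) \<or> (\<exists>q<m. W q \<noteq> 0)"
    "\<And>a. a < r \<Longrightarrow> (\<Sum>p=1..n. f a p * X p) + (\<Sum>q<m. g a q * W q) = 0"
    "jform n (lam - \<alpha>) X X + (\<beta> - lam) * (\<Sum>q<m. cnj (W q) * W q) = 0"
proof (rule higher_rank_nr_range_vector[OF Tmat_carrier lam rk,
      where f = "\<lambda>a i. if i < n then f a (Suc i) else g a (i - n)"])
  fix x
  assume x: "\<exists>i<n + m. x i \<noteq> 0"
    "\<And>a. a < r \<Longrightarrow> (\<Sum>i<n + m. (if i < n then f a (Suc i) else g a (i - n)) * x i) = 0"
    "(\<Sum>i<n + m. cnj (x i) * (\<Sum>j<n + m. Tmat n m \<alpha> \<beta> $$ (i,j) * x j)) = lam * (\<Sum>i<n + m. cnj (x i) * x i)"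
  define X where "X p = (if 1 \<le> p \<and> p \<le> n then x (p - 1) else 0)" for p
  define W where "W q = x (n + q)" for q
  have xd: "x = direct_sum_vec n X W"
    by (auto simp: direct_sum_vec_def X_def W_def fun_eq_iff)
  show thesis
  proof (rule that[of X W])
    show "X 0 = 0" "X (Suc n) = 0" by (auto simp: X_def)
    show "(\<exists>p. 1 \<le> p \<and> p \<le> n \<and> X p \<noteq> 0) \<or> (\<exists>q<m. W q \<noteq> 0)"
    proof -
      obtain i where i: "i < n + m" "x i \<noteq> 0" using x(1) by blast
      show ?thesis
      proof (cases "i < n")
        case True
        then have "1 \<le> Suc i \<and> Suc i \<le> n \<and> X (Suc i) \<noteq> 0" using i by (simp add: X_def)
        then show ?thesis by blast
      next
        case False
        then have "i - n < m \<and> W (i - n) \<noteq> 0" using i by (auto simp: W_def)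
        then show ?thesis by blast
      qed
    qed
    show "(\<Sum>p=1..n. f a p * X p) + (\<Sum>q<m. g a q * W q) = 0" if "a < r" for a
    proof -
      have "(\<Sum>i<n. f a (Suc i) * X (Suc i)) + (\<Sum>q<m. g a q * W q) = 0"
        using x(2)[OF that] unfolding sum_lessThan_add by (simp add: X_def W_def)
      then show ?thesis using sum_lessThan_Suc_shift[of "\<lambda>p. f a p * X p" n] by simp
    qed
    show "jform n (lam - \<alpha>) X X + (\<beta> - lam) * (\<Sum>q<m. cnj (W q) * W q) = 0"
      using x(3) Tmat_form[of X n X W m \<alpha> \<beta> W lam] unfolding xd[symmetric] by (simp add: X_def)
  qed
qed

text \<open>The root of \<open>\<rho> (1 + s\<^sup>2) = 2 s a\<close> which is at least 1 if it is real, and lies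
  in the upper half of the unit circle otherwise.\<close>
definition pencil_root :: "real \<Rightarrow> real \<Rightarrow> complex" where
  "pencil_root \<rho> a = (if \<rho> \<le> a then of_real ((a + sqrt (a\<^sup>2 - \<rho>\<^sup>2)) / \<rho>)
     else Complex (a / \<rho>) (sqrt (\<rho>\<^sup>2 - a\<^sup>2) / \<rho>))"

lemma pencil_root_real:
  assumes "0 < \<rho>" "\<rho> \<le> a"
  shows "\<exists>s. pencil_root \<rho> a = of_real s \<and> 1 \<le> s \<and> (\<rho> < a \<longrightarrow> 1 < s)"
proof (intro exI conjI)
  define w where "w = sqrt (a\<^sup>2 - \<rho>\<^sup>2)"
  have "0 \<le> w" using assms by (simp add: w_def power_mono)
  then show "1 \<le> (a + sqrt (a\<^sup>2 - \<rho>\<^sup>2)) / \<rho>" "\<rho> < a \<longrightarrow> 1 < (a + sqrt (a\<^sup>2 - \<rho>\<^sup>2)) / \<rho>"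
    unfolding w_def[symmetric] using assms by (auto simp: less_divide_eq le_divide_eq)
  show "pencil_root \<rho> a = of_real ((a + sqrt (a\<^sup>2 - \<rho>\<^sup>2)) / \<rho>)" using assms by (simp add: pencil_root_def)
qed

lemma pencil_root_unimodular:
  assumes "0 < \<rho>" "- \<rho> < a" "a \<le> \<rho>"
  shows "cmod (pencil_root \<rho> a) = 1" "Re (pencil_root \<rho> a) = a / \<rho>" "0 \<le> Im (pencil_root \<rho> a)"
    "Im (pencil_root \<rho> a) = sqrt (\<rho>\<^sup>2 - a\<^sup>2) / \<rho>"
proof -
  have "\<bar>a\<bar> \<le> \<bar>\<rho>\<bar>" using assms by simp
  then have le: "a\<^sup>2 \<le> \<rho>\<^sup>2" by (simp add: abs_le_square_iff)
  show R: "Re (pencil_root \<rho> a) = a / \<rho>" and I: "Im (pencil_root \<rho> a) = sqrt (\<rho>\<^sup>2 - a\<^sup>2) / \<rho>"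
    using assms by (auto simp: pencil_root_def)
  show "0 \<le> Im (pencil_root \<rho> a)" unfolding I using le assms by simp
  have "(cmod (pencil_root \<rho> a))\<^sup>2 = 1"
    unfolding cmod_power2 R I using le assms by (simp add: power_divide field_simps)
  then show "cmod (pencil_root \<rho> a) = 1"
    by (metis abs_norm_cancel one_power2 power2_eq_iff_nonneg norm_ge_zero zero_le_one)
qed

lemma pencil_root_eq:
  assumes \<rho>: "0 < \<rho>" and a: "- \<rho> < a"
  shows "2 * pencil_root \<rho> a * of_real a = of_real \<rho> * (1 + (pencil_root \<rho> a)\<^sup>2)"
proof -
  \<comment> \<open>Completing the square in the root equation multiplied by
    \<open>\<rho>\<close>.\<close>
  have "(of_real \<rho> * pencil_root \<rho> a - of_real a)\<^sup>2 = complex_of_real (a\<^sup>2 - \<rho>\<^sup>2)"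
  proof (cases "\<rho> \<le> a")
    case True
    define w where "w = sqrt (a\<^sup>2 - \<rho>\<^sup>2)"
    have w: "w\<^sup>2 = a\<^sup>2 - \<rho>\<^sup>2" using True \<rho> by (simp add: w_def power_mono)
    have "of_real \<rho> * pencil_root \<rho> a - of_real a = complex_of_real w"
      using True \<rho> by (simp add: pencil_root_def w_def)
    then show ?thesis unfolding w[symmetric] by simp
  next
    case False
    define w where "w = sqrt (\<rho>\<^sup>2 - a\<^sup>2)"
    have "\<bar>a\<bar> \<le> \<bar>\<rho>\<bar>" using a False by simp
    then have "a\<^sup>2 \<le> \<rho>\<^sup>2" by (simp add: abs_le_square_iff)
    then have w: "w\<^sup>2 = \<rho>\<^sup>2 - a\<^sup>2" by (simp add: w_def)
    have "of_real \<rho> * pencil_root \<rho> a - of_real a = \<i> * complex_of_real w"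
      using False \<rho> by (simp add: pencil_root_def w_def complex_eq_iff)
    then have "(of_real \<rho> * pencil_root \<rho> a - of_real a)\<^sup>2 = - complex_of_real (w\<^sup>2)"
      by (simp add: power_mult_distrib)
    then show ?thesis unfolding w by simp
  qed
  moreover have "R * (2 * S * A) = R * (R * (1 + S\<^sup>2))" if "(R * S - A)\<^sup>2 = A\<^sup>2 - R\<^sup>2" for R S A :: complex
  proof -
    have "R * (2 * S * A) - R * (R * (1 + S\<^sup>2)) = (A\<^sup>2 - R\<^sup>2) - (R * S - A)\<^sup>2"
      by (simp add: power2_eq_square algebra_simps)
    then show ?thesis using that by simp
  qed
  ultimately have "of_real \<rho> * (2 * pencil_root \<rho> a * of_real a) = of_real \<rho> * (of_real \<rho> * (1 + (pencil_root \<rho> a)\<^sup>2))"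
    by (simp only: of_real_diff of_real_power)
  then show ?thesis using \<rho> by simp
qed

text \<open>All roots have modulus at least 1, so the product can be 1 only for two unimodular roots
  with equal squares. Equal roots give \<open>a = b\<close>. Opposite roots, both in the closed
  upper half plane, are real, so one of \<open>a\<close> and \<open>b\<close> is
  \<open>- \<rho>\<close>, which is excluded.\<close>

lemma pencil_root_separated:
  assumes \<rho>: "0 < \<rho>" and a: "- \<rho> < a" and b: "- \<rho> < b" and ab: "a \<noteq> b \<or> \<rho> < a"
  shows "(pencil_root \<rho> a)\<^sup>2 * (cnj (pencil_root \<rho> b))\<^sup>2 \<noteq> 1"
proof
  let ?s = "pencil_root \<rho> a" and ?t = "pencil_root \<rho> b"
  assume eq: "?s\<^sup>2 * (cnj ?t)\<^sup>2 = 1"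
  then have "cmod (?s\<^sup>2 * (cnj ?t)\<^sup>2) = 1" by simp
  then have "(cmod ?s * cmod ?t)\<^sup>2 = 1" by (simp add: norm_mult norm_power power_mult_distrib)
  then have m: "cmod ?s * cmod ?t = 1"
    by (metis mult_nonneg_nonneg norm_ge_zero one_power2 power2_eq_iff_nonneg zero_le_one)
  have ge: "1 \<le> cmod (pencil_root \<rho> c) \<and> (\<rho> < c \<longrightarrow> 1 < cmod (pencil_root \<rho> c))" if "- \<rho> < c" for c
  proof (cases "\<rho> \<le> c")
    case True
    from pencil_root_real[OF \<rho> True] obtain s where s: "pencil_root \<rho> c = of_real s" "1 \<le> s" "\<rho> < c \<longrightarrow> 1 < s"
      by blast
    then show ?thesis by auto
  next
    case False
    then show ?thesis using pencil_root_unimodular(1)[OF \<rho> that] by simp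
  qed
  have s1: "\<not> 1 < cmod ?s" and t1: "\<not> 1 < cmod ?t"
    using m mult_left_mono[of 1 "cmod ?t" "cmod ?s"] mult_right_mono[of 1 "cmod ?s" "cmod ?t"] ge[OF a] ge[OF b]
    by auto
  then have ale: "a \<le> \<rho>" and ble: "b \<le> \<rho>" using ge[OF a] ge[OF b] by force+
  note A = pencil_root_unimodular[OF \<rho> a ale] and B = pencil_root_unimodular[OF \<rho> b ble]
  have "?t * cnj ?t = 1" using B(1) complex_norm_square[of ?t] by simp
  then have "?s\<^sup>2 = ?s\<^sup>2 * (?t * cnj ?t)\<^sup>2" by simp
  also have "\<dots> = ?s\<^sup>2 * (cnj ?t)\<^sup>2 * ?t\<^sup>2" by (simp add: power_mult_distrib)
  also have "\<dots> = ?t\<^sup>2" unfolding eq by simp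
  finally have "?s = ?t \<or> ?s = - ?t" by (simp add: power2_eq_iff)
  then show False
  proof
    assume "?s = ?t"
    then have "a = b" using A(2) B(2) \<rho> by (metis divide_cancel_right less_irrefl)
    then show False using ab ale by simp
  next
    assume n: "?s = - ?t"
    then have ba: "b = - a" using A(2) B(2) \<rho> by (simp add: field_simps)
    have "Im ?s = 0" using n A(3) B(3) by simp
    then have "sqrt (\<rho>\<^sup>2 - a\<^sup>2) = 0" using A(4) \<rho> by simp
    then have "\<rho>\<^sup>2 = a\<^sup>2" by simp
    then have "a = \<rho> \<or> a = - \<rho>" by (metis power2_eq_iff)
    then show False using a b ba by auto
  qed
qed

section \<open>Eigenvectors of the pencil\<close>

text \<open>Rotation by \<open>cis \<tau>\<close> reduces the equation for a complex
  \<open>z\<close> to the one for its modulus.\<close>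

lemma pencil_eq_rotate:
  assumes "2 * s * of_real a = of_real \<rho> * (1 + s\<^sup>2)"
  shows "2 * (cis \<tau> * s) * of_real a = of_real \<rho> * cis \<tau> + (cis \<tau> * s)\<^sup>2 * cnj (of_real \<rho> * cis \<tau>)"
proof -
  have c: "cis \<tau> * cnj (cis \<tau>) = 1" by (simp add: cis_cnj cis_mult)
  have "(cis \<tau> * s)\<^sup>2 * cnj (of_real \<rho> * cis \<tau>) = cis \<tau> * (cis \<tau> * cnj (cis \<tau>)) * of_real \<rho> * s\<^sup>2"
    by (simp only: complex_cnj_mult complex_cnj_complex_of_real power2_eq_square mult_ac)
  also have "\<dots> = cis \<tau> * of_real \<rho> * s\<^sup>2" unfolding c by simp
  finally have "of_real \<rho> * cis \<tau> + (cis \<tau> * s)\<^sup>2 * cnj (of_real \<rho> * cis \<tau>) = cis \<tau> * (of_real \<rho> * (1 + s\<^sup>2))"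
    by (simp add: algebra_simps)
  also have "\<dots> = 2 * (cis \<tau> * s) * of_real a" unfolding assms[symmetric] by simp
  finally show ?thesis by simp
qed

definition iso_vec :: "nat \<Rightarrow> real \<Rightarrow> real \<Rightarrow> nat \<Rightarrow> nat \<Rightarrow> complex" where
  "iso_vec n \<rho> \<tau> j = pencil_vec n j (cis \<tau> * pencil_root \<rho> (cos (phi n j)))"

lemma iso_vec_boundary [simp]: "iso_vec n \<rho> \<tau> j 0 = 0" "iso_vec n \<rho> \<tau> j (Suc n) = 0"
  by (simp_all add: iso_vec_def)

text \<open>The rotations cancel in the product of squares, so the separation of the roots decides.
  The alternative \<open>\<rho> < cos (phi n j)\<close> admits \<open>j = l\<close>.\<close>

lemma jform_iso_vec_orthogonal:
  assumes "0 < \<rho>" "- \<rho> < cos (phi n j)" "- \<rho> < cos (phi n l)"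
    and "cos (phi n j) \<noteq> cos (phi n l) \<or> \<rho> < cos (phi n j)"
  shows "jform n (of_real \<rho> * cis \<tau>) (iso_vec n \<rho> \<tau> l) (iso_vec n \<rho> \<tau> j) = 0"
  unfolding iso_vec_def
proof (rule jform_pencil_vec_orthogonal)
  let ?s = "pencil_root \<rho> (cos (phi n j))" and ?t = "pencil_root \<rho> (cos (phi n l))"
  have c: "cis \<tau> * cnj (cis \<tau>) = 1" by (simp add: cis_cnj cis_mult)
  have "(cis \<tau> * ?s)\<^sup>2 * (cnj (cis \<tau> * ?t))\<^sup>2 = (cis \<tau> * cnj (cis \<tau>))\<^sup>2 * (?s\<^sup>2 * (cnj ?t)\<^sup>2)"
    by (simp only: complex_cnj_mult power_mult_distrib mult_ac)
  also have "\<dots> = ?s\<^sup>2 * (cnj ?t)\<^sup>2" unfolding c by simp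
  finally show "(cis \<tau> * ?s)\<^sup>2 * (cnj (cis \<tau> * ?t))\<^sup>2 \<noteq> 1"
    using pencil_root_separated[OF assms] by simp
qed (intro pencil_eq_rotate pencil_root_eq assms)+

text \<open>A unimodular weight satisfies \<open>cnj u * u = 1\<close>, so the vector is its own
  partner in \<open>jform_pencil_vec_dual\<close>. The result is factored so that its direction
  \<open>- r + \<i> a\<close> becomes visible.\<close>

lemma jform_iso_vec_self:
  assumes \<rho>: "0 < \<rho>" and j: "1 \<le> j" "j \<le> n" and a: "- \<rho> < cos (phi n j)" "cos (phi n j) \<le> \<rho>"
  shows "jform n (of_real \<rho> * cis \<tau>) (iso_vec n \<rho> \<tau> j) (iso_vec n \<rho> \<tau> j)
    = cis \<tau> * of_real ((real n + 1) / 2 * (sqrt (\<rho>\<^sup>2 - (cos (phi n j))\<^sup>2) / \<rho>))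
      * Complex (- sqrt (\<rho>\<^sup>2 - (cos (phi n j))\<^sup>2)) (cos (phi n j))"
proof -
  define a where "a = cos (phi n j)"
  define s where "s = pencil_root \<rho> a"
  define r where "r = sqrt (\<rho>\<^sup>2 - a\<^sup>2)"
  note S = pencil_root_unimodular[OF \<rho>, of a, folded s_def]
  have ab: "- \<rho> < a" "a \<le> \<rho>" using a by (simp_all add: a_def)
  have "a\<^sup>2 \<le> \<rho>\<^sup>2" using ab by (simp add: abs_le_square_iff[symmetric])
  then have r2: "r\<^sup>2 = \<rho>\<^sup>2 - a\<^sup>2" by (simp add: r_def)
  have "cmod (cis \<tau> * s) = 1" using S(1)[OF ab] by (simp add: norm_mult)
  then have u: "cnj (cis \<tau> * s) * (cis \<tau> * s) = 1"
    by (metis complex_norm_square mult.commute of_real_1 power_one)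
  have "s = Complex (a / \<rho>) (r / \<rho>)" using S(2,4)[OF ab] by (simp add: complex_eq_iff r_def)
  moreover have "a / \<rho> * a - \<rho> = - (r / \<rho> * r)"
  proof -
    have "a / \<rho> * a - \<rho> = (a\<^sup>2 - \<rho>\<^sup>2) / \<rho>" using \<rho> by (simp add: diff_divide_distrib power2_eq_square)
    also have "a\<^sup>2 - \<rho>\<^sup>2 = - (r * r)" using r2 by (simp add: power2_eq_square)
    finally show ?thesis by simp
  qed
  ultimately have "s * of_real a - of_real \<rho> = of_real (r / \<rho>) * Complex (- r) a"
    by (simp add: complex_eq_iff)
  then have "cis \<tau> * s * of_real a - of_real \<rho> * cis \<tau> = cis \<tau> * (of_real (r / \<rho>) * Complex (- r) a)"
    by (metis mult.assoc mult.commute right_diff_distrib)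
  then have "(cis \<tau> * s * of_real a - of_real \<rho> * cis \<tau>) * of_real ((real n + 1) / 2)
    = cis \<tau> * of_real ((real n + 1) / 2 * (r / \<rho>)) * Complex (- r) a"
    by (simp only: of_real_mult mult_ac)
  then show ?thesis
    using jform_pencil_vec_dual[OF j u, of "of_real \<rho> * cis \<tau>"]
    by (simp only: iso_vec_def a_def[symmetric] s_def[symmetric] r_def[symmetric])
qed

text \<open>A root greater than 1 makes the vector orthogonal to itself. At the threshold
  \<open>\<rho> = cos (phi n j)\<close> the self value carries the factor
  \<open>sqrt 0\<close>.\<close>

lemma jform_iso_vec_isotropic:
  assumes "0 < \<rho>" "1 \<le> j" "j \<le> n" "\<rho> \<le> cos (phi n j)"
  shows "jform n (of_real \<rho> * cis \<tau>) (iso_vec n \<rho> \<tau> j) (iso_vec n \<rho> \<tau> j) = 0"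
proof (cases "\<rho> < cos (phi n j)")
  case True then show ?thesis using assms by (intro jform_iso_vec_orthogonal) auto
next
  case False
  then have eq: "cos (phi n j) = \<rho>" using assms(4) by simp
  have "- \<rho> < cos (phi n j)" "cos (phi n j) \<le> \<rho>" unfolding eq using assms(1) by auto
  from jform_iso_vec_self[OF assms(1-3) this, of \<tau>] show ?thesis unfolding eq by simp
qed

lemma jform_zero_right:
  assumes "\<And>p. 1 \<le> p \<Longrightarrow> p \<le> Suc n \<Longrightarrow> X p = 0"
  shows "jform n z Y X = 0"
  unfolding jform_def by (intro sum.neutral ballI) (simp add: assms)

text \<open>Replacing the root \<open>s\<close> by \<open>1/s\<close> gives a dual vector which pairs to zero with all other vectors.
  It exists only for \<open>s \<noteq> 1\<close>, which fails for at most one index.\<close>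
lemma iso_vec_independent:
  assumes \<rho>: "0 < \<rho>" and pn: "p \<le> n" and ge: "\<And>j. 1 \<le> j \<Longrightarrow> j \<le> p \<Longrightarrow> \<rho> \<le> cos (phi n j)"
    and 0: "\<And>P. 1 \<le> P \<Longrightarrow> P \<le> n \<Longrightarrow> (\<Sum>l<p. y l * iso_vec n \<rho> \<tau> (Suc l) P) = 0"
    and lp: "l < p"
  shows "y l = 0"
proof -
  let ?z = "of_real \<rho> * cis \<tau>"
  have c: "cnj (cis \<tau>) * cis \<tau> = 1" by (simp add: cis_cnj cis_mult)
  have main: "y j = 0" if jp: "j < p" and gt: "\<rho> < cos (phi n (Suc j))" for j
  proof -
    obtain s where s: "pencil_root \<rho> (cos (phi n (Suc j))) = of_real s" "1 < s"
      using pencil_root_real[OF \<rho>, of "cos (phi n (Suc j))"] gt by auto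
    define v where "v = cis \<tau> * of_real (1 / s)"
    have ss: "2 * s * cos (phi n (Suc j)) = \<rho> * (1 + s\<^sup>2)"
    proof -
      have "complex_of_real (2 * s * cos (phi n (Suc j))) = of_real (\<rho> * (1 + s\<^sup>2))"
        using pencil_root_eq[OF \<rho>, of "cos (phi n (Suc j))"] gt \<rho> s(1) by simp
      then show ?thesis by (simp only: of_real_eq_iff)
    qed
    \<comment> \<open>The root equation is palindromic, so \<open>1 / s\<close> solves it along with
      \<open>s\<close>.\<close>
    have "2 * (1 / s) * cos (phi n (Suc j)) = \<rho> * (1 + (1 / s)\<^sup>2)"
    proof -
      have "s\<^sup>2 * (2 * (1 / s) * cos (phi n (Suc j))) = 2 * s * cos (phi n (Suc j))"
        using s(2) by (simp add: power2_eq_square)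
      also have "\<dots> = s\<^sup>2 * (\<rho> * (1 + (1 / s)\<^sup>2))"
        unfolding ss using s(2) by (simp add: power_divide distrib_left distrib_right)
      finally have "s\<^sup>2 = 0 \<or> 2 * (1 / s) * cos (phi n (Suc j)) = \<rho> * (1 + (1 / s)\<^sup>2)"
        by (simp only: mult_cancel_left)
      then show ?thesis using s(2) by (elim disjE) (simp, assumption)
    qed
    then have "complex_of_real (2 * (1 / s) * cos (phi n (Suc j))) = of_real (\<rho> * (1 + (1 / s)\<^sup>2))" by simp
    then have "2 * of_real (1 / s) * complex_of_real (cos (phi n (Suc j))) = of_real \<rho> * (1 + (of_real (1 / s))\<^sup>2)"
      by (simp only: of_real_mult of_real_add of_real_power of_real_1 of_real_numeral)
    then have veq: "2 * v * of_real (cos (phi n (Suc j))) = ?z + v\<^sup>2 * cnj ?z"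
      unfolding v_def by (rule pencil_eq_rotate)
    have vu: "cnj v * (cis \<tau> * pencil_root \<rho> (cos (phi n (Suc j)))) = 1"
      using c s unfolding s(1) v_def by (simp add: mult.commute)
    have orth: "jform n ?z (pencil_vec n (Suc j) v) (iso_vec n \<rho> \<tau> (Suc l)) = 0" if l: "l < p" "l \<noteq> j" for l
      unfolding iso_vec_def
    proof (rule jform_pencil_vec_orthogonal[OF _ veq])
      have al: "\<rho> \<le> cos (phi n (Suc l))" using ge l by simp
      then have al': "- \<rho> < cos (phi n (Suc l))" using \<rho> by linarith
      show "2 * (cis \<tau> * pencil_root \<rho> (cos (phi n (Suc l)))) * of_real (cos (phi n (Suc l)))
        = ?z + (cis \<tau> * pencil_root \<rho> (cos (phi n (Suc l))))\<^sup>2 * cnj ?z"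
        by (intro pencil_eq_rotate pencil_root_eq \<rho> al')
      obtain t where t: "pencil_root \<rho> (cos (phi n (Suc l))) = of_real t" "1 \<le> t"
        using pencil_root_real[OF \<rho> al] by blast
      have "complex_of_real (2 * t * cos (phi n (Suc l))) = of_real (\<rho> * (1 + t\<^sup>2))"
        using pencil_root_eq[OF \<rho> al'] t(1) by simp
      then have tt: "2 * t * cos (phi n (Suc l)) = \<rho> * (1 + t\<^sup>2)" by (simp only: of_real_eq_iff)
      \<comment> \<open>A root determines its cosine through the root equation, and cosines
        determine indices.\<close>
      have "t \<noteq> s"
      proof
        assume "t = s"
        then have "2 * s * cos (phi n (Suc l)) = 2 * s * cos (phi n (Suc j))" using tt ss by (simp only:)
        then have "cos (phi n (Suc l)) = cos (phi n (Suc j))" using s(2) by simp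
        then show False using cos_phi_inj[of "Suc l" n "Suc j"] l jp pn by simp
      qed
      then have ts: "t\<^sup>2 \<noteq> s\<^sup>2" using t(2) s(2) by (simp add: power2_eq_iff)
      have "(cis \<tau> * of_real t)\<^sup>2 * (cnj v)\<^sup>2 = (cnj (cis \<tau>) * cis \<tau>)\<^sup>2 * of_real (t\<^sup>2 / s\<^sup>2)"
        unfolding v_def by (simp add: power_mult_distrib power_divide)
      also have "\<dots> = of_real (t\<^sup>2 / s\<^sup>2)" unfolding c by simp
      also have "\<dots> \<noteq> 1" using ts s(2) by (simp only: of_real_eq_1_iff) simp
      finally show "(cis \<tau> * pencil_root \<rho> (cos (phi n (Suc l))))\<^sup>2 * (cnj v)\<^sup>2 \<noteq> 1" unfolding t(1) .
    qed
    have "jform n ?z (pencil_vec n (Suc j) v) (\<lambda>P. \<Sum>l<p. y l * iso_vec n \<rho> \<tau> (Suc l) P) = 0"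
    proof (rule jform_zero_right)
      fix P :: nat assume "1 \<le> P" "P \<le> Suc n"
      then show "(\<Sum>l<p. y l * iso_vec n \<rho> \<tau> (Suc l) P) = 0"
        using 0[of P] by (cases "P = Suc n") auto
    qed
    then have "(\<Sum>l<p. y l * jform n ?z (pencil_vec n (Suc j) v) (iso_vec n \<rho> \<tau> (Suc l))) = 0"
      unfolding jform_sum_right .
    moreover have "(\<Sum>l<p. y l * jform n ?z (pencil_vec n (Suc j) v) (iso_vec n \<rho> \<tau> (Suc l)))
      = (\<Sum>l\<in>{j}. y l * jform n ?z (pencil_vec n (Suc j) v) (iso_vec n \<rho> \<tau> (Suc l)))"
      by (intro sum.mono_neutral_right) (use jp orth in auto)
    ultimately have "y j * jform n ?z (pencil_vec n (Suc j) v) (iso_vec n \<rho> \<tau> (Suc j)) = 0" by simp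
    moreover have "jform n ?z (pencil_vec n (Suc j) v) (iso_vec n \<rho> \<tau> (Suc j)) \<noteq> 0"
    proof -
      have "jform n ?z (pencil_vec n (Suc j) v) (iso_vec n \<rho> \<tau> (Suc j))
        = (cis \<tau> * pencil_root \<rho> (cos (phi n (Suc j))) * of_real (cos (phi n (Suc j))) - ?z) * of_real ((real n + 1) / 2)"
        unfolding iso_vec_def by (rule jform_pencil_vec_dual) (use jp pn vu in auto)
      also have "cis \<tau> * pencil_root \<rho> (cos (phi n (Suc j))) * of_real (cos (phi n (Suc j))) - ?z
        = cis \<tau> * of_real (s * cos (phi n (Suc j)) - \<rho>)"
        unfolding s(1) by (simp add: algebra_simps)
      finally have e: "jform n ?z (pencil_vec n (Suc j) v) (iso_vec n \<rho> \<tau> (Suc j))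
        = cis \<tau> * of_real (s * cos (phi n (Suc j)) - \<rho>) * of_real ((real n + 1) / 2)" .
      have "s * cos (phi n (Suc j)) > 1 * \<rho>"
        using s(2) gt \<rho> by (intro mult_strict_mono) auto
      then have "s * cos (phi n (Suc j)) - \<rho> \<noteq> 0" by simp
      moreover have "(real n + 1) / 2 \<noteq> 0" by simp
      ultimately show ?thesis unfolding e by (simp only: mult_eq_0_iff of_real_eq_0_iff cis_neq_zero) simp
    qed
    ultimately show ?thesis by simp
  qed
  show ?thesis
  proof (cases "\<rho> < cos (phi n (Suc l))")
    case True then show ?thesis using main lp by blast
  next
    \<comment> \<open>The index whose root is 1 has no dual vector, but all other coefficients are
      already zero, so a nonzero first entry suffices.\<close>
    case False
    then have eq: "cos (phi n (Suc l)) = \<rho>" using ge[of "Suc l"] lp by simp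
    have z: "y j = 0" if j: "j < p" "j \<noteq> l" for j
    proof (rule main[OF j(1)])
      have "cos (phi n (Suc j)) \<noteq> \<rho>"
        using cos_phi_inj[of "Suc j" n "Suc l"] j lp pn eq by auto
      then show "\<rho> < cos (phi n (Suc j))" using ge[of "Suc j"] j by simp
    qed
    have "(\<Sum>j<p. y j * iso_vec n \<rho> \<tau> (Suc j) 1) = (\<Sum>j\<in>{l}. y j * iso_vec n \<rho> \<tau> (Suc j) 1)"
      by (intro sum.mono_neutral_right) (use lp z in auto)
    moreover have "(\<Sum>j<p. y j * iso_vec n \<rho> \<tau> (Suc j) 1) = 0" using 0[of 1] lp pn by simp
    ultimately have "y l * iso_vec n \<rho> \<tau> (Suc l) 1 = 0" by simp
    moreover have "iso_vec n \<rho> \<tau> (Suc l) 1 \<noteq> 0"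
    proof -
      obtain s where s: "pencil_root \<rho> (cos (phi n (Suc l))) = of_real s" "1 \<le> s"
        using pencil_root_real[OF \<rho>, of "cos (phi n (Suc l))"] eq by auto
      have "sine_vec n (Suc l) 1 \<noteq> 0" using sin_phi_pos[of "Suc l" n] lp pn by (simp add: sine_vec_def)
      then show ?thesis using s by (simp add: iso_vec_def pencil_vec_def)
    qed
    ultimately show ?thesis by simp
  qed
qed

section \<open>Explicit isotropic subspaces\<close>

text \<open>For nonzero \<open>z\<close> the cosines at indices up to \<open>k\<close> are at least
  \<open>cmod z\<close>, so the vectors \<open>iso_vec\<close> are isotropic and mutually orthogonal
  for the form. The guard \<open>1 \<le> k\<close> leaves \<open>z\<close> free when the family is
  empty.\<close>

lemma isotropic_family:
  assumes k: "2 * k \<le> n + 1" and z: "1 \<le> k \<Longrightarrow> cmod z \<le> cos (phi n k)"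
  obtains X :: "nat \<Rightarrow> nat \<Rightarrow> complex" where "\<forall>l<k. X l (Suc n) = 0"
    "\<forall>a<k. \<forall>b<k. jform n z (X a) (X b) = 0"
    "\<forall>y. (\<forall>p. 1 \<le> p \<longrightarrow> p \<le> n \<longrightarrow> (\<Sum>l<k. y l * X l p) = 0) \<longrightarrow> (\<forall>l<k. y l = 0)"
proof (cases "z = 0")
  case True
  \<comment> \<open>The root equation degenerates at \<open>z = 0\<close>. The coordinate vectors at
    \<open>1, 3, ..., 2 * k - 1\<close> serve instead: the shift changes parity, and the last index
    is at most \<open>n\<close>.\<close>
  define X :: "nat \<Rightarrow> nat \<Rightarrow> complex" where "X l p = (if p = 2 * l + 1 then 1 else 0)" for l p
  show thesis
  proof (rule that[of X])
    show "\<forall>l<k. X l (Suc n) = 0" using k by (auto simp: X_def)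
    have "jform n z (X a) (X b) = 0" if "a < k" "b < k" for a b
      unfolding jform_def
    proof (rule sum.neutral, rule ballI)
      fix p
      have "odd p \<Longrightarrow> Suc p \<noteq> 2 * b + 1" by presburger
      then show "cnj (X a p) * (X b (Suc p) - z * X b p) = 0" using True by (auto simp: X_def)
    qed
    then show "\<forall>a<k. \<forall>b<k. jform n z (X a) (X b) = 0" by blast
    show "\<forall>y. (\<forall>p. 1 \<le> p \<longrightarrow> p \<le> n \<longrightarrow> (\<Sum>l<k. y l * X l p) = 0) \<longrightarrow> (\<forall>l<k. y l = 0)"
    proof (intro allI impI)
      fix y :: "nat \<Rightarrow> complex" and l
      assume y: "\<forall>p. 1 \<le> p \<longrightarrow> p \<le> n \<longrightarrow> (\<Sum>l<k. y l * X l p) = 0" and l: "l < k"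
      have "(\<Sum>i<k. y i * X i (2 * l + 1)) = 0" using y l k by simp
      moreover have "(\<Sum>i<k. y i * X i (2 * l + 1)) = (\<Sum>i<k. if i = l then y i else 0)"
        by (intro sum.cong) (auto simp: X_def)
      ultimately show "y l = 0" using l by simp
    qed
  qed
next
  case False
  define \<rho> where "\<rho> = cmod z"
  define \<tau> where "\<tau> = Arg z"
  have \<rho>: "0 < \<rho>" using False by (simp add: \<rho>_def)
  have zz: "z = of_real \<rho> * cis \<tau>" using rcis_cmod_Arg[of z] by (simp add: \<rho>_def \<tau>_def rcis_def)
  have kn: "k \<le> n" using k by (cases k) auto
  have ge: "\<rho> \<le> cos (phi n j)" if "1 \<le> j" "j \<le> k" for j
    using z cos_phi_le[of j k n] that kn by (simp add: \<rho>_def)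
  show thesis
  proof (rule that[of "\<lambda>l. iso_vec n \<rho> \<tau> (Suc l)"])
    have "jform n z (iso_vec n \<rho> \<tau> (Suc a)) (iso_vec n \<rho> \<tau> (Suc b)) = 0" if "a < k" "b < k" for a b
    proof (cases "a = b")
      case True
      then show ?thesis unfolding zz using that kn ge by (simp add: jform_iso_vec_isotropic \<rho>)
    next
      case False
      then have "cos (phi n (Suc b)) \<noteq> cos (phi n (Suc a))"
        using cos_phi_inj[of "Suc a" n "Suc b"] that kn by auto
      moreover have "- \<rho> < cos (phi n (Suc a))" "- \<rho> < cos (phi n (Suc b))"
        using ge[of "Suc a"] ge[of "Suc b"] that \<rho> by auto
      ultimately show ?thesis unfolding zz using \<rho> by (intro jform_iso_vec_orthogonal) auto
    qed
    then show "\<forall>a<k. \<forall>b<k. jform n z (iso_vec n \<rho> \<tau> (Suc a)) (iso_vec n \<rho> \<tau> (Suc b)) = 0" by blast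
    show "\<forall>y. (\<forall>p. 1 \<le> p \<longrightarrow> p \<le> n \<longrightarrow> (\<Sum>l<k. y l * iso_vec n \<rho> \<tau> (Suc l) p) = 0) \<longrightarrow> (\<forall>l<k. y l = 0)"
      using iso_vec_independent[OF \<rho> kn ge] by blast
  qed simp
qed

lemma higher_rank_nr_Tmat_disk:
  assumes "2 * k \<le> n + 1" and "1 \<le> k \<Longrightarrow> cmod (lam - \<alpha>) \<le> cos (phi n k)"
  shows "lam \<in> higher_rank_nr k (Tmat n m \<alpha> \<beta>)"
proof (rule isotropic_family[OF assms])
  fix X :: "nat \<Rightarrow> nat \<Rightarrow> complex"
  assume X: "\<forall>l<k. X l (Suc n) = 0" "\<forall>a<k. \<forall>b<k. jform n (lam - \<alpha>) (X a) (X b) = 0"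
    "\<forall>y. (\<forall>p. 1 \<le> p \<longrightarrow> p \<le> n \<longrightarrow> (\<Sum>l<k. y l * X l p) = 0) \<longrightarrow> (\<forall>l<k. y l = 0)"
  show ?thesis
  proof (rule higher_rank_nr_TmatI[where X = X and W = "\<lambda>_ _. 0"])
    show "X l (Suc n) = 0" if "l < k" for l using X(1) that by blast
    show "jform n (lam - \<alpha>) (X a) (X b) + (\<beta> - lam) * (\<Sum>q<m. cnj 0 * 0) = 0" if "a < k" "b < k" for a b
      using X(2) that by simp
    show "\<forall>l<k. y l = 0" if "\<And>p. 1 \<le> p \<Longrightarrow> p \<le> n \<Longrightarrow> (\<Sum>l<k. y l * X l p) = 0" for y
      using X(3) that by blast
  qed
qed

text \<open>At \<open>lam = \<beta>\<close> the scalar block contributes nothing to the form, so its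
  coordinate vectors come for free and only \<open>k - m\<close> isotropic vectors of the Jordan
  block are needed.\<close>

lemma higher_rank_nr_Tmat_eigenvalue:
  assumes k: "2 * (k - m) \<le> n + 1" and z: "m < k \<Longrightarrow> cmod (\<beta> - \<alpha>) \<le> cos (phi n (k - m))"
  shows "\<beta> \<in> higher_rank_nr k (Tmat n m \<alpha> \<beta>)"
proof (rule isotropic_family[OF k, of "\<beta> - \<alpha>"])
  show "1 \<le> k - m \<Longrightarrow> cmod (\<beta> - \<alpha>) \<le> cos (phi n (k - m))" using z by simp
  fix X :: "nat \<Rightarrow> nat \<Rightarrow> complex"
  assume X: "\<forall>l<k - m. X l (Suc n) = 0" "\<forall>a<k - m. \<forall>b<k - m. jform n (\<beta> - \<alpha>) (X a) (X b) = 0"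
    "\<forall>y. (\<forall>p. 1 \<le> p \<longrightarrow> p \<le> n \<longrightarrow> (\<Sum>l<k - m. y l * X l p) = 0) \<longrightarrow> (\<forall>l<k - m. y l = 0)"
  define X' where "X' l p = (if l < k - m then X l p else 0)" for l p
  define W where "W l q = (if l < k - m then 0 else if q = l - (k - m) then 1 else (0::complex))" for l q
  show ?thesis
  proof (rule higher_rank_nr_TmatI[where X = X' and W = W])
    show "X' l (Suc n) = 0" for l using X(1) by (simp add: X'_def)
    fix a b
    show "jform n (\<beta> - \<alpha>) (X' a) (X' b) + (\<beta> - \<beta>) * (\<Sum>q<m. cnj (W a q) * W b q) = 0"
    proof (cases "a < k - m \<and> b < k - m")
      case True
      then have "X' a = X a" "X' b = X b" by (auto simp: X'_def)
      then show ?thesis using X(2) True by simp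
    next
      case False
      then show ?thesis by (auto simp: jform_def X'_def)
    qed
  next
    fix y assume y: "\<And>p. 1 \<le> p \<Longrightarrow> p \<le> n \<Longrightarrow> (\<Sum>l<k. y l * X' l p) = 0"
      "\<And>q. q < m \<Longrightarrow> (\<Sum>l<k. y l * W l q) = 0"
    have "(\<Sum>l<k - m. y l * X l p) = 0" if "1 \<le> p" "p \<le> n" for p
    proof -
      have "(\<Sum>l<k. y l * X' l p) = (\<Sum>l<k - m. y l * X' l p)"
        by (intro sum.mono_neutral_right) (auto simp: X'_def)
      then show ?thesis using y(1)[OF that] by (simp add: X'_def)
    qed
    then have lo: "\<forall>l<k - m. y l = 0" using X(3) by blast
    show "\<forall>l<k. y l = 0"
    proof (intro allI impI)
      fix l assume l: "l < k"
      show "y l = 0"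
      proof (cases "l < k - m")
        case True then show ?thesis using lo by blast
      next
        case False
        have "(\<Sum>i<k. y i * W i (l - (k - m))) = (\<Sum>i<k. if i = l then y i else 0)"
          by (intro sum.cong) (use False lo in \<open>auto simp: W_def\<close>)
        then show ?thesis using y(2)[of "l - (k - m)"] False l by simp
      qed
    qed
  qed
qed

text \<open>The values of the form at \<open>iso_vec j\<close> and at \<open>iso_vec (n + 1 - j)\<close> are positive multiples of
  \<open>-r + \<i> a\<close> and \<open>-r - \<i> a\<close>; if they coincide as vectors, then \<open>a = 0\<close>.\<close>
lemma pair_weights:
  assumes K: "0 < K" and a: "0 \<le> a" and r: "0 < (r::real)" and x: "0 \<le> x" and y: "\<bar>y\<bar> * r \<le> a * x"
  obtains s t :: real where "a = 0 \<Longrightarrow> t = 0"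
    "of_real (s\<^sup>2 * K) * Complex (- r) a + of_real (t\<^sup>2 * K) * Complex (- r) (- a) + Complex x y = 0"
proof (cases "a = 0")
  case True
  then have "\<bar>y\<bar> * r \<le> 0" using y by simp
  then have y0: "y = 0" using r by (metis abs_le_zero_iff mult_le_0_iff not_less abs_ge_zero order_antisym_conv)
  show thesis
  proof (rule that[of 0 "sqrt (x / (K * r))"])
    have "(sqrt (x / (K * r)))\<^sup>2 * K * r = x" using x K r by simp
    then show "of_real ((sqrt (x / (K * r)))\<^sup>2 * K) * Complex (- r) a + of_real (0\<^sup>2 * K) * Complex (- r) (- a) + Complex x y = 0"
      using True y0 by (simp add: complex_eq_iff)
  qed simp
next
  case False
  then have a: "0 < a" using a by simp
  \<comment> \<open>Real and imaginary part form a linear system for the squared weights: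
    \<open>s2 + t2 = x / (K * r)\<close> and \<open>t2 - s2 = y / (K * a)\<close>. The bound on
    \<open>y\<close> makes both nonnegative.\<close>
  define s2 where "s2 = (x / r - y / a) / (2 * K)"
  define t2 where "t2 = (x / r + y / a) / (2 * K)"
  have b: "y * r \<le> a * x" "- (y * r) \<le> a * x" 
    using y mult_right_mono[OF abs_ge_self[of y] less_imp_le[OF r]]
      mult_right_mono[OF abs_ge_minus_self[of y] less_imp_le[OF r]] by simp_all
  have "y / a \<le> x / r" "- y / a \<le> x / r" using b a r by (simp_all add: field_simps)
  then have s2: "0 \<le> s2" and t2: "0 \<le> t2" using K by (auto simp: s2_def t2_def)
  have e1: "(s2 + t2) * K * r = x" using K r by (simp add: s2_def t2_def add_divide_distrib[symmetric] field_simps)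
  have e2: "(t2 - s2) * K * a = y" using K a by (simp add: s2_def t2_def diff_divide_distrib[symmetric] field_simps)
  show thesis
  proof (rule that[of "sqrt t2" "sqrt s2"])
    show "of_real ((sqrt s2)\<^sup>2 * K) * Complex (- r) a + of_real ((sqrt t2)\<^sup>2 * K) * Complex (- r) (- a) + Complex x y = 0"
      using s2 t2 e1 e2 by (simp add: complex_eq_iff algebra_simps)
  qed (use False in simp)
qed

text \<open>The cosines decrease, so the indices where they reach \<open>\<rho>\<close> form an
  initial segment.\<close>

lemma threshold_index:
  assumes "k \<le> n"
  obtains p where "p \<le> k" "\<And>j. 1 \<le> j \<Longrightarrow> j \<le> p \<Longrightarrow> \<rho> \<le> cos (phi n j)"
    "\<And>j. p < j \<Longrightarrow> j \<le> k \<Longrightarrow> cos (phi n j) < \<rho>"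
proof -
  have "\<exists>p\<le>k. (\<forall>j. 1 \<le> j \<longrightarrow> j \<le> p \<longrightarrow> \<rho> \<le> cos (phi n j)) \<and> (\<forall>j. p < j \<longrightarrow> j \<le> k \<longrightarrow> cos (phi n j) < \<rho>)"
    using assms
  proof (induction k)
    case (Suc k)
    show ?case
    proof (cases "\<rho> \<le> cos (phi n (Suc k))")
      case True
      have "\<rho> \<le> cos (phi n j)" if "1 \<le> j" "j \<le> Suc k" for j
        using cos_phi_le[of j "Suc k" n] that True Suc.prems by simp
      then show ?thesis by (intro exI[of _ "Suc k"]) auto
    next
      case False
      obtain p where "p \<le> k" "\<forall>j. 1 \<le> j \<longrightarrow> j \<le> p \<longrightarrow> \<rho> \<le> cos (phi n j)"
        "\<forall>j. p < j \<longrightarrow> j \<le> k \<longrightarrow> cos (phi n j) < \<rho>" using Suc by auto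
      then show ?thesis using False by (intro exI[of _ p]) (auto simp: le_Suc_eq)
    qed
  qed auto
  then show thesis using that by blast
qed

text \<open>Up to index \<open>p\<close> the vectors \<open>iso_vec\<close> are isotropic on their
  own. Each later index is combined with its reflection in \<open>Suc n\<close>, which has the
  opposite cosine, and with a fresh coordinate vector of the scalar block;
  \<open>pair_weights\<close> makes the three contributions cancel.\<close>

lemma higher_rank_nr_Tmat_kite:
  assumes k: "1 \<le> k" "2 * k \<le> n + 1"
    and lam: "lam - \<alpha> = of_real \<rho> * cis \<tau>" and c: "\<beta> - lam = cis \<tau> * Complex x y"
    and \<rho>: "cos (phi n k) < \<rho>"
    and m: "k \<le> m \<or> \<rho> \<le> cos (phi n (k - m))"
    and x: "0 \<le> x" and y: "\<bar>y\<bar> * sqrt (\<rho>\<^sup>2 - (cos (phi n k))\<^sup>2) \<le> cos (phi n k) * x"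
  shows "lam \<in> higher_rank_nr k (Tmat n m \<alpha> \<beta>)"
proof -
  have kn: "k \<le> n" using k by simp
  have ak: "0 \<le> cos (phi n j)" if "1 \<le> j" "j \<le> k" for j
    using cos_phi_nonneg[of j n] that k by simp
  have \<rho>0: "0 < \<rho>" using ak[of k] k \<rho> by simp
  obtain p where p: "p \<le> k" "\<And>j. 1 \<le> j \<Longrightarrow> j \<le> p \<Longrightarrow> \<rho> \<le> cos (phi n j)"
    "\<And>j. p < j \<Longrightarrow> j \<le> k \<Longrightarrow> cos (phi n j) < \<rho>" using threshold_index[OF kn, of \<rho>] by blast
  \<comment> \<open>Each index beyond \<open>p\<close> uses up one coordinate vector of the scalar
    block. If \<open>m < k\<close>, the bound on \<open>\<rho>\<close> places \<open>k - m\<close>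
    among the first \<open>p\<close> indices.\<close>
  have kpm: "k - p \<le> m"
  proof (cases "k \<le> m")
    case False
    then have "\<rho> \<le> cos (phi n (k - m))" using m by simp
    then have "\<not> p < k - m" using p(3)[of "k - m"] by auto
    then show ?thesis by simp
  qed simp
  let ?z = "of_real \<rho> * cis \<tau>"
  let ?v = "iso_vec n \<rho> \<tau>"
  have refl: "cos (phi n (Suc n - j)) = - cos (phi n j)" if "j \<le> n" for j
    using phi_reflect[of j n] that by simp
  have gt: "- \<rho> < cos (phi n j)" if "1 \<le> j" "j \<le> k" for j using ak[OF that] \<rho>0 by simp
  have gt': "- \<rho> < cos (phi n (Suc n - j))" if "p < j" "j \<le> k" for j
    using refl[of j] p(3)[OF that] that kn by simp
  \<comment> \<open>The weight \<open>t\<close> has to vanish at the middle index, where a vector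
    coincides with its reflection.\<close>
  have "\<exists>s t. (l < p \<longrightarrow> s = 1 \<and> t = 0) \<and> (2 * Suc l = n + 1 \<longrightarrow> t = 0) \<and>
    (p \<le> l \<longrightarrow> of_real (s\<^sup>2) * jform n ?z (?v (Suc l)) (?v (Suc l))
      + of_real (t\<^sup>2) * jform n ?z (?v (Suc n - Suc l)) (?v (Suc n - Suc l)) + (\<beta> - lam) = 0)"
    if l: "l < k" for l
  proof (cases "l < p")
    case True then show ?thesis by auto
  next
    case False
    define a where "a = cos (phi n (Suc l))"
    define r where "r = sqrt (\<rho>\<^sup>2 - a\<^sup>2)"
    define K where "K = (real n + 1) / 2 * (r / \<rho>)"
    have a0: "0 \<le> a" and a\<rho>: "a < \<rho>" using ak[of "Suc l"] p(3)[of "Suc l"] l False by (auto simp: a_def)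
    have "a\<^sup>2 < \<rho>\<^sup>2" using a0 a\<rho> by (simp add: power_strict_mono)
    then have r: "0 < r" by (simp add: r_def)
    then have K: "0 < K" using \<rho>0 by (simp add: K_def)
    \<comment> \<open>From \<open>k\<close> down to \<open>Suc l\<close> the cosine grows and
      \<open>r\<close> shrinks, so the kite at \<open>k\<close> is the smallest and its inequality
      implies the one needed here.\<close>
    have ale: "cos (phi n k) \<le> a" using cos_phi_le[of "Suc l" k n] l kn by (simp add: a_def)
    have "(cos (phi n k))\<^sup>2 \<le> a\<^sup>2" using ale ak[of k] k by (intro power_mono) auto
    then have "r \<le> sqrt (\<rho>\<^sup>2 - (cos (phi n k))\<^sup>2)" by (simp add: r_def)
    then have "\<bar>y\<bar> * r \<le> \<bar>y\<bar> * sqrt (\<rho>\<^sup>2 - (cos (phi n k))\<^sup>2)" by (intro mult_left_mono) auto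
    also have "\<dots> \<le> a * x" using y mult_right_mono[OF ale x] by linarith
    finally have yr: "\<bar>y\<bar> * r \<le> a * x" .
    obtain s t :: real where st: "a = 0 \<Longrightarrow> t = 0"
      "of_real (s\<^sup>2 * K) * Complex (- r) a + of_real (t\<^sup>2 * K) * Complex (- r) (- a) + Complex x y = 0"
      using pair_weights[OF K a0 r x yr] by blast
    have ln: "1 \<le> Suc l" "Suc l \<le> n" "1 \<le> Suc n - Suc l" "Suc n - Suc l \<le> n" using l kn k by auto
    have J1: "jform n ?z (?v (Suc l)) (?v (Suc l)) = cis \<tau> * of_real K * Complex (- r) a"
      using jform_iso_vec_self[OF \<rho>0 ln(1,2), of \<tau>] a0 a\<rho> \<rho>0 unfolding a_def r_def K_def by simp
    have ca: "cos (phi n (Suc n - Suc l)) = - a" using refl[of "Suc l"] ln by (simp only: a_def)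
    have J2: "jform n ?z (?v (Suc n - Suc l)) (?v (Suc n - Suc l)) = cis \<tau> * of_real K * Complex (- r) (- a)"
      using jform_iso_vec_self[OF \<rho>0 ln(3,4), of \<tau>] a0 a\<rho> \<rho>0 unfolding ca r_def K_def by simp
    have "of_real (s\<^sup>2) * jform n ?z (?v (Suc l)) (?v (Suc l))
      + of_real (t\<^sup>2) * jform n ?z (?v (Suc n - Suc l)) (?v (Suc n - Suc l)) + (\<beta> - lam)
      = cis \<tau> * (of_real (s\<^sup>2 * K) * Complex (- r) a + of_real (t\<^sup>2 * K) * Complex (- r) (- a) + Complex x y)"
      unfolding J1 J2 c by (simp only: of_real_mult distrib_left mult_ac)
    then have "of_real (s\<^sup>2) * jform n ?z (?v (Suc l)) (?v (Suc l))
      + of_real (t\<^sup>2) * jform n ?z (?v (Suc n - Suc l)) (?v (Suc n - Suc l)) + (\<beta> - lam) = 0"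
      unfolding st(2) by simp
    moreover have "t = 0" if "2 * Suc l = n + 1"
    proof -
      have e: "real n + 1 = 2 * real (Suc l)" using that by linarith
      have "A * pi / (2 * A) = pi / 2" if "A \<noteq> 0" for A :: real using that by simp
      then have "phi n (Suc l) = pi / 2" unfolding phi_def e by (metis of_nat_neq_0)
      then have "a = 0" unfolding a_def by (simp only: cos_pi_half)
      then show ?thesis using st(1) by simp
    qed
    ultimately show ?thesis using False by blast
  qed
  then obtain s t :: "nat \<Rightarrow> real" where st: "\<And>l. l < k \<Longrightarrow> l < p \<Longrightarrow> s l = 1 \<and> t l = 0"
    "\<And>l. l < k \<Longrightarrow> 2 * Suc l = n + 1 \<Longrightarrow> t l = 0"
    "\<And>l. l < k \<Longrightarrow> p \<le> l \<Longrightarrow> of_real ((s l)\<^sup>2) * jform n ?z (?v (Suc l)) (?v (Suc l))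
      + of_real ((t l)\<^sup>2) * jform n ?z (?v (Suc n - Suc l)) (?v (Suc n - Suc l)) + (\<beta> - lam) = 0"
    by metis
  define X where "X l P = of_real (s l) * ?v (Suc l) P + of_real (t l) * ?v (Suc n - Suc l) P" for l P
  define W where "W l q = (if p \<le> l \<and> q = l - p then 1 else (0::complex))" for l q
  have X: "jform n ?z (X a) (X b)
    = of_real (s a * s b) * jform n ?z (?v (Suc a)) (?v (Suc b)) + of_real (s a * t b) * jform n ?z (?v (Suc a)) (?v (Suc n - Suc b))
    + of_real (t a * s b) * jform n ?z (?v (Suc n - Suc a)) (?v (Suc b)) + of_real (t a * t b) * jform n ?z (?v (Suc n - Suc a)) (?v (Suc n - Suc b))" for a b
    unfolding X_def[abs_def] jform_add_left jform_add_right complex_cnj_complex_of_real of_real_mult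
    by (simp only: distrib_left add_ac mult_ac)
  have orth: "jform n ?z (?v i) (?v j) = 0"
    if "i \<noteq> j" "1 \<le> i" "i \<le> n" "1 \<le> j" "j \<le> n" "- \<rho> < cos (phi n i)" "- \<rho> < cos (phi n j)" for i j
    using cos_phi_inj[of i n j] that by (intro jform_iso_vec_orthogonal \<rho>0) auto
  have tp: "p \<le> l" if "l < k" "t l \<noteq> 0" for l using st(1)[of l] that by force
  have t2: "2 * Suc l \<noteq> n + 1" if "l < k" "t l \<noteq> 0" for l using st(2)[of l] that by blast
  \<comment> \<open>Since \<open>2 * k \<le> n + 1\<close>, an index up to \<open>k\<close> and a
    reflected one can only meet at the middle index, and there \<open>t\<close> is zero.\<close>
  have mixed: "of_real (s a * t b) * jform n ?z (?v (Suc a)) (?v (Suc n - Suc b)) = 0"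
    "of_real (t b * s a) * jform n ?z (?v (Suc n - Suc b)) (?v (Suc a)) = 0" if ab: "a < k" "b < k" for a b
  proof -
    have "jform n ?z (?v (Suc a)) (?v (Suc n - Suc b)) = 0 \<and> jform n ?z (?v (Suc n - Suc b)) (?v (Suc a)) = 0"
      if tb: "t b \<noteq> 0"
    proof -
      have "Suc a \<noteq> Suc n - Suc b"
      proof
        assume e: "Suc a = Suc n - Suc b"
        then have "a = b" using ab k by arith
        then show False using t2[OF ab(2) tb] e k ab by arith
      qed
      moreover have "- \<rho> < cos (phi n (Suc n - Suc b))" using gt'[of "Suc b"] tp[OF ab(2) tb] ab by simp
      moreover have "- \<rho> < cos (phi n (Suc a))" using gt[of "Suc a"] ab by simp
      moreover have "1 \<le> Suc a" "Suc a \<le> n" "1 \<le> Suc n - Suc b" "Suc n - Suc b \<le> n" using ab kn by auto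
      ultimately show ?thesis using orth by metis
    qed
    then show "of_real (s a * t b) * jform n ?z (?v (Suc a)) (?v (Suc n - Suc b)) = 0"
      "of_real (t b * s a) * jform n ?z (?v (Suc n - Suc b)) (?v (Suc a)) = 0" by (cases "t b = 0"; simp)+
  qed
  show ?thesis
  proof (rule higher_rank_nr_TmatI[where X = X and W = W])
    show "X l (Suc n) = 0" for l by (simp add: X_def)
    fix a b assume ab: "a < k" "b < k"
    show "jform n (lam - \<alpha>) (X a) (X b) + (\<beta> - lam) * (\<Sum>q<m. cnj (W a q) * W b q) = 0"
    proof (cases "a = b")
      case False
      have "(\<Sum>q<m. cnj (W a q) * W b q) = 0" by (rule sum.neutral) (use False in \<open>auto simp: W_def\<close>)
      moreover have "jform n ?z (?v (Suc a)) (?v (Suc b)) = 0"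
        using orth[of "Suc a" "Suc b"] False ab kn gt[of "Suc a"] gt[of "Suc b"] by simp
      moreover have "of_real (t a * t b) * jform n ?z (?v (Suc n - Suc a)) (?v (Suc n - Suc b)) = 0"
      proof (cases "t a = 0 \<or> t b = 0")
        case True then show ?thesis by auto
      next
        case nz: False
        have "jform n ?z (?v (Suc n - Suc a)) (?v (Suc n - Suc b)) = 0"
        proof (rule orth)
          show "Suc n - Suc a \<noteq> Suc n - Suc b" using False ab kn by simp
          show "- \<rho> < cos (phi n (Suc n - Suc a))" using gt'[of "Suc a"] tp[of a] nz ab by simp
          show "- \<rho> < cos (phi n (Suc n - Suc b))" using gt'[of "Suc b"] tp[of b] nz ab by simp
        qed (use ab kn in auto)
        then show ?thesis by simp
      qed
      ultimately show ?thesis unfolding lam X mixed[OF ab] mixed[OF ab(2,1)] by simp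
    next
      case True
      show ?thesis
      proof (cases "a < p")
        case ap: True
        have "W a q = 0" for q using ap by (simp add: W_def)
        moreover have "jform n ?z (?v (Suc a)) (?v (Suc a)) = 0"
          using p(2)[of "Suc a"] ap ab kn by (intro jform_iso_vec_isotropic \<rho>0) auto
        ultimately show ?thesis unfolding lam X mixed[OF ab] mixed[OF ab(2,1)] using st(1)[OF ab(1) ap] True by simp
      next
        case ap: False
        have "(\<Sum>q<m. cnj (W a q) * W b q) = (\<Sum>q<m. if q = a - p then 1 else 0)"
          by (rule sum.cong) (use ap True in \<open>auto simp: W_def\<close>)
        also have "\<dots> = 1" using ap ab kpm p(1) by simp
        finally have w: "(\<Sum>q<m. cnj (W a q) * W b q) = 1" .
        show ?thesis unfolding lam X mixed[OF ab] mixed[OF ab(2,1)] w using st(3)[OF ab(1)] ap True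
          by (simp add: power2_eq_square)
      qed
    qed
  next
    fix w assume w: "\<And>P. 1 \<le> P \<Longrightarrow> P \<le> n \<Longrightarrow> (\<Sum>l<k. w l * X l P) = 0"
      "\<And>q. q < m \<Longrightarrow> (\<Sum>l<k. w l * W l q) = 0"
    \<comment> \<open>The scalar block components separate the indices from \<open>p\<close> on;
      what remains is the independence of the first \<open>p\<close> vectors.\<close>
    have hi: "w l = 0" if l: "p \<le> l" "l < k" for l
    proof -
      have "(\<Sum>i<k. w i * W i (l - p)) = (\<Sum>i<k. if i = l then w i else 0)"
        by (intro sum.cong) (use l in \<open>auto simp: W_def\<close>)
      then show ?thesis using w(2)[of "l - p"] l kpm by simp
    qed
    have lo: "(\<Sum>l<p. w l * ?v (Suc l) P) = 0" if P: "1 \<le> P" "P \<le> n" for P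
    proof -
      have "(\<Sum>l<k. w l * X l P) = (\<Sum>l<p. w l * X l P)"
        by (intro sum.mono_neutral_right) (use p(1) hi in auto)
      also have "\<dots> = (\<Sum>l<p. w l * ?v (Suc l) P)"
        by (intro sum.cong) (use st(1) p(1) in \<open>auto simp: X_def\<close>)
      finally show ?thesis using w(1)[OF P] by simp
    qed
    have pn: "p \<le> n" using p(1) kn by simp
    have "w l = 0" if "l < p" for l
      by (rule iso_vec_independent[OF \<rho>0 pn p(2) lo that]) assumption+
    then show "\<forall>l<k. w l = 0" using hi not_le by blast
  qed
qed

section \<open>Supporting half planes\<close>

text \<open>The unitary twist \<open>Y\<close> by powers of \<open>cis \<theta>\<close> multiplies
  the shift form by \<open>cis \<theta>\<close>, so the bound on real parts holds in every
  direction. Isotropy then expresses the shift form by \<open>z\<close> and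
  \<open>w\<close>.\<close>

lemma isotropic_vector_bound:
  fixes \<theta> :: real
  assumes X: "X 0 = 0" "X (Suc n) = 0" and k: "1 \<le> k"
    and iso: "jform n z X X + (w - z) * (\<Sum>q<m. cnj (W q) * W q) = 0"
    and y: "\<And>j. 1 \<le> j \<Longrightarrow> j < k \<Longrightarrow> (\<Sum>q=1..n. of_real (sine_vec n j q) * cis (real q * \<theta>) * X q) = 0"
    and c: "k \<le> n \<Longrightarrow> cos (phi n k) \<le> c"
  shows "Re (cis \<theta> * z) * ((\<Sum>p=1..n. (cmod (X p))\<^sup>2) + (\<Sum>q<m. (cmod (W q))\<^sup>2))
    \<le> c * (\<Sum>p=1..n. (cmod (X p))\<^sup>2) + Re (cis \<theta> * w) * (\<Sum>q<m. (cmod (W q))\<^sup>2)"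
proof -
  define S where "S = (\<Sum>p=1..n. (cmod (X p))\<^sup>2)"
  define S' where "S' = (\<Sum>q<m. (cmod (W q))\<^sup>2)"
  define B where "B = (\<Sum>p=1..n. cnj (X p) * X (Suc p))"
  have S: "(\<Sum>p=1..n. cnj (X p) * X p) = of_real S"
    unfolding S_def of_real_sum by (intro sum.cong refl) (simp only: complex_norm_square mult.commute)
  have S': "(\<Sum>q<m. cnj (W q) * W q) = of_real S'"
    unfolding S'_def of_real_sum by (intro sum.cong refl) (simp only: complex_norm_square mult.commute)
  have "jform n z X X = B - z * (\<Sum>p=1..n. cnj (X p) * X p)"
    unfolding jform_def B_def sum_distrib_left sum_subtractf[symmetric]
    by (intro sum.cong refl) (simp add: algebra_simps)
  then have B: "B = z * of_real (S + S') - w * of_real S'"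
  proof -
    assume e: "jform n z X X = B - z * (\<Sum>p=1..n. cnj (X p) * X p)"
    have "B - (z * of_real (S + S') - w * of_real S') = B - z * of_real S + (w - z) * of_real S'"
      by (simp add: algebra_simps)
    also have "\<dots> = 0" using iso unfolding e S S' .
    finally show ?thesis by simp
  qed
  define Y where "Y p = cis (real p * \<theta>) * X p" for p
  have le: "Re (\<Sum>p=1..n. cnj (Y p) * Y (Suc p)) \<le> c * (\<Sum>p=1..n. (cmod (Y p))\<^sup>2)"
  proof (rule shift_form_upper_bound[OF _ _ k _ c])
    fix j :: nat assume "1 \<le> j" "j < k"
    then show "(\<Sum>q=1..n. of_real (sine_vec n j q) * Y q) = 0"
      using y[of j] by (simp add: Y_def mult.assoc)
  qed (use X in \<open>auto simp: Y_def\<close>)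
  have YS: "(\<Sum>p=1..n. (cmod (Y p))\<^sup>2) = S" by (simp add: Y_def S_def norm_mult)
  have YB: "(\<Sum>p=1..n. cnj (Y p) * Y (Suc p)) = cis \<theta> * B"
    unfolding B_def sum_distrib_left
  proof (rule sum.cong)
    fix p
    have "cnj (cis (real p * \<theta>)) * cis (real (Suc p) * \<theta>) = cis \<theta>"
      by (simp add: cis_cnj cis_mult algebra_simps)
    then show "cnj (Y p) * Y (Suc p) = cis \<theta> * (cnj (X p) * X (Suc p))"
      unfolding Y_def by (simp only: complex_cnj_mult) (metis mult.assoc mult.left_commute)
  qed simp
  have "cis \<theta> * B = of_real (S + S') * (cis \<theta> * z) - of_real S' * (cis \<theta> * w)"
    unfolding B by (simp only: right_diff_distrib mult_ac)
  then have "Re (cis \<theta> * B) = (S + S') * Re (cis \<theta> * z) - S' * Re (cis \<theta> * w)"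
    by simp
  then show ?thesis using le[unfolded YB YS] unfolding S_def[symmetric] S'_def[symmetric] by (simp only: mult.commute)
qed

lemma vector_norm_pos:
  fixes X W :: "nat \<Rightarrow> complex"
  assumes "(\<exists>p. 1 \<le> p \<and> p \<le> n \<and> X p \<noteq> 0) \<or> (\<exists>q<m. W q \<noteq> 0)"
  shows "0 < (\<Sum>p=1..n. (cmod (X p))\<^sup>2) + (\<Sum>q<m. (cmod (W q))\<^sup>2)"
  using assms
proof
  assume "\<exists>p. 1 \<le> p \<and> p \<le> n \<and> X p \<noteq> 0"
  then obtain p where p: "p \<in> {1..n}" "X p \<noteq> 0" by auto
  have "0 < (\<Sum>p=1..n. (cmod (X p))\<^sup>2)" by (rule sum_pos2[OF _ p(1)]) (use p in auto)
  then show ?thesis by (intro add_pos_nonneg sum_nonneg) auto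
next
  assume "\<exists>q<m. W q \<noteq> 0"
  then obtain q where q: "q \<in> {..<m}" "W q \<noteq> 0" by auto
  have "0 < (\<Sum>q<m. (cmod (W q))\<^sup>2)" by (rule sum_pos2[OF _ q(1)]) (use q in auto)
  then show ?thesis by (intro add_nonneg_pos sum_nonneg) auto
qed

text \<open>The \<open>k - 1\<close> available conditions remove the sine coefficients
  \<open>1, ..., k - 1\<close> of the twisted vector. This bounds the Jordan part by
  \<open>c\<close>, and \<open>cw\<close> bounds the scalar part by the same
  \<open>c\<close>.\<close>

lemma higher_rank_nr_Tmat_support:
  assumes lam: "lam \<in> higher_rank_nr k (Tmat n m \<alpha> \<beta>)" and k: "1 \<le> k"
    and c: "k \<le> n \<Longrightarrow> cos (phi n k) \<le> c" and cw: "Re (cis \<theta> * (\<beta> - \<alpha>)) \<le> c"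
  shows "Re (cis \<theta> * (lam - \<alpha>)) \<le> c"
proof (rule higher_rank_nr_TmatE[OF lam, of "k - 1"
      "\<lambda>a p. of_real (sine_vec n (Suc a) p) * cis (real p * \<theta>)" "\<lambda>_ _. 0"])
  show "k - 1 < k" using k by simp
  fix X W :: "nat \<Rightarrow> complex"
  assume X: "X 0 = 0" "X (Suc n) = 0"
    and nz: "(\<exists>p. 1 \<le> p \<and> p \<le> n \<and> X p \<noteq> 0) \<or> (\<exists>q<m. W q \<noteq> 0)"
    and y: "\<And>a. a < k - 1 \<Longrightarrow> (\<Sum>p=1..n. of_real (sine_vec n (Suc a) p) * cis (real p * \<theta>) * X p) + (\<Sum>q<m. 0 * W q) = 0"
    and iso: "jform n (lam - \<alpha>) X X + (\<beta> - lam) * (\<Sum>q<m. cnj (W q) * W q) = 0"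
  define S where "S = (\<Sum>p=1..n. (cmod (X p))\<^sup>2)"
  define S' where "S' = (\<Sum>q<m. (cmod (W q))\<^sup>2)"
  have "Re (cis \<theta> * (lam - \<alpha>)) * (S + S') \<le> c * S + Re (cis \<theta> * (\<beta> - \<alpha>)) * S'"
    unfolding S_def S'_def
  proof (rule isotropic_vector_bound[OF X k _ _ c])
    show "jform n (lam - \<alpha>) X X + (\<beta> - \<alpha> - (lam - \<alpha>)) * (\<Sum>q<m. cnj (W q) * W q) = 0" using iso by simp
    fix j :: nat assume "1 \<le> j" "j < k"
    then show "(\<Sum>q=1..n. of_real (sine_vec n j q) * cis (real q * \<theta>) * X q) = 0" using y[of "j - 1"] by simp
  qed
  also have "\<dots> \<le> c * S + c * S'"
    using mult_right_mono[OF cw, of S'] by (simp add: S'_def sum_nonneg)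
  finally have "Re (cis \<theta> * (lam - \<alpha>)) * (S + S') \<le> c * (S + S')" by (simp add: distrib_left)
  then show ?thesis using vector_norm_pos[OF nz] unfolding S_def S'_def by (simp only: mult_le_cancel_right_pos)
qed

text \<open>The first \<open>m\<close> conditions remove the scalar block altogether, the other
  \<open>k - 1 - m\<close> remove the sine coefficients \<open>1, ..., k - m - 1\<close>. The
  direction \<open>- Arg (lam - \<alpha>)\<close> turns the real part into the modulus.\<close>

lemma higher_rank_nr_Tmat_norm_le:
  assumes lam: "lam \<in> higher_rank_nr k (Tmat n m \<alpha> \<beta>)" and k: "m < k"
  shows "cmod (lam - \<alpha>) \<le> cos (phi n (k - m))"
proof -
  define \<theta> where "\<theta> = - Arg (lam - \<alpha>)"
  have "lam - \<alpha> = of_real (cmod (lam - \<alpha>)) * cis (- \<theta>)"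
    using rcis_cmod_Arg[of "lam - \<alpha>"] by (simp add: \<theta>_def rcis_def)
  then have "cis \<theta> * (lam - \<alpha>) = of_real (cmod (lam - \<alpha>)) * (cis \<theta> * cis (- \<theta>))"
    by (metis mult.left_commute)
  then have z: "Re (cis \<theta> * (lam - \<alpha>)) = cmod (lam - \<alpha>)" by (simp add: cis_mult)
  show ?thesis
  proof (rule higher_rank_nr_TmatE[OF lam, of "k - 1"
        "\<lambda>a p. if a < m then 0 else of_real (sine_vec n (Suc (a - m)) p) * cis (real p * \<theta>)"
        "\<lambda>a q. if a < m \<and> q = a then 1 else 0"])
    show "k - 1 < k" using k by simp
    fix X W :: "nat \<Rightarrow> complex"
    assume X: "X 0 = 0" "X (Suc n) = 0"
      and nz: "(\<exists>p. 1 \<le> p \<and> p \<le> n \<and> X p \<noteq> 0) \<or> (\<exists>q<m. W q \<noteq> 0)"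
      and y: "\<And>a. a < k - 1 \<Longrightarrow> (\<Sum>p=1..n. (if a < m then 0 else of_real (sine_vec n (Suc (a - m)) p) * cis (real p * \<theta>)) * X p)
        + (\<Sum>q<m. (if a < m \<and> q = a then 1 else 0) * W q) = 0"
      and iso: "jform n (lam - \<alpha>) X X + (\<beta> - lam) * (\<Sum>q<m. cnj (W q) * W q) = 0"
    have W: "W a = 0" if a: "a < m" for a
    proof -
      have "(\<Sum>q<m. (if a < m \<and> q = a then 1 else 0) * W q) = (\<Sum>q<m. if q = a then W q else 0)"
        by (intro sum.cong) (use a in auto)
      then show ?thesis using y[of a] a k by simp
    qed
    define S where "S = (\<Sum>p=1..n. (cmod (X p))\<^sup>2)"
    define S' where "S' = (\<Sum>q<m. (cmod (W q))\<^sup>2)"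
    have S': "S' = 0" using W by (simp add: S'_def)
    have "Re (cis \<theta> * (lam - \<alpha>)) * (S + S') \<le> cos (phi n (k - m)) * S + Re (cis \<theta> * (\<beta> - \<alpha>)) * S'"
      unfolding S_def S'_def
    proof (rule isotropic_vector_bound[where k = "k - m", OF X])
      show "1 \<le> k - m" using k by simp
      show "jform n (lam - \<alpha>) X X + (\<beta> - \<alpha> - (lam - \<alpha>)) * (\<Sum>q<m. cnj (W q) * W q) = 0" using iso by simp
      fix j :: nat assume j: "1 \<le> j" "j < k - m"
      then have "\<not> j - 1 + m < m" "Suc (j - 1 + m - m) = j" "j - 1 + m < k - 1" by auto
      then show "(\<Sum>q=1..n. of_real (sine_vec n j q) * cis (real q * \<theta>) * X q) = 0"
        using y[of "j - 1 + m"] by simp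
    qed simp
    then have "cmod (lam - \<alpha>) * S \<le> cos (phi n (k - m)) * S" unfolding S' z by simp
    moreover have "0 < S" using vector_norm_pos[OF nz] S' unfolding S_def S'_def by simp
    ultimately show ?thesis by simp
  qed
qed

text \<open>Carries the supporting inequalities to the tangent direction, where the strict condition
  behind them just fails.\<close>

lemma le_at_right_end:
  fixes f g :: "real \<Rightarrow> real"
  assumes "0 < T" and "\<And>t. 0 \<le> t \<Longrightarrow> t < T \<Longrightarrow> f t \<le> g t" and "isCont f T" "isCont g T"
  shows "f T \<le> g T"
proof (rule tendsto_le)
  show "at_left T \<noteq> bot" by simp
  show "(f \<longlongrightarrow> f T) (at_left T)" "(g \<longlongrightarrow> g T) (at_left T)"
    using assms(3,4) by (auto simp: isCont_def intro: tendsto_within_subset)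
  show "\<forall>\<^sub>F t in at_left T. f t \<le> g t"
    using assms(1,2) unfolding eventually_at_left_field by (intro exI[of _ 0]) auto
qed

text \<open>With \<open>z = \<rho> cis \<tau>\<close> and \<open>g = \<psi> - \<tau>\<close>, the supporting line in direction \<open>t\<close> gives
  \<open>\<rho> cos t \<le> d cos (t + g)\<close> as long as \<open>\<rho> cos t > a\<close>; the extreme case is \<open>\<rho> cos t = a\<close>.\<close>
lemma higher_rank_nr_Tmat_subset_kite:
  assumes lam: "lam \<in> higher_rank_nr k (Tmat n m \<alpha> \<beta>)" and k: "1 \<le> k" "2 * k \<le> n + 1"
    and z: "lam - \<alpha> = of_real \<rho> * cis \<tau>" and w: "\<beta> - \<alpha> = of_real d * cis \<psi>"
    and \<rho>: "cos (phi n k) < \<rho>" and g: "g = \<psi> - \<tau>"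
  shows "\<rho> \<le> d * cos g"
    and "\<bar>d * sin g\<bar> * sqrt (\<rho>\<^sup>2 - (cos (phi n k))\<^sup>2) \<le> cos (phi n k) * (d * cos g - \<rho>)"
proof -
  define a where "a = cos (phi n k)"
  have a: "0 \<le> a" unfolding a_def using cos_phi_nonneg k by simp
  have a\<rho>: "a < \<rho>" using \<rho> by (simp add: a_def)
  have supp: "\<rho> * cos t \<le> d * cos (t + g)" if t: "a < \<rho> * cos t" for t
  proof (rule ccontr)
    assume n: "\<not> ?thesis"
    \<comment> \<open>If the claim failed, \<open>c\<close> would lie strictly below
      \<open>\<rho> * cos t\<close>, against the support bound in direction
      \<open>t - \<tau>\<close>.\<close>
    define c where "c = max a (d * cos (t + g))"
    have "cis (t - \<tau>) * (\<beta> - \<alpha>) = of_real d * cis (t + g)" unfolding w g by (simp add: cis_mult algebra_simps)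
    then have 1: "Re (cis (t - \<tau>) * (\<beta> - \<alpha>)) = d * cos (t + g)" by simp
    have "cis (t - \<tau>) * (lam - \<alpha>) = of_real \<rho> * cis t" unfolding z by (simp add: cis_mult algebra_simps)
    then have 2: "Re (cis (t - \<tau>) * (lam - \<alpha>)) = \<rho> * cos t" by simp
    have "Re (cis (t - \<tau>) * (lam - \<alpha>)) \<le> c"
      by (rule higher_rank_nr_Tmat_support[OF lam k(1)]) (unfold 1, auto simp: c_def a_def)
    then show False using n t unfolding 2 c_def by simp
  qed
  show le: "\<rho> \<le> d * cos g" using supp[of 0] a\<rho> by simp
  \<comment> \<open>\<open>T\<close> and \<open>- T\<close> are the extreme directions, with
    \<open>\<rho> * cos T = a\<close>; \<open>supp\<close> applies only strictly between them, so
    continuity is needed. The two signs together produce the absolute value.\<close>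
  define T where "T = arccos (a / \<rho>)"
  have a\<rho>1: "0 \<le> a / \<rho>" "a / \<rho> < 1" using a a\<rho> by auto
  have "arccos 1 < T" unfolding T_def using a\<rho>1 by (intro arccos_less_arccos) auto
  then have T: "0 < T" by simp
  have Tpi: "T \<le> pi" unfolding T_def using a\<rho>1 by (intro arccos_ubound) auto
  have cT: "\<rho> * cos T = a" unfolding T_def using a\<rho>1 a a\<rho> by (simp add: cos_arccos_abs)
  have sT: "\<rho> * sin T = sqrt (\<rho>\<^sup>2 - a\<^sup>2)"
  proof -
    have "0 \<le> \<rho> * sin T" using T Tpi a a\<rho> by (intro mult_nonneg_nonneg sin_ge_zero) auto
    moreover have "(\<rho> * sin T)\<^sup>2 = \<rho>\<^sup>2 - a\<^sup>2"
      by (simp add: power_mult_distrib sin_squared_eq algebra_simps flip: cT)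
    ultimately show ?thesis by (metis real_sqrt_unique)
  qed
  have big: "a < \<rho> * cos t" if "0 \<le> t" "t < T" for t
  proof -
    have "cos T < cos t" using that Tpi by (intro cos_monotone_0_pi) auto
    then show ?thesis using a a\<rho> unfolding cT[symmetric] by (intro mult_strict_left_mono) auto
  qed
  have "\<rho> * cos T \<le> d * cos (T + g)"
    by (rule le_at_right_end[OF T, of "\<lambda>t. \<rho> * cos t" "\<lambda>t. d * cos (t + g)"]) (use supp big in auto)
  moreover have "\<rho> * cos T \<le> d * cos (- T + g)"
  proof (rule le_at_right_end[OF T, of "\<lambda>t. \<rho> * cos t" "\<lambda>t. d * cos (- t + g)"])
    show "\<rho> * cos t \<le> d * cos (- t + g)" if "0 \<le> t" "t < T" for t
      using supp[of "- t"] big[OF that] by simp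
  qed auto
  ultimately have "a \<le> d * (cos T * cos g - sin T * sin g)" "a \<le> d * (cos T * cos g + sin T * sin g)"
    unfolding cT by (simp_all add: cos_add cos_diff mult.commute)
  then have "\<rho> * a \<le> \<rho> * (d * (cos T * cos g - sin T * sin g))" "\<rho> * a \<le> \<rho> * (d * (cos T * cos g + sin T * sin g))"
    using a a\<rho> by (auto intro!: mult_left_mono)
  moreover have "\<rho> * (d * (cos T * cos g - sin T * sin g)) = (\<rho> * cos T) * (d * cos g) - (d * sin g) * (\<rho> * sin T)"
    "\<rho> * (d * (cos T * cos g + sin T * sin g)) = (\<rho> * cos T) * (d * cos g) + (d * sin g) * (\<rho> * sin T)"
    by (simp_all add: algebra_simps)
  ultimately have "(d * sin g) * sqrt (\<rho>\<^sup>2 - a\<^sup>2) \<le> a * (d * cos g - \<rho>)"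
    "- (d * sin g) * sqrt (\<rho>\<^sup>2 - a\<^sup>2) \<le> a * (d * cos g - \<rho>)"
    unfolding cT sT by (simp_all add: right_diff_distrib mult.commute)
  then have "\<bar>d * sin g\<bar> * sqrt (\<rho>\<^sup>2 - a\<^sup>2) \<le> a * (d * cos g - \<rho>)" by (simp add: abs_if)
  then show "\<bar>d * sin g\<bar> * sqrt (\<rho>\<^sup>2 - (cos (phi n k))\<^sup>2) \<le> cos (phi n k) * (d * cos g - \<rho>)"
    by (simp add: a_def)
qed

text \<open>Here \<beta> - \<alpha> is turned to the real axis, so \<open>\<psi> - \<tau>\<close>
  becomes \<open>- Arg \<mu>\<close>. Sufficiency and necessity lead to the same kite inequalities,
  and what remains for \<open>2 * k \<le> n + 1\<close> is plane geometry.\<close>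

lemma higher_rank_nr_Tmat_iff:
  assumes k: "1 \<le> k" "2 * k \<le> n + 1" and w: "\<beta> - \<alpha> = of_real d * cis \<psi>"
  defines "a \<equiv> cos (phi n k)"
  shows "\<alpha> + cis \<psi> * \<mu> \<in> higher_rank_nr k (Tmat n m \<alpha> \<beta>) \<longleftrightarrow> cmod \<mu> \<le> a \<or>
    (k \<le> m \<or> cmod \<mu> \<le> cos (phi n (k - m))) \<and> cmod \<mu> \<le> d * cos (Arg \<mu>) \<and>
    \<bar>d * sin (Arg \<mu>)\<bar> * sqrt ((cmod \<mu>)\<^sup>2 - a\<^sup>2) \<le> a * (d * cos (Arg \<mu>) - cmod \<mu>)"
    (is "?lam \<in> ?L \<longleftrightarrow> _ \<or> ?C")
proof -
  define \<rho> where "\<rho> = cmod \<mu>"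
  define \<tau> where "\<tau> = \<psi> + Arg \<mu>"
  have z: "?lam - \<alpha> = of_real \<rho> * cis \<tau>"
    using rcis_cmod_Arg[of \<mu>] by (simp add: \<rho>_def \<tau>_def rcis_def flip: cis_mult)
  have nz: "cmod (?lam - \<alpha>) = cmod \<mu>" by (simp add: norm_mult)
  show ?thesis
  proof (cases "cmod \<mu> \<le> a")
    case True
    then show ?thesis using higher_rank_nr_Tmat_disk[OF k(2), of ?lam \<alpha> m \<beta>] nz by (simp add: a_def)
  next
    case False
    then have \<rho>: "cos (phi n k) < \<rho>" by (simp add: \<rho>_def a_def)
    have "?C" if L: "?lam \<in> ?L"
    proof -
      have "k \<le> m \<or> cmod \<mu> \<le> cos (phi n (k - m))"
        using higher_rank_nr_Tmat_norm_le[OF L] nz by (cases "k \<le> m") auto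
      moreover have "- Arg \<mu> = \<psi> - \<tau>" by (simp add: \<tau>_def)
      note higher_rank_nr_Tmat_subset_kite[OF L k z w \<rho> this]
      ultimately show ?thesis by (simp add: \<rho>_def a_def)
    qed
    moreover have "?lam \<in> ?L" if C: ?C
    proof (rule higher_rank_nr_Tmat_kite[OF k z _ \<rho>])
      have "cis \<psi> = cis \<tau> * cis (- Arg \<mu>)" by (simp add: \<tau>_def cis_mult)
      then have "\<beta> - ?lam = cis \<tau> * (of_real d * cis (- Arg \<mu>) - of_real \<rho>)"
        using w z by (simp add: algebra_simps)
      also have "of_real d * cis (- Arg \<mu>) - of_real \<rho> = Complex (d * cos (Arg \<mu>) - \<rho>) (- (d * sin (Arg \<mu>)))"
        by (simp add: complex_eq_iff)
      finally show "\<beta> - ?lam = cis \<tau> * Complex (d * cos (Arg \<mu>) - \<rho>) (- (d * sin (Arg \<mu>)))" .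
      show "k \<le> m \<or> \<rho> \<le> cos (phi n (k - m))" "0 \<le> d * cos (Arg \<mu>) - \<rho>"
        "\<bar>- (d * sin (Arg \<mu>))\<bar> * sqrt (\<rho>\<^sup>2 - (cos (phi n k))\<^sup>2) \<le> cos (phi n k) * (d * cos (Arg \<mu>) - \<rho>)"
        using C by (auto simp: \<rho>_def a_def)
    qed
    ultimately show ?thesis using False by blast
  qed
qed

section \<open>The geometry of the kite\<close>

text \<open>With \<open>\<gamma> = \<bar>Arg \<mu>\<bar>\<close> and \<open>a = d cos \<delta> = \<bar>\<mu>\<bar> cos \<theta>\<close>, both sides say \<open>\<gamma> + \<theta> \<le> \<delta>\<close>.\<close>
lemma kite_polar:
  assumes a: "0 < a" and d: "a < d" and \<mu>: "a < cmod \<mu>" and \<delta>: "\<delta> = arccos (a / d)"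
  shows "cmod \<mu> \<le> d * cos (Arg \<mu>) \<and>
      \<bar>d * sin (Arg \<mu>)\<bar> * sqrt ((cmod \<mu>)\<^sup>2 - a\<^sup>2) \<le> a * (d * cos (Arg \<mu>) - cmod \<mu>)
    \<longleftrightarrow> a < d * cos (Arg \<mu>) \<and> Re \<mu> \<le> d \<and> (Re \<mu> - d) * cot \<delta> \<le> Im \<mu> \<and> Im \<mu> \<le> (d - Re \<mu>) * cot \<delta>"
    (is "?C \<longleftrightarrow> ?R")
proof -
  define \<rho> where "\<rho> = cmod \<mu>"
  define \<gamma> where "\<gamma> = \<bar>Arg \<mu>\<bar>"
  define \<theta> where "\<theta> = arccos (a / \<rho>)"
  have \<rho>: "a < \<rho>" using \<mu> by (simp add: \<rho>_def)
  have arc: "0 < arccos (a / r) \<and> arccos (a / r) < pi / 2 \<and> r * cos (arccos (a / r)) = a" if "a < r" for r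
  proof -
    have b: "0 < a / r" "a / r < 1" using a that by auto
    have "arccos 1 < arccos (a / r)" "arccos (a / r) < arccos 0" using b by (intro arccos_less_arccos; simp)+
    moreover have "cos (arccos (a / r)) = a / r" using b by (intro cos_arccos) auto
    ultimately show ?thesis using a that by simp
  qed
  have \<theta>: "0 < \<theta>" "\<theta> < pi / 2" "\<rho> * cos \<theta> = a" using arc[OF \<rho>] by (auto simp: \<theta>_def)
  have \<delta>': "0 < \<delta>" "\<delta> < pi / 2" "d * cos \<delta> = a" using arc[OF d] by (auto simp: \<delta>)
  have \<gamma>: "0 \<le> \<gamma>" "\<gamma> \<le> pi" using Arg_bounded[of \<mu>] by (auto simp: \<gamma>_def)
  have c: "cos (Arg \<mu>) = cos \<gamma>" by (simp add: \<gamma>_def)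
  have s0: "0 \<le> sin \<gamma>" using \<gamma> by (rule sin_ge_zero)
  have s: "\<bar>sin (Arg \<mu>)\<bar> = sin \<gamma>" using s0 by (auto simp: \<gamma>_def abs_if split: if_splits)
  have \<mu>p: "\<mu> = of_real \<rho> * cis (Arg \<mu>)" using rcis_cmod_Arg[of \<mu>] by (simp add: \<rho>_def rcis_def)
  have Re: "Re \<mu> = \<rho> * cos \<gamma>" by (subst \<mu>p) (simp add: c)
  have "\<bar>Im \<mu>\<bar> = \<rho> * \<bar>sin (Arg \<mu>)\<bar>" by (subst \<mu>p) (use a \<rho> in \<open>simp add: abs_mult\<close>)
  then have Im: "\<bar>Im \<mu>\<bar> = \<rho> * sin \<gamma>" by (simp add: s)
  have sq: "sqrt (\<rho>\<^sup>2 - a\<^sup>2) = \<rho> * sin \<theta>"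
  proof (rule real_sqrt_unique)
    show "(\<rho> * sin \<theta>)\<^sup>2 = \<rho>\<^sup>2 - a\<^sup>2"
      by (simp add: power_mult_distrib sin_squared_eq algebra_simps flip: \<theta>(3))
    show "0 \<le> \<rho> * sin \<theta>" using a \<rho> \<theta> by (intro mult_nonneg_nonneg sin_ge_zero) auto
  qed
  have C2: "\<bar>d * sin (Arg \<mu>)\<bar> * sqrt ((cmod \<mu>)\<^sup>2 - a\<^sup>2) \<le> a * (d * cos (Arg \<mu>) - cmod \<mu>) \<longleftrightarrow> cos \<delta> \<le> cos (\<gamma> + \<theta>)"
  proof -
    have e1: "\<bar>d * sin (Arg \<mu>)\<bar> * sqrt ((cmod \<mu>)\<^sup>2 - a\<^sup>2) = d * sin \<gamma> * (\<rho> * sin \<theta>)"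
      using a d s sq by (simp add: abs_mult \<rho>_def)
    have e2: "a * (d * cos (Arg \<mu>) - cmod \<mu>) = \<rho> * (d * (cos \<gamma> * cos \<theta>)) - \<rho> * (d * cos \<delta>)"
      unfolding c \<delta>'(3) \<rho>_def[symmetric] by (simp add: algebra_simps flip: \<theta>(3))
    have "\<bar>d * sin (Arg \<mu>)\<bar> * sqrt ((cmod \<mu>)\<^sup>2 - a\<^sup>2) \<le> a * (d * cos (Arg \<mu>) - cmod \<mu>)
      \<longleftrightarrow> \<rho> * (d * cos \<delta>) \<le> \<rho> * (d * cos (\<gamma> + \<theta>))"
      unfolding e1 e2 by (simp add: cos_add algebra_simps)
    also have "\<dots> \<longleftrightarrow> cos \<delta> \<le> cos (\<gamma> + \<theta>)" using a \<rho> d by simp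
    finally show ?thesis .
  qed
  have sd: "0 < sin \<delta>" using \<delta>' by (intro sin_gt_zero) auto
  have R2: "(Re \<mu> - d) * cot \<delta> \<le> Im \<mu> \<and> Im \<mu> \<le> (d - Re \<mu>) * cot \<delta> \<longleftrightarrow> cos (\<delta> - \<gamma>) \<le> cos \<theta>"
  proof -
    have "(Re \<mu> - d) * cot \<delta> = - ((d - Re \<mu>) * cot \<delta>)" by (simp add: algebra_simps)
    then have "(Re \<mu> - d) * cot \<delta> \<le> Im \<mu> \<and> Im \<mu> \<le> (d - Re \<mu>) * cot \<delta> \<longleftrightarrow> \<bar>Im \<mu>\<bar> \<le> (d - Re \<mu>) * cot \<delta>"
      by (auto simp: abs_le_iff)
    also have "\<dots> \<longleftrightarrow> \<rho> * sin \<gamma> * sin \<delta> \<le> (d - \<rho> * cos \<gamma>) * cos \<delta>"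
      unfolding Im Re cot_def using sd by (simp add: pos_le_divide_eq)
    also have "\<dots> \<longleftrightarrow> \<rho> * cos (\<delta> - \<gamma>) \<le> \<rho> * cos \<theta>"
      unfolding \<theta>(3) \<delta>'(3)[symmetric] by (simp add: cos_diff algebra_simps)
    also have "\<dots> \<longleftrightarrow> cos (\<delta> - \<gamma>) \<le> cos \<theta>" using a \<rho> by simp
    finally show ?thesis .
  qed
  show ?thesis
  proof
    assume C: ?C
    then have cc: "cos \<delta> \<le> cos (\<gamma> + \<theta>)" using C2 by blast
    have "0 < cos \<delta>" using \<delta>' by (intro cos_gt_zero) auto
    have le: "\<gamma> + \<theta> \<le> \<delta>"
    proof (cases "\<gamma> + \<theta> \<le> pi")
      case True
      show ?thesis using cc cos_mono_le_eq[of \<delta> "\<gamma> + \<theta>"] True \<gamma> \<theta> \<delta>' by auto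
    next
      \<comment> \<open>Cosine is monotone only up to \<pi>; a sum beyond \<pi> stays below
        \<open>3 * pi / 2\<close> and has cosine at most 0, less than
        \<open>cos \<delta>\<close>.\<close>
      case False
      have "0 \<le> cos (\<gamma> + \<theta> - pi)" using False \<gamma> \<theta> by (intro cos_ge_zero) auto
      then have "cos (\<gamma> + \<theta>) \<le> 0" by (simp add: cos_diff)
      then show ?thesis using cc \<open>0 < cos \<delta>\<close> by simp
    qed
    have "cos \<delta> < cos \<gamma>" using le \<gamma> \<theta> \<delta>' by (intro cos_monotone_0_pi) auto
    then have "d * cos \<delta> < d * cos \<gamma>" using a d by (intro mult_strict_left_mono) auto
    then have e: "a < d * cos (Arg \<mu>)" unfolding c \<delta>'(3) .
    have "cos (\<delta> - \<gamma>) \<le> cos \<theta>" using le \<gamma> \<theta> \<delta>' by (intro cos_monotone_0_pi_le) auto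
    moreover have "Re \<mu> \<le> d"
    proof -
      have "\<rho> \<le> d * cos \<gamma>" using C unfolding c \<rho>_def by blast
      also have "\<dots> \<le> d * 1" using a d by (intro mult_left_mono) auto
      finally show ?thesis using complex_Re_le_cmod[of \<mu>] by (simp add: \<rho>_def)
    qed
    ultimately show ?R using e R2 by blast
  next
    assume R: ?R
    then have cc: "cos (\<delta> - \<gamma>) \<le> cos \<theta>" using R2 by blast
    have "d * cos \<delta> < d * cos \<gamma>" using R unfolding c \<delta>'(3) by blast
    then have "cos \<delta> < cos \<gamma>" using a d by simp
    then have "\<gamma> < \<delta>" using cos_mono_less_eq[of \<delta> \<gamma>] \<gamma> \<delta>' by auto
    then have "\<theta> \<le> \<delta> - \<gamma>" using cc cos_mono_le_eq[of "\<delta> - \<gamma>" \<theta>] \<gamma> \<theta> \<delta>' by auto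
    then have "cos \<delta> \<le> cos (\<gamma> + \<theta>)" using \<gamma> \<theta> \<delta>' by (intro cos_monotone_0_pi_le) auto
    then have 2: "\<bar>d * sin (Arg \<mu>)\<bar> * sqrt ((cmod \<mu>)\<^sup>2 - a\<^sup>2) \<le> a * (d * cos (Arg \<mu>) - cmod \<mu>)" using C2 by blast
    moreover have "0 \<le> \<bar>d * sin (Arg \<mu>)\<bar> * sqrt ((cmod \<mu>)\<^sup>2 - a\<^sup>2)"
      using \<mu> a by (intro mult_nonneg_nonneg) (auto simp: power_mono)
    ultimately have "0 \<le> a * (d * cos (Arg \<mu>) - cmod \<mu>)" by linarith
    then have "cmod \<mu> \<le> d * cos (Arg \<mu>)" using a by (simp add: zero_le_mult_iff)
    then show ?C using 2 by blast
  qed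
qed

section \<open>Identification with the disk, the kite and the segment\<close>

lemma mem_rotated_image: "\<alpha> + cis \<psi> * \<mu> \<in> (\<lambda>\<mu>. \<alpha> + cis \<psi> * \<mu>) ` A \<longleftrightarrow> \<mu> \<in> A"
  by auto

lemma rotated_set_eqI:
  assumes "\<And>\<mu>. \<alpha> + cis \<psi> * \<mu> \<in> A \<longleftrightarrow> \<alpha> + cis \<psi> * \<mu> \<in> B"
  shows "A = B"
proof (rule Set.set_eqI)
  fix lam
  have "cis \<psi> * cis (- \<psi>) = 1" by (simp add: cis_mult)
  then have "lam = \<alpha> + cis \<psi> * (cis (- \<psi>) * (lam - \<alpha>))" by (simp flip: mult.assoc)
  then show "lam \<in> A \<longleftrightarrow> lam \<in> B" using assms by metis
qed

lemma mem_cball_rotated: "\<alpha> + cis \<psi> * \<mu> \<in> cball \<alpha> r \<longleftrightarrow> cmod \<mu> \<le> r"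
  by (simp add: dist_norm norm_mult)

lemma mem_kite_iff:
  fixes \<alpha> \<beta> :: complex and n k :: nat
  defines "d \<equiv> cmod (\<beta> - \<alpha>)" and "a \<equiv> cos (phi n k)"
  assumes "0 < a" "a < d" "a < cmod \<mu>"
  shows "\<alpha> + cis \<psi> * \<mu> \<in> Etilde_rot \<psi> n k \<alpha> \<beta> \<inter> Rset_rot \<psi> n d k \<alpha> \<beta> \<longleftrightarrow>
    cmod \<mu> \<le> d * cos (Arg \<mu>) \<and>
    \<bar>d * sin (Arg \<mu>)\<bar> * sqrt ((cmod \<mu>)\<^sup>2 - a\<^sup>2) \<le> a * (d * cos (Arg \<mu>) - cmod \<mu>)"
proof -
  have "\<beta> \<noteq> \<alpha>" using assms by auto
  then have "delta n k \<alpha> \<beta> = arccos (a / d)" using assms by (simp add: delta_def)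
  from kite_polar[OF assms(3-5) this] show ?thesis
    unfolding Etilde_rot_def Rset_rot_def Int_iff mem_rotated_image
    by (auto simp: Etilde_def Rset_def Dset_def a_def d_def)
qed

text \<open>The factor \<open>UNIV\<close> lets the cases \<open>k \<le> m\<close> and
  \<open>m < k\<close> share one proof. Inside the disk both sides hold; outside it the kite
  inequalities decide.\<close>

lemma higher_rank_nr_Tmat_eq_kite:
  assumes k: "1 \<le> k" "2 * k \<le> n" and w: "\<beta> - \<alpha> = of_real (cmod (\<beta> - \<alpha>)) * cis \<psi>"
    and d: "cos (phi n k) < cmod (\<beta> - \<alpha>)"
  shows "higher_rank_nr k (Tmat n m \<alpha> \<beta>) = cball \<alpha> (cos (phi n k)) \<union>
    (Etilde_rot \<psi> n k \<alpha> \<beta> \<inter> Rset_rot \<psi> n (cmod (\<beta> - \<alpha>)) k \<alpha> \<beta> \<inter>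
      (if k \<le> m then UNIV else cball \<alpha> (cos (phi n (k - m)))))"
proof (rule rotated_set_eqI[of \<alpha> \<psi>])
  fix \<mu>
  let ?e = "\<alpha> + cis \<psi> * \<mu>"
  have k': "2 * k \<le> n + 1" using k by simp
  have b: "?e \<in> (if k \<le> m then UNIV else cball \<alpha> (cos (phi n (k - m)))) \<longleftrightarrow> k \<le> m \<or> cmod \<mu> \<le> cos (phi n (k - m))"
    using mem_cball_rotated[of \<alpha> \<psi> \<mu>] by (cases "k \<le> m") simp_all
  show "?e \<in> higher_rank_nr k (Tmat n m \<alpha> \<beta>) \<longleftrightarrow> ?e \<in> cball \<alpha> (cos (phi n k)) \<union>
    (Etilde_rot \<psi> n k \<alpha> \<beta> \<inter> Rset_rot \<psi> n (cmod (\<beta> - \<alpha>)) k \<alpha> \<beta> \<inter>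
      (if k \<le> m then UNIV else cball \<alpha> (cos (phi n (k - m)))))"
  proof (cases "cmod \<mu> \<le> cos (phi n k)")
    case True
    then show ?thesis unfolding higher_rank_nr_Tmat_iff[OF k(1) k' w] Un_iff mem_cball_rotated by blast
  next
    case False
    then have "cos (phi n k) < cmod \<mu>" by simp
    from mem_kite_iff[OF cos_phi_pos[OF k(2)] d this, of \<psi>] False
    show ?thesis
      unfolding higher_rank_nr_Tmat_iff[OF k(1) k' w] Un_iff mem_cball_rotated Int_iff[of _ _ "if k \<le> m then UNIV else cball \<alpha> (cos (phi n (k - m)))"] b
      by blast
  qed
qed

text \<open>The kite inequalities force \<open>cmod \<mu> \<le> cmod (\<beta> - \<alpha>)\<close>,
  so they add no point outside the disk.\<close>

lemma higher_rank_nr_Tmat_eq_disk: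
  assumes k: "1 \<le> k" "2 * k \<le> n" and w: "\<beta> - \<alpha> = of_real (cmod (\<beta> - \<alpha>)) * cis \<psi>"
    and d: "cmod (\<beta> - \<alpha>) \<le> cos (phi n k)"
  shows "higher_rank_nr k (Tmat n m \<alpha> \<beta>) = cball \<alpha> (cos (phi n k))"
proof (rule rotated_set_eqI[of \<alpha> \<psi>])
  fix \<mu>
  have k': "2 * k \<le> n + 1" using k by simp
  have "cmod (\<beta> - \<alpha>) * cos (Arg \<mu>) \<le> cmod (\<beta> - \<alpha>) * 1" by (intro mult_left_mono) auto
  then have "cmod \<mu> \<le> cmod (\<beta> - \<alpha>) * cos (Arg \<mu>) \<Longrightarrow> cmod \<mu> \<le> cos (phi n k)" using d by simp
  then show "\<alpha> + cis \<psi> * \<mu> \<in> higher_rank_nr k (Tmat n m \<alpha> \<beta>) \<longleftrightarrow> \<alpha> + cis \<psi> * \<mu> \<in> cball \<alpha> (cos (phi n k))"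
    unfolding higher_rank_nr_Tmat_iff[OF k(1) k' w] mem_cball_rotated by blast
qed

text \<open>Now \<open>cos (phi n k) = 0\<close>: the disk shrinks to \<alpha>, and the kite
  inequalities force a nonzero \<open>\<mu>\<close> to be real and positive. The length
  \<open>L\<close> covers both the full segment, \<open>L = d\<close>, and the one cut off by the
  modulus bound.\<close>

lemma higher_rank_nr_Tmat_eq_segment:
  assumes k: "2 * k = n + 1" and w: "\<beta> - \<alpha> = of_real d * cis \<psi>" and L: "0 \<le> L" "L \<le> d"
    and Lk: "\<And>\<rho>. 0 \<le> \<rho> \<Longrightarrow> \<rho> \<le> d \<Longrightarrow> (k \<le> m \<or> \<rho> \<le> cos (phi n (k - m))) \<longleftrightarrow> \<rho> \<le> L"
  shows "higher_rank_nr k (Tmat n m \<alpha> \<beta>) = {\<alpha> + cis \<psi> * of_real (t * L) | t. t \<in> {0..1}}"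
proof (rule rotated_set_eqI[of \<alpha> \<psi>])
  fix \<mu>
  have k': "1 \<le> k" "2 * k \<le> n + 1" using k by auto
  have "real n + 1 = 2 * real k" using k by linarith
  then have "phi n k = pi / 2" using k' by (simp add: phi_def)
  then have a: "cos (phi n k) = 0" by (simp only: cos_pi_half)
  have mem: "\<alpha> + cis \<psi> * \<mu> \<in> {\<alpha> + cis \<psi> * of_real (t * L) | t. t \<in> {0..1}} \<longleftrightarrow> (\<exists>t\<in>{0..1}. \<mu> = of_real (t * L))"
    by auto
  have \<mu>p: "\<mu> = of_real (cmod \<mu>) * cis (Arg \<mu>)" using rcis_cmod_Arg[of \<mu>] by (simp add: rcis_def)
  have "(\<exists>t\<in>{0..1}. \<mu> = of_real (t * L)) \<longleftrightarrow> cmod \<mu> \<le> 0 \<or> (k \<le> m \<or> cmod \<mu> \<le> cos (phi n (k - m))) \<and>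
    cmod \<mu> \<le> d * cos (Arg \<mu>) \<and> \<bar>d * sin (Arg \<mu>)\<bar> * sqrt ((cmod \<mu>)\<^sup>2 - 0\<^sup>2) \<le> 0 * (d * cos (Arg \<mu>) - cmod \<mu>)"
    (is "?S \<longleftrightarrow> _ \<or> ?C")
  proof (cases "\<mu> = 0")
    case True
    then show ?thesis by (auto intro!: bexI[of _ 0])
  next
    case False
    have "?S" if C: ?C
    proof -
      have "cmod \<mu> * \<bar>d * sin (Arg \<mu>)\<bar> \<le> 0" using C by (simp add: mult.commute)
      then have ds: "d * sin (Arg \<mu>) = 0" using False by (simp add: mult_le_0_iff)
      have "0 < cmod \<mu>" using False by simp
      then have dc: "0 < d * cos (Arg \<mu>)" using C by linarith
      then have "d \<noteq> 0" by auto
      then have "0 < cos (Arg \<mu>)" "sin (Arg \<mu>) = 0" using ds dc L by (auto simp: zero_less_mult_iff)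
      then have "cos (Arg \<mu>) = 1" using sin_cos_squared_add[of "Arg \<mu>"] by (simp add: power2_eq_1_iff)
      then have cis: "cis (Arg \<mu>) = 1" using \<open>sin (Arg \<mu>) = 0\<close> by (simp add: complex_eq_iff)
      then have \<mu>r: "\<mu> = of_real (cmod \<mu>)" using \<mu>p by simp
      have "cmod \<mu> \<le> d" using C \<open>cos (Arg \<mu>) = 1\<close> by simp
      then have le: "cmod \<mu> \<le> L" using Lk[of "cmod \<mu>"] C by simp
      then have "0 < L" using False by (metis less_le_trans zero_less_norm_iff)
      then show ?S using \<mu>r le by (intro bexI[of _ "cmod \<mu> / L"]) auto
    qed
    moreover have "?C" if S: ?S
    proof -
      obtain t where t: "0 \<le> t" "t \<le> 1" "\<mu> = of_real (t * L)" using S by auto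
      have tL: "0 < t * L" using t False L by (simp add: less_le)
      have "t * L \<le> 1 * L" using t L by (intro mult_right_mono) auto
      then have le: "t * L \<le> L" by simp
      have n: "cmod \<mu> = t * L" unfolding t(3) norm_of_real using tL by simp
      have "Arg \<mu> = 0" unfolding t(3) using tL by (intro Arg_of_real[THEN trans]) auto
      then show ?C using Lk[of "cmod \<mu>"] n le L tL by simp
    qed
    moreover have "\<not> cmod \<mu> \<le> 0" using False by simp
    ultimately show ?thesis by blast
  qed
  then show "\<alpha> + cis \<psi> * \<mu> \<in> higher_rank_nr k (Tmat n m \<alpha> \<beta>) \<longleftrightarrow>
      \<alpha> + cis \<psi> * \<mu> \<in> {\<alpha> + cis \<psi> * of_real (t * L) | t. t \<in> {0..1}}"
    unfolding higher_rank_nr_Tmat_iff[OF k' w] mem a by blast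
qed

text \<open>Near the two directions in which \<open>\<beta> - \<alpha>\<close> has real part 0, the supporting lines of the numerical range
  pass through \<open>\<beta>\<close>.\<close>
lemma higher_rank_nr_Tmat_only_eigenvalue:
  assumes k: "n + 1 < 2 * k" and w: "\<beta> - \<alpha> = of_real d * cis \<psi>" and d: "0 \<le> d"
    and lam: "lam \<in> higher_rank_nr k (Tmat n m \<alpha> \<beta>)"
  shows "lam = \<beta>"
proof -
  have k1: "1 \<le> k" using k by simp
  \<comment> \<open>If \<open>\<bar>d * sin t\<bar> \<le> e\<close>, then
    \<open>- (d * sin t)\<close> is at least \<open>cos (phi n k)\<close> and is an admissible
    support value. For \<open>n < k\<close> any positive \<open>e\<close> would do;
    \<open>e \<le> 1\<close> later keeps \<open>t\<close> below \<pi>.\<close>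
  define e where "e = (if k \<le> n then - cos (phi n k) else 1)"
  have e: "0 < e" "e \<le> 1" using cos_phi_neg[OF k] by (auto simp: e_def neg_le_iff_le[of _ 1, simplified] intro: order_trans[OF _ cos_ge_minus_one] simp: minus_le_iff)
  \<comment> \<open>Rotation by \<open>pi / 2 - \<psi>\<close> makes \<beta> - \<alpha> purely
    imaginary; a further rotation by \<open>t\<close> gives it the real part
    \<open>- (d * sin t)\<close>.\<close>
  define D where "D = cis (pi / 2 - \<psi>) * (lam - \<beta>)"
  have le: "Re (cis t * D) \<le> 0" if t: "\<bar>d * sin t\<bar> \<le> e" for t
  proof -
    have "cis (t + (pi / 2 - \<psi>)) * (\<beta> - \<alpha>) = of_real d * cis (t + pi / 2)"
      unfolding w by (simp add: cis_mult algebra_simps)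
    then have 1: "Re (cis (t + (pi / 2 - \<psi>)) * (\<beta> - \<alpha>)) = - (d * sin t)" by (simp add: cos_add)
    have "Re (cis (t + (pi / 2 - \<psi>)) * (lam - \<alpha>)) \<le> - (d * sin t)"
    proof (rule higher_rank_nr_Tmat_support[OF lam k1])
      show "cos (phi n k) \<le> - (d * sin t)" if "k \<le> n"
        using t that unfolding e_def by (simp add: abs_le_iff)
    qed (simp only: 1 order_refl)
    moreover have "cis t * D = cis (t + (pi / 2 - \<psi>)) * (lam - \<alpha>) - cis (t + (pi / 2 - \<psi>)) * (\<beta> - \<alpha>)"
      by (simp add: D_def cis_mult algebra_simps flip: mult.assoc)
    ultimately show ?thesis using 1 by simp
  qed
  \<comment> \<open>Passing from \<open>t\<close> to \<open>t + pi\<close> keeps the modulus of the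
    sine and flips the sign of the real part.\<close>
  have eq: "Re (cis t * D) = 0" if t: "\<bar>d * sin t\<bar> \<le> e" for t
  proof -
    have "cis (t + pi) * D = - (cis t * D)" by (simp flip: cis_mult)
    then have "Re (cis (t + pi) * D) = - Re (cis t * D)" by simp
    moreover have "Re (cis (t + pi) * D) \<le> 0" using t by (intro le) simp
    ultimately show ?thesis using le[OF t] by simp
  qed
  have Re: "Re D = 0" using eq[of 0] e by simp
  \<comment> \<open>A small positive angle supplies, next to \<open>0\<close>, a second direction in
    which the real part of \<open>D\<close> vanishes, hence \<open>D = 0\<close>. The summand 1
    avoids division by zero when \<open>d = 0\<close>.\<close>
  define t where "t = e / (d + 1)"
  have t: "0 < t" "t \<le> e" using e d by (auto simp: t_def field_simps)
  have "sin t > 0" using t e pi_gt3 by (intro sin_gt_zero) auto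
  have "\<bar>sin t\<bar> \<le> t" using abs_sin_x_le_abs_x[of t] t by simp
  then have "\<bar>d * sin t\<bar> \<le> d * t" using d by (simp add: abs_mult mult_left_mono)
  also have "d * t \<le> e" using e d by (simp add: t_def field_simps)
  finally have "Re (cis t * D) = 0" by (rule eq)
  then have "Im D = 0" using Re \<open>sin t > 0\<close> by simp
  then have "D = 0" using Re by (simp add: complex_eq_iff)
  then show ?thesis by (simp add: D_def)
qed

section \<open>Assembly of the seven cases\<close>

theorem theorem3p7:
  fixes n m k :: nat and \<alpha> \<beta> :: complex and \<psi> :: real
  assumes "n \<ge> 2" and "m \<ge> 1" and "1 \<le> k" and "k \<le> n + m"
    and "\<beta> - \<alpha> = of_real (cmod (\<beta> - \<alpha>)) * cis \<psi>"
  defines "T \<equiv> Tmat n m \<alpha> \<beta>" and "d \<equiv> cmod (\<beta> - \<alpha>)"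
  shows
   "(2 * k \<le> n \<and> d \<le> cos (phi n k) \<longrightarrow>
       higher_rank_nr k T = cball \<alpha> (cos (phi n k)))
  \<and> (2 * k \<le> n \<and> k \<le> m \<and> d > cos (phi n k) \<longrightarrow>
       higher_rank_nr k T = cball \<alpha> (cos (phi n k)) \<union>
         (Etilde_rot \<psi> n k \<alpha> \<beta> \<inter> Rset_rot \<psi> n d k \<alpha> \<beta>))
  \<and> (2 * k \<le> n \<and> k > m \<and> d > cos (phi n k) \<longrightarrow>
       higher_rank_nr k T = cball \<alpha> (cos (phi n k)) \<union>
         (Etilde_rot \<psi> n k \<alpha> \<beta> \<inter> Rset_rot \<psi> n d k \<alpha> \<beta> \<inter> cball \<alpha> (cos (psi_km n k m))))
  \<and> ((2 * k = n + 1 \<and> k \<le> m) \<or> (2 * k = n + 1 \<and> k > m \<and> d \<le> cos (psi_km n k m)) \<longrightarrow>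
       higher_rank_nr k T = closed_segment \<alpha> \<beta>)
  \<and> (2 * k = n + 1 \<and> k > m \<and> d > cos (psi_km n k m) \<longrightarrow>
       higher_rank_nr k T =
         {\<alpha> + of_real t * (\<beta> - \<alpha>) * of_real (cos (eta n k m \<alpha> \<beta>)) | t. t \<in> {0..1}})
  \<and> ((n + 1 < 2 * k \<and> k \<le> m) \<or> (n + 1 < 2 * k \<and> m < k \<and> d \<le> cos (psi_km n k m)) \<longrightarrow>
       higher_rank_nr k T = {\<beta>})
  \<and> (n + 1 < 2 * k \<and> m < k \<and> d > cos (psi_km n k m) \<longrightarrow>
       higher_rank_nr k T = {})"
proof -
  note k1 = assms(3) and w = assms(5)
  have w': "\<beta> - \<alpha> = of_real d * cis \<psi>" using w by (simp only: d_def)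
  have d0: "0 \<le> d" by (simp add: d_def)
  have psi: "psi_km n k m = phi n (k - m)" if "m < k"
    using that by (simp add: psi_km_def phi_def of_nat_diff)
  have pt1: "higher_rank_nr k T = cball \<alpha> (cos (phi n k))" if "2 * k \<le> n" "d \<le> cos (phi n k)"
    using higher_rank_nr_Tmat_eq_disk[OF k1 that(1) w] that(2) by (simp add: T_def d_def)
  have pt2: "higher_rank_nr k T = cball \<alpha> (cos (phi n k)) \<union> (Etilde_rot \<psi> n k \<alpha> \<beta> \<inter> Rset_rot \<psi> n d k \<alpha> \<beta>)"
    if "2 * k \<le> n" "k \<le> m" "d > cos (phi n k)"
    using higher_rank_nr_Tmat_eq_kite[OF k1 that(1) w, of m] that(2,3) by (simp add: T_def d_def)
  have pt3: "higher_rank_nr k T = cball \<alpha> (cos (phi n k)) \<union>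
      (Etilde_rot \<psi> n k \<alpha> \<beta> \<inter> Rset_rot \<psi> n d k \<alpha> \<beta> \<inter> cball \<alpha> (cos (psi_km n k m)))"
    if "2 * k \<le> n" "k > m" "d > cos (phi n k)"
    using higher_rank_nr_Tmat_eq_kite[OF k1 that(1) w, of m] that(2,3) psi[OF that(2)] by (simp add: T_def d_def)
  have pt4: "higher_rank_nr k T = closed_segment \<alpha> \<beta>"
    if "2 * k = n + 1" "k \<le> m \<or> k > m \<and> d \<le> cos (psi_km n k m)"
  proof -
    have "higher_rank_nr k T = {\<alpha> + cis \<psi> * of_real (t * d) | t. t \<in> {0..1}}"
      unfolding T_def by (rule higher_rank_nr_Tmat_eq_segment[OF that(1) w' d0]) (use that(2) psi in auto)
    also have "\<alpha> + cis \<psi> * of_real (t * d) = (1 - t) *\<^sub>R \<alpha> + t *\<^sub>R \<beta>" for t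
    proof -
      have "\<beta> = \<alpha> + of_real d * cis \<psi>" using w' by (simp add: algebra_simps)
      then show ?thesis by (simp add: scaleR_conv_of_real algebra_simps)
    qed
    then have "{\<alpha> + cis \<psi> * of_real (t * d) | t. t \<in> {0..1}} = closed_segment \<alpha> \<beta>"
      by (auto simp: closed_segment_def)
    finally show ?thesis .
  qed
  have pt5: "higher_rank_nr k T = {\<alpha> + of_real t * (\<beta> - \<alpha>) * of_real (cos (eta n k m \<alpha> \<beta>)) | t. t \<in> {0..1}}"
    if "2 * k = n + 1" "k > m" "d > cos (psi_km n k m)"
  proof -
    define L where "L = cos (psi_km n k m)"
    have L0: "0 \<le> L" unfolding L_def psi[OF that(2)] using that(1) by (intro cos_phi_nonneg) simp
    have Ld: "L < d" using that by (simp add: L_def)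
    \<comment> \<open>Since \<open>0 \<le> L < d\<close>, the angle is on its \<open>arccos\<close>
      branch, so \<open>d\<close> times its cosine is the cut-off length \<open>L\<close>.\<close>
    have "eta n k m \<alpha> \<beta> = arccos (L / d)"
      using that L0 Ld by (auto simp: eta_def L_def d_def)
    moreover have "0 \<le> L / d" "L / d \<le> 1" using L0 Ld by auto
    then have "cos (arccos (L / d)) = L / d" by (intro cos_arccos) auto
    ultimately have "d * cos (eta n k m \<alpha> \<beta>) = L" using L0 Ld by simp
    then have "of_real t * (\<beta> - \<alpha>) * of_real (cos (eta n k m \<alpha> \<beta>)) = cis \<psi> * of_real (t * L)" for t
      unfolding w' by (auto simp: mult_ac)
    moreover have "higher_rank_nr k T = {\<alpha> + cis \<psi> * of_real (t * L) | t. t \<in> {0..1}}"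
      unfolding T_def by (rule higher_rank_nr_Tmat_eq_segment[OF that(1) w' L0])
        (use that(2) psi Ld in \<open>auto simp: L_def\<close>)
    ultimately show ?thesis by (simp only:)
  qed
  have sub: "higher_rank_nr k T \<subseteq> {\<beta>}" if "n + 1 < 2 * k"
    using higher_rank_nr_Tmat_only_eigenvalue[OF that w' d0] by (auto simp: T_def)
  have pt6: "higher_rank_nr k T = {\<beta>}"
    if "n + 1 < 2 * k" "k \<le> m \<or> m < k \<and> d \<le> cos (psi_km n k m)"
  proof -
    have "\<beta> \<in> higher_rank_nr k T"
      unfolding T_def
    proof (rule higher_rank_nr_Tmat_eigenvalue)
      show dk: "cmod (\<beta> - \<alpha>) \<le> cos (phi n (k - m))" if "m < k"
        using that \<open>k \<le> m \<or> m < k \<and> d \<le> cos (psi_km n k m)\<close> psi[OF that] by (auto simp: d_def)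
      \<comment> \<open>Otherwise \<open>cos (phi n (k - m))\<close> would be negative, yet it
        bounds a modulus; \<open>k \<le> n + m\<close> keeps the index at most
        \<open>n\<close>.\<close>
      show "2 * (k - m) \<le> n + 1"
      proof (rule ccontr)
        assume n: "\<not> ?thesis"
        then have "m < k" by simp
        moreover have "cos (phi n (k - m)) < 0" using n assms(4) by (intro cos_phi_neg) auto
        ultimately show False using dk norm_ge_zero[of "\<beta> - \<alpha>"] by linarith
      qed
    qed
    then show ?thesis using sub[OF that(1)] by blast
  qed
  have pt7: "higher_rank_nr k T = {}" if "n + 1 < 2 * k" "m < k" "d > cos (psi_km n k m)"
  proof -
    have "\<beta> \<notin> higher_rank_nr k T"
      using higher_rank_nr_Tmat_norm_le[OF _ that(2), of \<beta> n \<alpha> \<beta>] that(3) psi[OF that(2)]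
      by (auto simp: T_def d_def)
    then show ?thesis using sub[OF that(1)] by blast
  qed
  show ?thesis using pt1 pt2 pt3 pt4 pt5 pt6 pt7 by blast
qed

end
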